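(* Consider a causal Bayesian network $\mathbf M(V\|J)$ over quasi-universal spaces with graph $\mathbf G=(J,V,E)$, spaces $\mathcal X_v$ ($v\in J\,\dot\cup\,V$) and joint Markov kernel $\mathbf P(X_V\|X_J)\in\mathsf P(\mathcal X_V)^{\mathcal X_J}$. Assume that $\mathcal X_v$ is a standard quasi-universal space for every $v\in V$. Then for all (not necessarily disjoint) $A,B,C\subseteq J\,\dot\cup\,V$ we have the implication $$A\perp_{\mathbf G}B\mid C\quad\Longrightarrow\quad X_A\perp\!\!\!\perp_{\mathbf P(X_V\|X_J)}X_B\mid X_C.$$
   Context: Sample space: $\Omega=[0,1]^{\mathbb N}$, $\mathcal B_\Omega$ the $\sigma$-algebra of all universally measurable subsets, $\Omega^\Omega$ all measurable maps $(\Omega,\mathcal B_\Omega)\to(\Omega,\mathcal B_\Omega)$. A quasi-universal space is a pair $(\mathcal X,\mathcal X^\Omega)$ of a set and a set $\mathcal X^\Omega$ of maps $\Omega\to\mathcal X$ containing all constants and closed under $X\mapsto X\circ\Phi$, $\Phi\in\Omega^\Omega$; $g:\mathcal X\to\mathcal Y$ is quasi-measurable if $g\circ\mathcal X^\Omega\subseteq\mathcal Y^\Omega$; products carry componentwise structure; $\mathcal X^{\mathcal Z}$ is the set of quasi-measurable maps $\mathcal Z\to\mathcal X$; $(\mathcal X^\Omega)^\Omega$ is the set of maps $X:\Omega\to\mathcal X^\Omega$ with $(\omega,\omega')\mapsto X(\omega)(\omega')$ quasi-measurable. A space is standard if it is empty or a retract of $(\Omega,\Omega^\Omega)$, i.e.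 there are quasi-measurable $i:\mathcal X\to\Omega$, $r:\Omega\to\mathcal X$ with $r\circ i=\mathrm{id}$. Induced $\sigma$-algebra: $\mathcal B_{\mathcal X}=\{A\mid X^{-1}(A)\in\mathcal B_\Omega\ \forall X\in\mathcal X^\Omega\}$. $\mathsf P(\mathcal X)$ is the quasi-universal space of push-forwards $X_*P$ on $\mathcal B_{\mathcal X}$, $X\in\mathcal X^\Omega$, $P$ a probability measure on $(\Omega,\mathcal B_\Omega)$, with admissible random variables the maps $\omega\mapsto X(\omega)_*P$, $X\in(\mathcal X^\Omega)^\Omega$. Elements of $\mathsf P(\mathcal X)^{\mathcal Z}$ are Markov kernels; their product is $(K(X|Y,Z)\otimes Q(Y|Z))(D|z)=\int K(X\in D^y|Y=y,Z=z)\,Q(Y\in dy|Z=z)$, $D^y=\{x\mid(x,y)\in D\}$ (kernels are regarded as constant in missing conditioning variables; factors are reordered as needed). A conditional directed acyclic graph (CDAG) $\mathbf G=(J,V,E)$ consists of disjoint sets $J$ (input nodes) and $V$ (output nodes), here finite, and a set $E$ of directed edges $w\to v$ with $w\in J\cup V$, $v\in V$, without non-trivial directed cycles. $\mathrm{Pa}(v)=\{w\mid w\to v\in E\}$; $\mathrm{Anc}(C)$ is the set of nodes $w$ with a directed walk (possibly trivial) from $w$ to some node of $C$. A walk is a finite sequence of nodes and edges $v_0,\dots,v_n$ ($n\ge0$), consecutive nodes joined by an edge in either direction, repetitions allowed. A walk is blocked by $C$ if $v_0\in C$ or $v_n\in C$ or it contains two adjacent edges forming a non-collider $v_{k-1}\leftarrow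 v_k\leftarrow v_{k+1}$, $v_{k-1}\to v_k\to v_{k+1}$ or $v_{k-1}\leftarrow v_k\to v_{k+1}$ with $v_k\in C$, or a collider $v_{k-1}\to v_k\leftarrow v_{k+1}$ with $v_k\notin\mathrm{Anc}(C)$. $A\perp_{\mathbf G}B\mid C$ means that every walk from a node in $A$ to a node in $J\cup B$ is blocked by $C$ (note the inclusion of $J$). A causal Bayesian network consists of a finite CDAG $\mathbf G=(J,V,E)$, a quasi-universal space $\mathcal X_v$ for every $v\in J\,\dot\cup\,V$, and a Markov kernel $\mathbf P_v(X_v\|X_{\mathrm{Pa}(v)})\in\mathsf P(\mathcal X_v)^{\mathcal X_{\mathrm{Pa}(v)}}$ for every $v\in V$, where $\mathcal X_D:=\prod_{v\in D}\mathcal X_v$ and $\mathcal X_\emptyset$ is the one-point space. Its joint Markov kernel is $\mathbf P(X_V\|X_J):=\bigotimes_{v\in V}\mathbf P_v(X_v\|X_{\mathrm{Pa}(v)})\in\mathsf P(\mathcal X_V)^{\mathcal X_J}$, the product taken in reverse of a topological order (children to the left of their parents); it does not depend on the chosen topological order. For $D\subseteq J\,\dot\cup\,V$, $X_D$ denotes the projection $\mathcal X_V\times\mathcal X_J\to\mathcal X_D$; for $A,B,C\subseteq J\,\dot\cup\,V$, $\mathbf P(X_A,X_B,X_C\|X_J)$ is the Markov kernel sending $x_J$ to the distribution of $(X_A,X_B,X_C)$ under $\mathbf P(X_V\|X_J=x_J)\otimes\delta_{x_J}$, and analogously for fewer variables. $X_A\perp\!\!\!\perp_{\mathbf P(X_V\|X_J)}X_B\mid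 X_C$ means: there is a Markov kernel $\mathbf Q(X_A|X_C)\in\mathsf P(\mathcal X_A)^{\mathcal X_C}$ with $\mathbf P(X_A,X_B,X_C\|X_J)=\mathbf Q(X_A|X_C)\otimes\mathbf P(X_B,X_C\|X_J)$ as Markov kernels in $\mathsf P(\mathcal X_A\times\mathcal X_B\times\mathcal X_C)^{\mathcal X_J}$. *)

theory Defs
  imports "HOL-Probability.Probability"
begin

section \<open>The sample space\<close>

text \<open>The unit interval is made a type, so that \<open>[0,1]\<^sup>\<nat>\<close> is a full function type and maps
  out of the sample space need no extensionality convention.\<close>

typedef unit_interval = "{0..1 :: real}"
  by (rule exI[of _ 0]) simp

type_synonym omega = "nat \<Rightarrow> unit_interval"

definition borel_omega :: "omega measure" where
  "borel_omega = (\<Pi>\<^sub>M n\<in>UNIV. vimage_algebra UNIV Rep_unit_interval borel)"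

definition universally_measurable_sets :: "'a measure \<Rightarrow> 'a set set" where
  "universally_measurable_sets M =
     {A. A \<subseteq> space M \<and> (\<forall>\<mu>\<in>space (prob_algebra M). A \<in> sets (completion \<mu>))}"

definition universal_omega :: "omega measure" where
  "universal_omega = sigma UNIV (universally_measurable_sets borel_omega)"

lemma space_borel_omega [simp]: "space borel_omega = UNIV"
  by (simp add: borel_omega_def space_PiM)

lemma space_universal_omega [simp]: "space universal_omega = UNIV"
  by (simp add: universal_omega_def space_measure_of_conv)

lemma sigma_algebra_universally_measurable_sets:
  "sigma_algebra (space M) (universally_measurable_sets M)"
proof -
  have sp: "space (completion \<mu>) = space M" if "\<mu> \<in> space (prob_algebra M)" for \<mu>
    using that by (auto simp: space_prob_algebra dest: sets_eq_imp_space_eq)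
  have "space M - A \<in> universally_measurable_sets M" if "A \<in> universally_measurable_sets M" for A
  proof -
    have "space M - A \<in> sets (completion \<mu>)" if "\<mu> \<in> space (prob_algebra M)" for \<mu>
      using \<open>A \<in> _\<close> that sets.compl_sets[of A "completion \<mu>"] sp[OF that]
      by (simp add: universally_measurable_sets_def)
    then show ?thesis
      by (simp add: universally_measurable_sets_def)
  qed
  moreover have "(\<Union>i. A i) \<in> universally_measurable_sets M"
    if "range A \<subseteq> universally_measurable_sets M" for A :: "nat \<Rightarrow> 'a set"
  proof -
    have A: "A i \<in> universally_measurable_sets M" for i
      using that by auto
    then have "(\<Union>i. A i) \<in> sets (completion \<mu>)" if "\<mu> \<in> space (prob_algebra M)" for \<mu>
      using that by (intro sets.countable_UN) (auto simp: universally_measurable_sets_def)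
    then show ?thesis
      using A by (auto simp: universally_measurable_sets_def)
  qed
  ultimately show ?thesis
    by (auto simp: sigma_algebra_iff2 universally_measurable_sets_def)
qed

lemma sets_universal_omega: "sets universal_omega = universally_measurable_sets borel_omega"
  using sigma_algebra.sets_measure_of_eq[OF
      sigma_algebra_universally_measurable_sets[of borel_omega]]
  by (simp add: universal_omega_def)

section \<open>Quasi-universal spaces\<close>

record 'a quspace =
  points :: "'a set"
  rvars :: "(omega \<Rightarrow> 'a) set"

definition quasi_universal_space :: "'a quspace \<Rightarrow> bool" where
  "quasi_universal_space X \<longleftrightarrow>
     rvars X \<subseteq> UNIV \<rightarrow> points X \<and>
     (\<forall>x\<in>points X. (\<lambda>_. x) \<in> rvars X) \<and>
     (\<forall>\<xi>\<in>rvars X. \<forall>\<Phi>\<in>universal_omega \<rightarrow>\<^sub>M universal_omega. \<xi> \<circ> \<Phi> \<in> rvars X)"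

definition quasi_measurable :: "'a quspace \<Rightarrow> 'b quspace \<Rightarrow> ('a \<Rightarrow> 'b) set" where
  "quasi_measurable X Y = {g \<in> points X \<rightarrow> points Y. \<forall>\<xi>\<in>rvars X. g \<circ> \<xi> \<in> rvars Y}"

definition omega_space :: "omega quspace" where
  "omega_space = \<lparr>points = UNIV, rvars = universal_omega \<rightarrow>\<^sub>M universal_omega\<rparr>"

definition prod_space :: "'a quspace \<Rightarrow> 'b quspace \<Rightarrow> ('a \<times> 'b) quspace" where
  "prod_space X Y =
     \<lparr>points = points X \<times> points Y,
      rvars = {\<zeta>. fst \<circ> \<zeta> \<in> rvars X \<and> snd \<circ> \<zeta> \<in> rvars Y}\<rparr>"

text \<open>Families are extensional functions; for \<open>D = {}\<close> this is the one-point space.\<close>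

definition Pi_space :: "'n set \<Rightarrow> ('n \<Rightarrow> 'a quspace) \<Rightarrow> ('n \<Rightarrow> 'a) quspace" where
  "Pi_space D X =
     \<lparr>points = (\<Pi>\<^sub>E v\<in>D. points (X v)),
      rvars = {\<xi>. (\<forall>\<omega>. \<xi> \<omega> \<in> extensional D) \<and> (\<forall>v\<in>D. (\<lambda>\<omega>. \<xi> \<omega> v) \<in> rvars (X v))}\<rparr>"

definition standard_space :: "'a quspace \<Rightarrow> bool" where
  "standard_space X \<longleftrightarrow>
     points X = {} \<or>
     (\<exists>i\<in>quasi_measurable X omega_space. \<exists>r\<in>quasi_measurable omega_space X.
        \<forall>x\<in>points X. r (i x) = x)"

definition induced_sets :: "'a quspace \<Rightarrow> 'a set set" where
  "induced_sets X = {A. A \<subseteq> points X \<and> (\<forall>\<xi>\<in>rvars X. \<xi> -` A \<in> sets universal_omega)}"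

definition induced :: "'a quspace \<Rightarrow> 'a measure" where
  "induced X = sigma (points X) (induced_sets X)"

lemma space_induced [simp]: "space (induced X) = points X"
  by (simp add: induced_def space_measure_of_conv)

lemma sets_induced:
  assumes "quasi_universal_space X"
  shows "sets (induced X) = induced_sets X"
proof -
  have "\<xi> -` (points X - A) \<in> sets universal_omega"
    if "\<xi> \<in> rvars X" "A \<in> induced_sets X" for \<xi> A
  proof -
    have "\<xi> \<in> UNIV \<rightarrow> points X"
      using assms that(1) unfolding quasi_universal_space_def by (meson subsetD)
    then have "\<xi> \<omega> \<in> points X" for \<omega>
      by (rule Pi_mem) simp
    then have "\<xi> -` (points X - A) = space universal_omega - \<xi> -` A"
      by auto
    moreover have "\<xi> -` A \<in> sets universal_omega"
      using that by (simp add: induced_sets_def)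
    ultimately show ?thesis
      by (simp only: sets.compl_sets)
  qed
  moreover have "(\<Union>i. A i) \<in> induced_sets X" if "range A \<subseteq> induced_sets X" for A :: "nat \<Rightarrow> 'a set"
  proof -
    have A: "A i \<in> induced_sets X" for i
      using that by auto
    then have "(\<Union>i. \<xi> -` A i) \<in> sets universal_omega" if "\<xi> \<in> rvars X" for \<xi>
      using that by (intro sets.countable_UN) (auto simp: induced_sets_def)
    then show ?thesis
      using A by (auto simp: induced_sets_def vimage_UN)
  qed
  ultimately have "sigma_algebra (points X) (induced_sets X)"
    by (auto simp: sigma_algebra_iff2 induced_sets_def)
  then show ?thesis
    by (simp add: induced_def sigma_algebra.sets_measure_of_eq)
qed

section \<open>Markov kernels\<close>

definition rvars_rvars :: "'a quspace \<Rightarrow> (omega \<Rightarrow> omega \<Rightarrow> 'a) set" where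
  "rvars_rvars X =
     {\<Xi>. (\<forall>\<omega>. \<Xi> \<omega> \<in> rvars X) \<and>
         (\<lambda>(\<omega>, \<omega>'). \<Xi> \<omega> \<omega>') \<in> quasi_measurable (prod_space omega_space omega_space) X}"

definition P_space :: "'a quspace \<Rightarrow> 'a measure quspace" where
  "P_space X =
     \<lparr>points = {distr P (induced X) \<xi> | \<xi> P.
                  \<xi> \<in> rvars X \<and> P \<in> space (prob_algebra universal_omega)},
      rvars = {(\<lambda>\<omega>. distr P (induced X) (\<Xi> \<omega>)) | \<Xi> P.
                  \<Xi> \<in> rvars_rvars X \<and> P \<in> space (prob_algebra universal_omega)}\<rparr>"

definition markov_kernels :: "'z quspace \<Rightarrow> 'a quspace \<Rightarrow> ('z \<Rightarrow> 'a measure) set" where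
  "markov_kernels Z X = quasi_measurable Z (P_space X)"

text \<open>The product \<open>K(X|Y,Z) \<otimes> Q(Y|Z)\<close>. It lives on the \<open>\<sigma>\<close>-algebra induced by the product
  space, which is in general larger than the product of the induced \<open>\<sigma>\<close>-algebras.\<close>

definition kernel_prod ::
  "'x quspace \<Rightarrow> 'y quspace \<Rightarrow> ('y \<times> 'z \<Rightarrow> 'x measure) \<Rightarrow> ('z \<Rightarrow> 'y measure) \<Rightarrow>
   'z \<Rightarrow> ('x \<times> 'y) measure" where
  "kernel_prod X Y K Q z =
     measure_of (points (prod_space X Y)) (induced_sets (prod_space X Y))
       (\<lambda>D. \<integral>\<^sup>+ y. emeasure (K (y, z)) {x. (x, y) \<in> D} \<partial>Q z)"

section \<open>Conditional directed acyclic graphs\<close>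

record 'n cdgraph =
  inputs :: "'n set"
  outputs :: "'n set"
  edges :: "('n \<times> 'n) set"

definition nodes :: "'n cdgraph \<Rightarrow> 'n set" where
  "nodes G = inputs G \<union> outputs G"

definition CDAG :: "'n cdgraph \<Rightarrow> bool" where
  "CDAG G \<longleftrightarrow>
     finite (inputs G) \<and> finite (outputs G) \<and> inputs G \<inter> outputs G = {} \<and>
     edges G \<subseteq> nodes G \<times> outputs G \<and> acyclic (edges G)"

definition Pa :: "'n cdgraph \<Rightarrow> 'n \<Rightarrow> 'n set" where
  "Pa G v = {w. (w, v) \<in> edges G}"

definition Anc :: "'n cdgraph \<Rightarrow> 'n set \<Rightarrow> 'n set" where
  "Anc G C = {w \<in> nodes G. \<exists>c\<in>C. (w, c) \<in> (edges G)\<^sup>*}"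

text \<open>In a CDAG two adjacent nodes are joined by exactly one edge, so a walk is determined by its
  nodes.\<close>

definition walk :: "'n cdgraph \<Rightarrow> 'n list \<Rightarrow> bool" where
  "walk G \<pi> \<longleftrightarrow>
     \<pi> \<noteq> [] \<and> set \<pi> \<subseteq> nodes G \<and>
     (\<forall>k. Suc k < length \<pi> \<longrightarrow>
        (\<pi> ! k, \<pi> ! Suc k) \<in> edges G \<or> (\<pi> ! Suc k, \<pi> ! k) \<in> edges G)"

definition collider :: "'n cdgraph \<Rightarrow> 'n \<Rightarrow> 'n \<Rightarrow> 'n \<Rightarrow> bool" where
  "collider G a b c \<longleftrightarrow> (a, b) \<in> edges G \<and> (c, b) \<in> edges G"

definition non_collider :: "'n cdgraph \<Rightarrow> 'n \<Rightarrow> 'n \<Rightarrow> 'n \<Rightarrow> bool" where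
  "non_collider G a b c \<longleftrightarrow>
     (b, a) \<in> edges G \<and> (c, b) \<in> edges G \<or>
     (a, b) \<in> edges G \<and> (b, c) \<in> edges G \<or>
     (b, a) \<in> edges G \<and> (b, c) \<in> edges G"

definition blocked :: "'n cdgraph \<Rightarrow> 'n set \<Rightarrow> 'n list \<Rightarrow> bool" where
  "blocked G C \<pi> \<longleftrightarrow>
     hd \<pi> \<in> C \<or> last \<pi> \<in> C \<or>
     (\<exists>k. Suc (Suc k) < length \<pi> \<and>
        (non_collider G (\<pi> ! k) (\<pi> ! Suc k) (\<pi> ! Suc (Suc k)) \<and> \<pi> ! Suc k \<in> C \<or>
         collider G (\<pi> ! k) (\<pi> ! Suc k) (\<pi> ! Suc (Suc k)) \<and> \<pi> ! Suc k \<notin> Anc G C))"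

text \<open>Walks ending in an input node must be blocked as well, which makes the relation
  asymmetric in \<open>A\<close> and \<open>B\<close>.\<close>

definition separated :: "'n cdgraph \<Rightarrow> 'n set \<Rightarrow> 'n set \<Rightarrow> 'n set \<Rightarrow> bool" where
  "separated G A B C \<longleftrightarrow>
     (\<forall>\<pi>. walk G \<pi> \<and> hd \<pi> \<in> A \<and> last \<pi> \<in> inputs G \<union> B \<longrightarrow> blocked G C \<pi>)"

definition topological_order :: "'n cdgraph \<Rightarrow> 'n list \<Rightarrow> bool" where
  "topological_order G vs \<longleftrightarrow>
     distinct vs \<and> set vs = outputs G \<and>
     (\<forall>i j. i < j \<longrightarrow> j < length vs \<longrightarrow> (vs ! j, vs ! i) \<notin> edges G)"

lemma topological_order_exists:
  assumes "CDAG G"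
  shows "\<exists>vs. topological_order G vs"
proof -
  have "\<exists>vs. distinct vs \<and> set vs = S \<and>
          (\<forall>i j. i < j \<longrightarrow> j < length vs \<longrightarrow> (vs ! j, vs ! i) \<notin> edges G)"
    if "finite S" for S
    using that
  proof (induction S rule: finite_remove_induct)
    case empty
    then show ?case by simp
  next
    case (remove S)
    have "finite (edges G \<inter> S \<times> S)" "acyclic (edges G \<inter> S \<times> S)"
      using remove assms by (auto simp: CDAG_def intro: acyclic_subset)
    then have "wf (edges G \<inter> S \<times> S)"
      by (rule finite_acyclic_wf)
    moreover obtain u where "u \<in> S"
      using remove.hyps(2) by blast
    ultimately obtain v where v: "v \<in> S" "\<And>w. (w, v) \<in> edges G \<inter> S \<times> S \<Longrightarrow> w \<notin> S"
      by (rule wfE_min) blast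
    obtain vs where vs: "distinct vs" "set vs = S - {v}"
      "\<forall>i j. i < j \<longrightarrow> j < length vs \<longrightarrow> (vs ! j, vs ! i) \<notin> edges G"
      using remove.IH[OF v(1)] by blast
    have "((v # vs) ! j, (v # vs) ! i) \<notin> edges G" if "i < j" "j < length (v # vs)" for i j
    proof (cases i)
      case 0
      then have "(v # vs) ! j \<in> set vs"
        using that by (cases j) auto
      then have "(v # vs) ! j \<in> S"
        using vs(2) by blast
      then have "((v # vs) ! j, v) \<notin> edges G"
        using v by blast
      then show ?thesis
        using 0 by simp
    next
      case (Suc i')
      then show ?thesis
        using that vs(3) by (cases j) simp_all
    qed
    then show ?case
      using vs v(1) by (intro exI[of _ "v # vs"]) auto
  qed
  then show ?thesis
    using assms by (auto simp: CDAG_def topological_order_def)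
qed

section \<open>Causal Bayesian networks\<close>

text \<open>As for \<^const>\<open>PiM\<close>, all node spaces are carried by subsets of one type, which may be
  taken to be a disjoint union.\<close>

record ('n, 'a) bayes_net =
  graph :: "'n cdgraph"
  node_space :: "'n \<Rightarrow> 'a quspace"
  mechanism :: "'n \<Rightarrow> ('n \<Rightarrow> 'a) \<Rightarrow> 'a measure"

definition X_space :: "('n, 'a) bayes_net \<Rightarrow> 'n set \<Rightarrow> ('n \<Rightarrow> 'a) quspace" where
  "X_space M D = Pi_space D (node_space M)"

definition causal_bayesian_network :: "('n, 'a) bayes_net \<Rightarrow> bool" where
  "causal_bayesian_network M \<longleftrightarrow>
     CDAG (graph M) \<and>
     (\<forall>v\<in>nodes (graph M). quasi_universal_space (node_space M v)) \<and>
     (\<forall>v\<in>outputs (graph M).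
        mechanism M v \<in> markov_kernels (X_space M (Pa (graph M) v)) (node_space M v))"

text \<open>The list is in reverse topological order: its head is multiplied on the left, and the
  resulting point of \<open>\<X>\<^sub>v \<times> \<X>\<^bsub>set vs\<^esub>\<close> is re-read as a point of \<open>\<X>\<^bsub>insert v (set vs)\<^esub>\<close>.\<close>

fun kernel_along :: "('n, 'a) bayes_net \<Rightarrow> 'n list \<Rightarrow> ('n \<Rightarrow> 'a) \<Rightarrow> ('n \<Rightarrow> 'a) measure" where
  "kernel_along M [] xJ = return (induced (X_space M {})) (\<lambda>_. undefined)"
| "kernel_along M (v # vs) xJ =
     distr
       (kernel_prod (node_space M v) (X_space M (set vs))
          (\<lambda>(y, xJ). mechanism M v
             (restrict (merge (set vs) (inputs (graph M)) (y, xJ)) (Pa (graph M) v)))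
          (kernel_along M vs) xJ)
       (induced (X_space M (insert v (set vs))))
       (\<lambda>(x, y). y(v := x))"

text \<open>The joint kernel \<open>P(X\<^sub>V \<parallel> X\<^sub>J)\<close>, computed along a topological order \<open>vs\<close> of the outputs.\<close>

definition joint_kernel :: "('n, 'a) bayes_net \<Rightarrow> 'n list \<Rightarrow> ('n \<Rightarrow> 'a) \<Rightarrow> ('n \<Rightarrow> 'a) measure" where
  "joint_kernel M vs = kernel_along M (rev vs)"

section \<open>Conditional independence\<close>

definition X_proj ::
  "('n, 'a) bayes_net \<Rightarrow> 'n set \<Rightarrow> ('n \<Rightarrow> 'a) \<times> ('n \<Rightarrow> 'a) \<Rightarrow> 'n \<Rightarrow> 'a" where
  "X_proj M D xVJ = restrict (merge (outputs (graph M)) (inputs (graph M)) xVJ) D"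

text \<open>\<open>P(X\<^sub>V \<parallel> X\<^sub>J = x\<^sub>J) \<otimes> \<delta>\<close>, with \<open>\<delta>\<close> the point mass at \<open>x\<^sub>J\<close>.\<close>

definition extended_kernel ::
  "('n, 'a) bayes_net \<Rightarrow> (('n \<Rightarrow> 'a) \<Rightarrow> ('n \<Rightarrow> 'a) measure) \<Rightarrow>
   ('n \<Rightarrow> 'a) \<Rightarrow> (('n \<Rightarrow> 'a) \<times> ('n \<Rightarrow> 'a)) measure" where
  "extended_kernel M P =
     kernel_prod (X_space M (outputs (graph M))) (X_space M (inputs (graph M)))
       (\<lambda>(_, xJ). P xJ)
       (\<lambda>xJ. return (induced (X_space M (inputs (graph M)))) xJ)"

definition marginal2 ::
  "('n, 'a) bayes_net \<Rightarrow> (('n \<Rightarrow> 'a) \<Rightarrow> ('n \<Rightarrow> 'a) measure) \<Rightarrow> 'n set \<Rightarrow> 'n set \<Rightarrow>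
   ('n \<Rightarrow> 'a) \<Rightarrow> (('n \<Rightarrow> 'a) \<times> ('n \<Rightarrow> 'a)) measure" where
  "marginal2 M P B C xJ =
     distr (extended_kernel M P xJ)
       (induced (prod_space (X_space M B) (X_space M C)))
       (\<lambda>x. (X_proj M B x, X_proj M C x))"

definition marginal3 ::
  "('n, 'a) bayes_net \<Rightarrow> (('n \<Rightarrow> 'a) \<Rightarrow> ('n \<Rightarrow> 'a) measure) \<Rightarrow> 'n set \<Rightarrow> 'n set \<Rightarrow> 'n set \<Rightarrow>
   ('n \<Rightarrow> 'a) \<Rightarrow> (('n \<Rightarrow> 'a) \<times> ('n \<Rightarrow> 'a) \<times> ('n \<Rightarrow> 'a)) measure" where
  "marginal3 M P A B C xJ =
     distr (extended_kernel M P xJ)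
       (induced (prod_space (X_space M A) (prod_space (X_space M B) (X_space M C))))
       (\<lambda>x. (X_proj M A x, X_proj M B x, X_proj M C x))"

definition cond_independent ::
  "('n, 'a) bayes_net \<Rightarrow> (('n \<Rightarrow> 'a) \<Rightarrow> ('n \<Rightarrow> 'a) measure) \<Rightarrow> 'n set \<Rightarrow> 'n set \<Rightarrow> 'n set \<Rightarrow> bool"
  where
  "cond_independent M P A B C \<longleftrightarrow>
     (\<exists>Q\<in>markov_kernels (X_space M C) (X_space M A).
        \<forall>xJ\<in>points (X_space M (inputs (graph M))).
          marginal3 M P A B C xJ =
          kernel_prod (X_space M A) (prod_space (X_space M B) (X_space M C))
            (\<lambda>((xB, xC), xJ). Q xC) (marginal2 M P B C) xJ)"

end

theory Submission
  imports Defs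
begin

text \<open>Separation splits the ancestral closure of \<open>A \<union> J \<union> B \<union> C\<close> into disjoint sets \<open>A0\<close> and \<open>S0\<close> with
  \<open>A \<subseteq> A0 \<union> C\<close> and \<open>J \<union> B \<union> C \<subseteq> S0\<close> such that no family \<open>{v} \<union> Pa(v)\<close> meets both \<open>A0\<close> and \<open>S0 - C\<close>.
  Along a topological order one maintains a kernel \<open>Q(X\<^sub>A\<^sub>0 | X\<^sub>C)\<close> that is a conditional law of the \<open>A0\<close>-part
  given the \<open>S0\<close>-part of the nodes seen so far. A mechanism whose family lies in \<open>S0\<close> is integrated
  independently of \<open>Q\<close> and commutes with it; a mechanism of a node of \<open>A0\<close> is composed with \<open>Q\<close>; at a
  node \<open>v\<close> of \<open>C\<close> with a parent in \<open>A0\<close>, the joint kernel of \<open>X\<^sub>A\<^sub>0\<close> and \<open>X\<^sub>v\<close> given \<open>X\<^sub>C\<close> is disintegrated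
  along \<open>X\<^sub>v\<close>.

  The disintegration must depend measurably on a parameter from an arbitrary quasi-universal space.
  Standard spaces are retracts of the real line, where conditional distribution functions are limits
  of quotients over dyadic cells along a subsequence chosen measurably from the \<open>L\<^sup>2\<close>-rate. Their
  quantile transform expresses the conditional law as an image of a fixed uniform noise variable,
  which is the form that admissible random variables of \<open>P(X)\<close> have to take.\<close>

section \<open>Disintegration of real kernels\<close>

text \<open>The witness \<open>Q\<close> must be the same for all input values, so the joint law
  cannot be disintegrated separately for each \<open>xJ\<close>. What is disintegrated instead is a
  kernel in the value of \<open>C\<close> alone, built from the current \<open>Q\<close> and one
  mechanism. Its identity holds for every value of \<open>C\<close>, so no exceptional null set
  depends on the input. The law of the \<open>S0\<close>-part is only claimed to exist, for each
  input value separately. Inputs may lie in \<open>C\<close>, where they enter as parameters; only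
  output spaces are disintegrated.

  A second obstacle is the sigma-algebra induced by a product, which may exceed the product
  sigma-algebra. Integrals are therefore exchanged on the square of the sample space, where
  universally measurable sets are squeezed between measurable ones, and identities on the plane are
  checked on Borel sets and extended by uniqueness.

  Standardness has a second use besides disintegration: every measurable family of probability
  measures on a nonempty standard space is the image of one fixed noise law, so composed kernels are
  Markov kernels again.\<close>

definition cell :: "nat \<Rightarrow> real \<Rightarrow> int" where
  "cell n y = \<lfloor>2 ^ n * y\<rfloor>"

lemma measurable_cell [measurable]: "cell n \<in> borel \<rightarrow>\<^sub>M count_space UNIV"
  unfolding cell_def by measurable

text \<open>This makes the partitions nested: whatever depends on the coarse index is a function of
  the fine one, which is the source of the martingale property.\<close>

lemma cell_div:
  assumes "n \<le> m"
  shows "cell n y = cell m y div 2 ^ (m - n)"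
proof -
  have "2 ^ m * y / real_of_int (2 ^ (m - n)) = 2 ^ n * y"
  proof -
    obtain d where "m = n + d" using assms le_Suc_ex by blast
    then show ?thesis by (simp add: power_add)
  qed
  moreover have "\<lfloor>2 ^ m * y / real_of_int (2 ^ (m - n))\<rfloor> = \<lfloor>2 ^ m * y\<rfloor> div 2 ^ (m - n)"
    by (rule floor_divide_real_eq_div) simp
  ultimately show ?thesis by (simp add: cell_def)
qed

text \<open>Cells of side less than \<open>y - t\<close> separate \<open>t\<close> from
  \<open>y\<close>. With \<open>incseq_cells\<close>, measures that agree on unions of cells can be
  compared on half-lines, which determine a finite measure on the line.\<close>

lemma greaterThan_eq_cells: "{t<..} = (\<Union>m. {y. cell m t < cell m y})"
proof (intro set_eqI iffI)
  fix y assume "y \<in> {t<..}"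
  then have "0 < y - t" by simp
  then obtain m where m: "1 / (y - t) < 2 ^ m"
    using real_arch_pow[of 2 "1 / (y - t)"] by auto
  then have "1 < 2 ^ m * (y - t)"
    using \<open>0 < y - t\<close> by (simp add: field_simps)
  then have "cell m t < cell m y"
    unfolding cell_def by (simp add: right_diff_distrib) linarith
  then show "y \<in> (\<Union>m. {y. cell m t < cell m y})" by auto
next
  fix y assume "y \<in> (\<Union>m. {y. cell m t < cell m y})"
  then obtain m where "cell m t < cell m y" by auto
  moreover have "cell m y \<le> cell m t" if "y \<le> t"
    using that by (auto simp: cell_def intro!: floor_mono)
  ultimately show "y \<in> {t<..}" by force
qed

lemma incseq_cells: "incseq (\<lambda>m. {y. cell m t < cell m y})"
proof (rule incseq_SucI, safe)
  fix m y assume "cell m t < cell m y"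
  then show "cell (Suc m) t < cell (Suc m) y"
    using cell_div[of m "Suc m" t] cell_div[of m "Suc m" y]
      zdiv_mono1[of "cell (Suc m) y" "cell (Suc m) t" 2]
    by (cases "cell (Suc m) t < cell (Suc m) y") auto
qed

definition cond_quotient :: "'a measure \<Rightarrow> 'a set \<Rightarrow> ('a \<Rightarrow> int) \<Rightarrow> int \<Rightarrow> real" where
  "cond_quotient M a c i = measure M (a \<inter> (c -` {i} \<inter> space M)) / measure M (c -` {i} \<inter> space M)"

lemma (in prob_space) cond_quotient_bounds:
  assumes "c \<in> M \<rightarrow>\<^sub>M count_space UNIV"
  shows "0 \<le> cond_quotient M a c i" "cond_quotient M a c i \<le> 1"
proof -
  have "c -` {i} \<inter> space M \<in> sets M"
    using assms by (rule measurable_sets) simp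
  then have "measure M (a \<inter> (c -` {i} \<inter> space M)) \<le> measure M (c -` {i} \<inter> space M)"
    by (intro finite_measure_mono) auto
  then show "0 \<le> cond_quotient M a c i" "cond_quotient M a c i \<le> 1"
    by (auto simp: cond_quotient_def divide_le_eq_1 intro: divide_nonneg_nonneg measure_nonneg)
       (smt (verit) measure_nonneg)+
qed

text \<open>This is the defining property of the conditional probability of \<open>a\<close> given
  \<open>c\<close>. Since \<open>c\<close> takes countably many values, it suffices to compare on
  singletons the image of \<open>M\<close> restricted to \<open>a\<close> with the image of
  \<open>M\<close> weighted by the quotient.\<close>

lemma (in prob_space) integral_cond_quotient:
  assumes c[measurable]: "c \<in> M \<rightarrow>\<^sub>M count_space UNIV" and a[measurable]: "a \<in> sets M"
  shows "(\<integral>p. cond_quotient M a c (c p) * g (c p) \<partial>M) = (\<integral>p. indicator a p * g (c p) \<partial>M)"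
proof -
  let ?q = "cond_quotient M a c"
  have "distr (density M (indicator a)) (count_space UNIV) c =
      density (distr M (count_space UNIV) c) (\<lambda>i. ennreal (?q i))"
  proof (rule measure_eqI_countable[where A=UNIV])
    fix i :: int
    have [measurable]: "c -` {i} \<inter> space M \<in> sets M"
      using c by (rule measurable_sets) simp
    have "emeasure (distr (density M (indicator a)) (count_space UNIV) c) {i} =
        emeasure M (a \<inter> (c -` {i} \<inter> space M))"
      by (simp add: emeasure_distr emeasure_density nn_integral_set_ennreal flip: indicator_inter_arith)
    also have "\<dots> = ennreal (?q i) * emeasure M (c -` {i} \<inter> space M)"
    proof -
      \<comment> \<open>Monotonicity also settles null cells: there the numerator vanishes, and the
        quotient is 0 by the convention for division by zero.\<close>
      have "measure M (a \<inter> (c -` {i} \<inter> space M)) \<le> measure M (c -` {i} \<inter> space M)"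
        by (intro finite_measure_mono) auto
      then have "measure M (a \<inter> (c -` {i} \<inter> space M)) = ?q i * measure M (c -` {i} \<inter> space M)"
        by (auto simp: cond_quotient_def) (smt (verit) measure_nonneg)
      then show ?thesis
        using cond_quotient_bounds[OF c, of a i]
        by (simp add: emeasure_eq_measure ennreal_mult)
    qed
    also have "\<dots> = emeasure (density (distr M (count_space UNIV) c) (\<lambda>i. ennreal (?q i))) {i}"
      by (simp add: emeasure_density nn_integral_cmult_indicator[symmetric] emeasure_distr
          nn_integral_distr flip: nn_integral_cmult_indicator)
    finally show "emeasure (distr (density M (indicator a)) (count_space UNIV) c) {i} =
        emeasure (density (distr M (count_space UNIV) c) (\<lambda>i. ennreal (?q i))) {i}" .
  qed auto
  note eq = this
  have "(\<integral>p. ?q (c p) * g (c p) \<partial>M) = (\<integral>i. ?q i * g i \<partial>distr M (count_space UNIV) c)"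
    by (subst integral_distr) auto
  also have "\<dots> = (\<integral>i. g i \<partial>density (distr M (count_space UNIV) c) (\<lambda>i. ennreal (?q i)))"
    using cond_quotient_bounds[OF c] by (subst integral_density) auto
  also have "\<dots> = (\<integral>p. g (c p) \<partial>density M (indicator a))"
    by (subst eq[symmetric], subst integral_distr) auto
  also have "\<dots> = (\<integral>p. indicator a p * g (c p) \<partial>M)"
  proof -
    have "density M (indicator a) = density M (\<lambda>p. ennreal (indicator a p))"
      by (simp add: ennreal_indicator)
    then show ?thesis by (simp add: integral_density)
  qed
  finally show ?thesis .
qed

text \<open>The quotients along the dyadic cells form a bounded martingale. Its increments are orthogonal,
  which yields the rate of convergence needed to select a subsequence measurably.\<close>

definition quotient_at :: "(real \<times> real) measure \<Rightarrow> real set \<Rightarrow> nat \<Rightarrow> real \<Rightarrow> real" where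
  "quotient_at \<mu> A n y = cond_quotient \<mu> (A \<times> UNIV) (\<lambda>p. cell n (snd p)) (cell n y)"

definition energy :: "(real \<times> real) measure \<Rightarrow> real set \<Rightarrow> nat \<Rightarrow> real" where
  "energy \<mu> A n = (\<integral>p. (quotient_at \<mu> A n (snd p))\<^sup>2 \<partial>\<mu>)"

definition energy_limit :: "(real \<times> real) measure \<Rightarrow> real set \<Rightarrow> real" where
  "energy_limit \<mu> A = (SUP n. energy \<mu> A n)"

text \<open>The condition \<open>k \<le> n\<close> drives the indices to infinity, so that every
  fixed level is eventually refined. The bound \<open>(1 / 4) ^ k\<close> on squared increments will
  give summable bounds \<open>(1 / 2) ^ k\<close> on the increments. Taking the least index makes
  the choice measurable in \<open>\<mu>\<close>.\<close>

definition fast_index :: "(real \<times> real) measure \<Rightarrow> real set \<Rightarrow> nat \<Rightarrow> nat" where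
  "fast_index \<mu> A k = (LEAST n. k \<le> n \<and> energy_limit \<mu> A - (1 / 4) ^ k < energy \<mu> A n)"

text \<open>Truncation keeps the values in the unit interval where \<^const>\<open>lim\<close> is unspecified.\<close>

definition cond_limit :: "(real \<times> real) measure \<Rightarrow> real set \<Rightarrow> real \<Rightarrow> real" where
  "cond_limit \<mu> A y = max 0 (min 1 (lim (\<lambda>k. quotient_at \<mu> A (fast_index \<mu> A k) y)))"

locale real_pair_prob = prob_space \<mu> for \<mu> :: "(real \<times> real) measure" +
  fixes A :: "real set"
  assumes sets_mu [measurable_cong]: "sets \<mu> = sets (borel \<Otimes>\<^sub>M borel)"
    and A [measurable]: "A \<in> sets borel"
begin

lemma quotient_measurable [measurable]: "quotient_at \<mu> A n \<in> borel_measurable borel"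
  unfolding quotient_at_def by measurable

lemma cell_snd [measurable]: "(\<lambda>p. cell n (snd p)) \<in> \<mu> \<rightarrow>\<^sub>M count_space UNIV"
  by measurable

lemma quotient_bounds: "0 \<le> quotient_at \<mu> A n y" "quotient_at \<mu> A n y \<le> 1"
  unfolding quotient_at_def by (rule cond_quotient_bounds, measurable)+

text \<open>The martingale property: \<open>g\<close> of the level-\<open>m\<close> index is a
  function of the level-\<open>n\<close> index, to which \<open>integral_cond_quotient\<close>
  applies.\<close>

lemma integral_quotient:
  assumes "m \<le> n"
  shows "(\<integral>p. quotient_at \<mu> A n (snd p) * g (cell m (snd p)) \<partial>\<mu>) =
    (\<integral>p. indicator A (fst p) * g (cell m (snd p)) \<partial>\<mu>)"
proof -
  have "A \<times> UNIV \<in> sets \<mu>" by measurable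
  from integral_cond_quotient[OF cell_snd this, of n "\<lambda>i. g (i div 2 ^ (n - m))"]
  show ?thesis
    by (simp add: quotient_at_def indicator_times flip: cell_div[OF assms])
qed

lemma integrable_bounded:
  fixes f :: "real \<times> real \<Rightarrow> real"
  assumes [measurable]: "f \<in> borel_measurable \<mu>" and "\<And>p. \<bar>f p\<bar> \<le> B"
  shows "integrable \<mu> f"
  using assms by (intro integrable_const_bound[where B=B]) auto

text \<open>Orthogonality of increments: integrating either quotient against the
  level-\<open>m\<close> quotient amounts to integrating the indicator of \<open>A\<close> against
  it, so the mixed term equals the energy at level \<open>m\<close>.\<close>

lemma quotient_diff:
  assumes "m \<le> n"
  shows "(\<integral>p. (quotient_at \<mu> A n (snd p) - quotient_at \<mu> A m (snd p))\<^sup>2 \<partial>\<mu>) = energy \<mu> A n - energy \<mu> A m"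
proof -
  let ?f = "\<lambda>n p. quotient_at \<mu> A n (snd p)"
  let ?q = "cond_quotient \<mu> (A \<times> UNIV) (\<lambda>p. cell m (snd p))"
  have "(\<integral>p. ?f n p * ?f m p \<partial>\<mu>) = (\<integral>p. ?f m p * ?f m p \<partial>\<mu>)"
    using integral_quotient[OF assms, of ?q] integral_quotient[OF order.refl, of m ?q]
    by (simp add: quotient_at_def)
  moreover have int: "integrable \<mu> (\<lambda>p. ?f i p * ?f j p)" for i j
    using quotient_bounds by (intro integrable_bounded[where B=1]) (auto simp: abs_mult intro!: mult_le_one)
  moreover have eq: "(\<lambda>p. (?f n p - ?f m p)\<^sup>2) = (\<lambda>p. ?f n p * ?f n p - 2 * (?f n p * ?f m p) + ?f m p * ?f m p)"
    by (auto simp: power2_eq_square algebra_simps)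
  ultimately show ?thesis
    unfolding energy_def eq by (simp add: power2_eq_square)
qed

lemma energy_mono: "m \<le> n \<Longrightarrow> energy \<mu> A m \<le> energy \<mu> A n"
  using quotient_diff[of m n] Bochner_Integration.integral_nonneg[of \<mu> "\<lambda>p. (quotient_at \<mu> A n (snd p) - quotient_at \<mu> A m (snd p))\<^sup>2"]
  by simp

lemma energy_le_1: "energy \<mu> A n \<le> 1"
proof -
  have "energy \<mu> A n \<le> (\<integral>p. 1 \<partial>\<mu>)"
    unfolding energy_def using quotient_bounds[of n]
    by (intro integral_mono integrable_bounded[where B=1]) (auto simp: abs_square_le_1 power_le_one)
  then show ?thesis by (simp add: prob_space)
qed

text \<open>Both orders of the two levels are treated, so consecutive fast indices can be compared
  without knowing which is larger.\<close>

lemma quotient_diff_le: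
  assumes "L - \<epsilon> < energy \<mu> A m" "L - \<epsilon> < energy \<mu> A n" "energy \<mu> A m \<le> L" "energy \<mu> A n \<le> L"
  shows "(\<integral>p. (quotient_at \<mu> A n (snd p) - quotient_at \<mu> A m (snd p))\<^sup>2 \<partial>\<mu>) \<le> \<epsilon>"
proof (cases "m \<le> n")
  case True
  then show ?thesis using quotient_diff[OF True] assms by linarith
next
  case False
  then show ?thesis using quotient_diff[of n m] assms by (simp add: power2_commute)
qed

text \<open>The increments have summable first moments, so their series converges absolutely almost
  everywhere, and the quotients are its partial sums up to the initial term.\<close>

lemma AE_quotient_convergent:
  assumes diff: "\<And>k. (\<integral>p. (quotient_at \<mu> A (r (Suc k)) (snd p) - quotient_at \<mu> A (r k) (snd p))\<^sup>2 \<partial>\<mu>) \<le> (1 / 4) ^ k"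
  shows "AE p in \<mu>. convergent (\<lambda>k. quotient_at \<mu> A (r k) (snd p))"
proof -
  let ?g = "\<lambda>k p. quotient_at \<mu> A (r k) (snd p)"
  let ?d = "\<lambda>k p. ?g (Suc k) p - ?g k p"
  have bd: "\<bar>?d k p\<bar> \<le> 1" for k p
    using quotient_bounds[of "r k" "snd p"] quotient_bounds[of "r (Suc k)" "snd p"] by linarith
  have int: "integrable \<mu> (\<lambda>p. \<bar>?d k p\<bar>)" "integrable \<mu> (\<lambda>p. (?d k p)\<^sup>2)" for k
    using bd[of k] by (auto intro!: integrable_bounded[where B=1] simp: abs_square_le_1)
  have le: "(\<integral>p. \<bar>?d k p\<bar> \<partial>\<mu>) \<le> (1 / 2) ^ k" for k
  proof -
    \<comment> \<open>The weight \<open>2 ^ k\<close> balances the two terms: after integration a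
      squared increment of at most \<open>(1 / 4) ^ k\<close> contributes
      \<open>(1 / 2) ^ k\<close>, the same as the constant.\<close>
    have amgm: "\<bar>x\<bar> \<le> ((1 / 2) ^ k + 2 ^ k * x\<^sup>2) / 2" for x :: real
    proof -
      have "0 \<le> (2 ^ k * \<bar>x\<bar> - 1)\<^sup>2 / 2 ^ k" by simp
      also have "\<dots> = 2 ^ k * x\<^sup>2 - 2 * \<bar>x\<bar> + (1 / 2) ^ k"
        by (simp add: power2_eq_square field_simps abs_mult_self_eq)
      finally show ?thesis by simp
    qed
    have "(\<integral>p. \<bar>?d k p\<bar> \<partial>\<mu>) \<le> (\<integral>p. ((1 / 2) ^ k + 2 ^ k * (?d k p)\<^sup>2) / 2 \<partial>\<mu>)"
      using int[of k] by (intro integral_mono amgm) auto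
    also have "\<dots> = ((1 / 2) ^ k + 2 ^ k * (\<integral>p. (?d k p)\<^sup>2 \<partial>\<mu>)) / 2"
      using int[of k] by (simp add: prob_space)
    also have "\<dots> \<le> ((1 / 2) ^ k + 2 ^ k * (1 / 4) ^ k) / 2"
      using diff[of k] by simp
    also have "2 ^ k * (1 / 4) ^ k = (1 / 2 :: real) ^ k"
      by (simp flip: power_mult_distrib)
    finally show ?thesis by simp
  qed
  have "(\<integral>\<^sup>+p. (\<Sum>k. ennreal \<bar>?d k p\<bar>) \<partial>\<mu>) = (\<Sum>k. \<integral>\<^sup>+p. ennreal \<bar>?d k p\<bar> \<partial>\<mu>)"
    by (rule nn_integral_suminf) measurable
  also have "\<dots> \<le> (\<Sum>k. ennreal ((1 / 2) ^ k))"
    using le int by (intro suminf_le) (auto simp: nn_integral_eq_integral ennreal_leI)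
  also have "\<dots> = ennreal (\<Sum>k. (1 / 2) ^ k)"
    by (intro suminf_ennreal2) (auto simp: summable_geometric)
  also have "\<dots> < \<infinity>" by simp
  finally have "(\<integral>\<^sup>+p. (\<Sum>k. ennreal \<bar>?d k p\<bar>) \<partial>\<mu>) \<noteq> \<infinity>" by simp
  then have "AE p in \<mu>. (\<Sum>k. ennreal \<bar>?d k p\<bar>) \<noteq> \<infinity>"
    by (intro nn_integral_PInf_AE) auto
  then show ?thesis
  proof eventually_elim
    case (elim p)
    then have "summable (\<lambda>k. \<bar>?d k p\<bar>)"
      by (intro summable_suminf_not_top) auto
    then have "summable (\<lambda>k. ?d k p)"
      by (rule summable_rabs_cancel)
    then have "convergent (\<lambda>n. \<Sum>k<n. ?d k p)"
      by (simp add: summable_iff_convergent)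
    then have "convergent (\<lambda>n. ?g n p - ?g 0 p)"
      using sum_lessThan_telescope[of "\<lambda>k. ?g k p"] by simp
    then show ?case
      using convergent_add[OF _ convergent_const[of "?g 0 p"]] by fastforce
  qed
qed

lemma energy_bdd: "bdd_above (range (energy \<mu> A))"
  using energy_le_1 by (rule bdd_aboveI2)

lemma energy_le_limit: "energy \<mu> A n \<le> energy_limit \<mu> A"
  unfolding energy_limit_def by (intro cSUP_upper energy_bdd) simp

lemma fast_index:
  "k \<le> fast_index \<mu> A k" "energy_limit \<mu> A - (1 / 4) ^ k < energy \<mu> A (fast_index \<mu> A k)"
proof -
  have "energy_limit \<mu> A - (1 / 4) ^ k < (SUP n. energy \<mu> A n)"
    unfolding energy_limit_def by simp
  then obtain n where "energy_limit \<mu> A - (1 / 4) ^ k < energy \<mu> A n"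
    using energy_bdd by (subst (asm) less_cSUP_iff) auto
  then have "energy_limit \<mu> A - (1 / 4) ^ k < energy \<mu> A (max k n)"
    using energy_mono[of n "max k n"] by simp
  then have "k \<le> max k n \<and> energy_limit \<mu> A - (1 / 4) ^ k < energy \<mu> A (max k n)" by simp
  then have "k \<le> fast_index \<mu> A k \<and> energy_limit \<mu> A - (1 / 4) ^ k < energy \<mu> A (fast_index \<mu> A k)"
    unfolding fast_index_def by (rule LeastI)
  then show "k \<le> fast_index \<mu> A k" "energy_limit \<mu> A - (1 / 4) ^ k < energy \<mu> A (fast_index \<mu> A k)"
    by auto
qed

lemma cond_limit_bounds: "0 \<le> cond_limit \<mu> A y" "cond_limit \<mu> A y \<le> 1"
  by (auto simp: cond_limit_def)

lemma cond_limit_measurable [measurable]: "cond_limit \<mu> A \<in> borel_measurable borel"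
  unfolding cond_limit_def by measurable

lemma AE_cond_limit:
  "AE p in \<mu>. (\<lambda>k. quotient_at \<mu> A (fast_index \<mu> A k) (snd p)) \<longlonglongrightarrow> cond_limit \<mu> A (snd p)"
proof -
  have "AE p in \<mu>. convergent (\<lambda>k. quotient_at \<mu> A (fast_index \<mu> A k) (snd p))"
  proof (intro AE_quotient_convergent quotient_diff_le[where L="energy_limit \<mu> A"] energy_le_limit fast_index)
    fix k :: nat
    have "(1 / 4 :: real) ^ Suc k \<le> (1 / 4) ^ k"
      by (rule power_decreasing) auto
    then show "energy_limit \<mu> A - (1 / 4) ^ k < energy \<mu> A (fast_index \<mu> A (Suc k))"
      using fast_index(2)[of "Suc k"] by linarith
  qed
  then show ?thesis
  proof eventually_elim
    case (elim p)
    let ?q = "\<lambda>k. quotient_at \<mu> A (fast_index \<mu> A k) (snd p)"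
    have lim: "?q \<longlonglongrightarrow> lim ?q"
      using elim by (simp add: convergent_LIMSEQ_iff)
    then have "0 \<le> lim ?q" "lim ?q \<le> 1"
      using quotient_bounds by (auto intro: LIMSEQ_le_const LIMSEQ_le_const2)
    then show ?case
      using lim by (simp add: cond_limit_def)
  qed
qed

text \<open>The integrals of the quotients converge by dominated convergence, and they are constant
  from \<open>k = m\<close> on because \<open>fast_index\<close> is at least
  \<open>k\<close>.\<close>

lemma integral_cond_limit_cell:
  fixes g :: "int \<Rightarrow> real"
  assumes g: "\<And>i. \<bar>g i\<bar> \<le> 1"
  shows "(\<integral>p. cond_limit \<mu> A (snd p) * g (cell m (snd p)) \<partial>\<mu>) =
    (\<integral>p. indicator A (fst p) * g (cell m (snd p)) \<partial>\<mu>)"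
proof -
  let ?q = "\<lambda>k p. quotient_at \<mu> A (fast_index \<mu> A k) (snd p)"
  have [measurable]: "(\<lambda>p. g (cell m (snd p))) \<in> borel_measurable \<mu>"
    by (rule measurable_compose[OF cell_snd]) simp
  have "(\<lambda>k. \<integral>p. ?q k p * g (cell m (snd p)) \<partial>\<mu>) \<longlonglongrightarrow> (\<integral>p. cond_limit \<mu> A (snd p) * g (cell m (snd p)) \<partial>\<mu>)"
  proof (rule integral_dominated_convergence[where w="\<lambda>_. 1"])
    show "AE p in \<mu>. (\<lambda>k. ?q k p * g (cell m (snd p))) \<longlonglongrightarrow> cond_limit \<mu> A (snd p) * g (cell m (snd p))"
      using AE_cond_limit by eventually_elim (intro tendsto_intros)
    show "AE p in \<mu>. norm (?q k p * g (cell m (snd p))) \<le> 1" for k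
      using quotient_bounds g by (auto simp: abs_mult intro!: mult_le_one)
  qed auto
  moreover have "eventually (\<lambda>k. (\<integral>p. ?q k p * g (cell m (snd p)) \<partial>\<mu>) =
      (\<integral>p. indicator A (fst p) * g (cell m (snd p)) \<partial>\<mu>)) sequentially"
    using eventually_ge_at_top[of m]
  proof eventually_elim
    case (elim k)
    then show ?case
      using fast_index(1)[of k] by (intro integral_quotient) simp
  qed
  ultimately show ?thesis
    by (rule LIMSEQ_unique[OF _ tendsto_eventually])
qed

text \<open>As functions of \<open>B\<close> both sides are finite measures. They agree on the
  unions of cells that increase to a half-line, hence on half-lines, hence on all Borel
  sets.\<close>

lemma integral_cond_limit:
  assumes B [measurable]: "B \<in> sets borel"
  shows "(\<integral>p. cond_limit \<mu> A (snd p) * indicator B (snd p) \<partial>\<mu>) = measure \<mu> (A \<times> B)"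
proof -
  define M1 where "M1 = distr (density \<mu> (\<lambda>p. ennreal (cond_limit \<mu> A (snd p)))) borel snd"
  define M2 where "M2 = distr (density \<mu> (\<lambda>p. ennreal (indicator A (fst p)))) borel snd"
  have e: "emeasure (distr (density \<mu> (\<lambda>p. ennreal (f p))) borel snd) X =
      ennreal (\<integral>p. f p * indicator X (snd p) \<partial>\<mu>)"
    if [measurable]: "f \<in> borel_measurable \<mu>" "X \<in> sets borel" and f: "\<And>p. 0 \<le> f p" "\<And>p. f p \<le> 1"
    for f :: "real \<times> real \<Rightarrow> real" and X :: "real set"
  proof -
    have "emeasure (distr (density \<mu> (\<lambda>p. ennreal (f p))) borel snd) X =
        (\<integral>\<^sup>+p. ennreal (f p) * indicator (snd -` X \<inter> space \<mu>) p \<partial>\<mu>)"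
      by (simp add: emeasure_distr emeasure_density)
    also have "\<dots> = (\<integral>\<^sup>+p. ennreal (f p * indicator X (snd p)) \<partial>\<mu>)"
      using f by (intro nn_integral_cong) (auto split: split_indicator)
    also have "\<dots> = ennreal (\<integral>p. f p * indicator X (snd p) \<partial>\<mu>)"
      using f by (intro nn_integral_eq_integral integrable_bounded[where B=1])
        (auto split: split_indicator)
    finally show ?thesis .
  qed
  have e1: "emeasure M1 X = ennreal (\<integral>p. cond_limit \<mu> A (snd p) * indicator X (snd p) \<partial>\<mu>)"
    if "X \<in> sets borel" for X
    unfolding M1_def using that cond_limit_bounds by (intro e) auto
  have e2: "emeasure M2 X = ennreal (\<integral>p. indicator A (fst p) * indicator X (snd p) \<partial>\<mu>)"
    if "X \<in> sets borel" for X
    unfolding M2_def using that by (intro e) (auto split: split_indicator)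
  have "M1 = M2"
  proof (rule measure_eqI_lessThan)
    show "sets M1 = sets borel" "sets M2 = sets borel" by (simp_all add: M1_def M2_def)
    fix t :: real
    show "emeasure M1 {t<..} < \<infinity>" by (simp add: e1)
    have "emeasure M1 {y. cell m t < cell m y} = emeasure M2 {y. cell m t < cell m y}" for m
    proof -
      have "(\<integral>p. cond_limit \<mu> A (snd p) * indicator {y. cell m t < cell m y} (snd p) \<partial>\<mu>) =
        (\<integral>p. indicator A (fst p) * indicator {y. cell m t < cell m y} (snd p) \<partial>\<mu>)"
        using integral_cond_limit_cell[of "indicator {i. cell m t < i}" m]
        by (simp add: indicator_def)
      then show ?thesis
        by (simp add: e1 e2)
    qed
    then have "(SUP m. emeasure M1 {y. cell m t < cell m y}) = (SUP m. emeasure M2 {y. cell m t < cell m y})"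
      by simp
    moreover have "{y. cell m t < cell m y} \<in> sets borel" for m
      by measurable
    ultimately show "emeasure M1 {t<..} = emeasure M2 {t<..}"
      unfolding greaterThan_eq_cells[of t]
      by (subst (asm) (1 2) SUP_emeasure_incseq) (auto simp: M1_def M2_def incseq_cells)
  qed
  then have "emeasure M1 B = emeasure M2 B" by simp
  then have "(\<integral>p. cond_limit \<mu> A (snd p) * indicator B (snd p) \<partial>\<mu>) = (\<integral>p. indicator A (fst p) * indicator B (snd p) \<partial>\<mu>)"
    using cond_limit_bounds by (simp add: e1 e2)
  also have "\<dots> = (\<integral>p. indicator (A \<times> B) p \<partial>\<mu>)"
    by (simp add: indicator_times)
  also have "\<dots> = measure \<mu> (A \<times> B)"
    by simp
  finally show ?thesis .
qed

end

section \<open>Measurable dependence of the conditional limits on a parameter\<close>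

lemma real_pair_probI:
  assumes "\<kappa> \<in> N \<rightarrow>\<^sub>M prob_algebra (borel \<Otimes>\<^sub>M borel)" "z \<in> space N" "A \<in> sets borel"
  shows "real_pair_prob (\<kappa> z) A"
proof -
  have "\<kappa> z \<in> space (prob_algebra (borel \<Otimes>\<^sub>M borel))"
    using assms(1,2) by (rule measurable_space)
  then show ?thesis
    using assms(3) by (auto simp: space_prob_algebra real_pair_prob_def real_pair_prob_axioms_def)
qed

text \<open>Only countable operations are involved: measures of fixed sets, a supremum over levels,
  a least index, the limit of a sequence. The cell index and the fast index are integer-valued, so
  measurability is shown for each fixed index before the measurable index is inserted.\<close>

lemma cond_limit_param_measurable:
  assumes \<kappa>: "\<kappa> \<in> N \<rightarrow>\<^sub>M prob_algebra (borel \<Otimes>\<^sub>M borel)" and A [measurable]: "A \<in> sets borel"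
  shows "(\<lambda>(z, y). cond_limit (\<kappa> z) A y) \<in> borel_measurable (N \<Otimes>\<^sub>M borel)"
proof -
  have \<kappa>' [measurable]: "\<kappa> \<in> N \<rightarrow>\<^sub>M subprob_algebra (borel \<Otimes>\<^sub>M borel)"
    using \<kappa> by (rule measurable_prob_algebraD)
  have sp: "space (\<kappa> z) = UNIV" if "z \<in> space N" for z
    using subprob_measurableD(1)[OF \<kappa>' that] by (simp add: space_pair_measure)
  have q [measurable]: "(\<lambda>w. quotient_at (\<kappa> (fst w)) A n (snd w)) \<in> borel_measurable (N \<Otimes>\<^sub>M borel)" for n
  proof -
    let ?C = "\<lambda>i. (\<lambda>p. cell n (snd p)) -` {i} :: (real \<times> real) set"
    have C [measurable]: "?C i \<in> sets (borel \<Otimes>\<^sub>M borel)" for i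
    proof -
      have "(\<lambda>p. cell n (snd p)) \<in> borel \<Otimes>\<^sub>M borel \<rightarrow>\<^sub>M count_space UNIV"
        by measurable
      from measurable_sets[OF this, of "{i}"] show ?thesis
        by (simp add: space_pair_measure)
    qed
    have AU [measurable]: "A \<times> UNIV \<in> sets (borel \<Otimes>\<^sub>M borel)"
      by measurable
    have "(\<lambda>w. measure (\<kappa> (fst w)) ((A \<times> UNIV) \<inter> ?C (cell n (snd w))) / measure (\<kappa> (fst w)) (?C (cell n (snd w))))
        \<in> borel_measurable (N \<Otimes>\<^sub>M borel)"
    proof (rule measurable_compose_countable[where g="\<lambda>w. cell n (snd w)" and
          f="\<lambda>i w. measure (\<kappa> (fst w)) ((A \<times> UNIV) \<inter> ?C i) / measure (\<kappa> (fst w)) (?C i)"])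
      fix i
      have "(\<lambda>z. measure (\<kappa> z) D) \<in> borel_measurable N" if "D \<in> sets (borel \<Otimes>\<^sub>M borel)" for D
        using measurable_compose[OF \<kappa>' measurable_measure_subprob_algebra[OF that]] .
      from this[of "(A \<times> UNIV) \<inter> ?C i"] this[of "?C i"]
      show "(\<lambda>w. measure (\<kappa> (fst w)) ((A \<times> UNIV) \<inter> ?C i) / measure (\<kappa> (fst w)) (?C i))
          \<in> borel_measurable (N \<Otimes>\<^sub>M borel)"
        using C AU by (intro borel_measurable_divide measurable_compose[OF measurable_fst]) auto
    qed measurable
    then show ?thesis
      by (rule measurable_cong[THEN iffD1, rotated])
         (auto simp: quotient_at_def cond_quotient_def sp space_pair_measure)
  qed
  have e [measurable]: "(\<lambda>z. energy (\<kappa> z) A n) \<in> borel_measurable N" for n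
  proof (rule measurable_cong[THEN iffD1])
    have "(\<lambda>w. (fst w, snd (snd w))) \<in> N \<Otimes>\<^sub>M borel \<Otimes>\<^sub>M borel \<rightarrow>\<^sub>M N \<Otimes>\<^sub>M borel"
      by measurable
    from measurable_compose[OF this q[of n]]
    have "(\<lambda>(z, p). ennreal ((quotient_at (\<kappa> z) A n (snd p))\<^sup>2)) \<in> borel_measurable (N \<Otimes>\<^sub>M borel \<Otimes>\<^sub>M borel)"
      by (auto simp: split_beta' intro!: borel_measurable_power)
    from nn_integral_measurable_subprob_algebra2[OF this \<kappa>']
    show "(\<lambda>z. enn2real (\<integral>\<^sup>+p. ennreal ((quotient_at (\<kappa> z) A n (snd p))\<^sup>2) \<partial>\<kappa> z)) \<in> borel_measurable N"
      by simp
    fix z assume "z \<in> space N"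
    then interpret real_pair_prob "\<kappa> z" A
      by (rule real_pair_probI[OF \<kappa> _ A])
    show "enn2real (\<integral>\<^sup>+p. ennreal ((quotient_at (\<kappa> z) A n (snd p))\<^sup>2) \<partial>\<kappa> z) = energy (\<kappa> z) A n"
    proof -
      have "snd \<in> borel_measurable (\<kappa> z)"
        using measurable_snd by (simp add: measurable_cong_sets[OF sets_mu refl])
      then have "(\<lambda>p. (quotient_at (\<kappa> z) A n (snd p))\<^sup>2) \<in> borel_measurable (\<kappa> z)"
        by (intro borel_measurable_power measurable_compose[OF _ quotient_measurable])
      then show ?thesis
        unfolding energy_def by (subst integral_eq_nn_integral) auto
    qed
  qed
  have L [measurable]: "(\<lambda>z. energy_limit (\<kappa> z) A) \<in> borel_measurable N"
    unfolding energy_limit_def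
    using real_pair_prob.energy_bdd[OF real_pair_probI[OF \<kappa> _ A]]
    by (intro borel_measurable_cSUP) auto
  have r [measurable]: "(\<lambda>z. fast_index (\<kappa> z) A k) \<in> N \<rightarrow>\<^sub>M count_space UNIV" for k
    unfolding fast_index_def by measurable
  have [measurable]: "(\<lambda>w. quotient_at (\<kappa> (fst w)) A (fast_index (\<kappa> (fst w)) A k) (snd w)) \<in> borel_measurable (N \<Otimes>\<^sub>M borel)" for k
    by (rule measurable_compose_countable[where g="\<lambda>w. fast_index (\<kappa> (fst w)) A k" and
          f="\<lambda>n w. quotient_at (\<kappa> (fst w)) A n (snd w)"]) measurable
  show ?thesis
    unfolding cond_limit_def split_beta' by measurable
qed

text \<open>The limits for different thresholds are known to be monotone only almost everywhere. The
  supremum over rational thresholds is monotone everywhere and, at rational \<open>q\<close>,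
  changes nothing outside a null set.\<close>

definition cond_cdf :: "(real \<times> real) measure \<Rightarrow> real \<Rightarrow> real \<Rightarrow> real" where
  "cond_cdf \<mu> q y = (SUP r\<in>{r\<in>\<rat>. r \<le> q}. cond_limit \<mu> {..r} y)"

text \<open>A generalized inverse of the conditional distribution function. With the strict
  inequality, a uniform \<open>u\<close> satisfies \<open>u < cond_cdf \<mu> q y\<close> with
  probability exactly \<open>cond_cdf \<mu> q y\<close>, so neither right-continuity nor
  normalization has to be arranged. The default 1 keeps the infimum inside the unit
  interval.\<close>

definition cond_quantile :: "(real \<times> real) measure \<Rightarrow> real \<Rightarrow> real \<Rightarrow> real" where
  "cond_quantile \<mu> y u = (INF q\<in>\<rat> \<inter> {0..1}. if u < cond_cdf \<mu> q y then q else 1)"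

abbreviation unit_uniform :: "real measure" where
  "unit_uniform \<equiv> uniform_measure lborel {0..1}"

lemma prob_space_unit_uniform: "prob_space unit_uniform"
  by (rule prob_space_uniform_measure) auto

lemma emeasure_unit_uniform_lessThan:
  assumes "0 \<le> c" "c \<le> 1"
  shows "emeasure unit_uniform {..<c} = ennreal c"
proof -
  have "{0..1} \<inter> {..<c} = {0..<c}"
    using assms by auto
  then have "emeasure unit_uniform {..<c} = ennreal c / ennreal 1"
    using assms by simp
  then show ?thesis
    using assms by (subst (asm) divide_ennreal) auto
qed

lemma countable_Rats_Collect [simp]: "countable {r::real \<in> \<rat>. P r}"
  by (rule countable_subset[OF _ countable_rat]) auto

lemma Rats_le_nonempty: "{r::real \<in> \<rat>. r \<le> q} \<noteq> {}"
  using Rats_dense_in_real[of "q - 1" q] by (auto intro: less_imp_le)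

lemma cond_cdf_bdd: "bdd_above ((\<lambda>r. cond_limit \<mu> {..r} y) ` X)"
  by (rule bdd_aboveI2[where M=1]) (simp add: cond_limit_def)

lemma cond_cdf_bounds: "0 \<le> cond_cdf \<mu> q y" "cond_cdf \<mu> q y \<le> 1"
proof -
  obtain r where "r \<in> {r \<in> \<rat>. r \<le> q}" using Rats_le_nonempty by blast
  then have "cond_limit \<mu> {..r} y \<le> cond_cdf \<mu> q y"
    unfolding cond_cdf_def by (intro cSUP_upper cond_cdf_bdd)
  then show "0 \<le> cond_cdf \<mu> q y"
    by (rule order_trans[rotated]) (simp add: cond_limit_def)
  show "cond_cdf \<mu> q y \<le> 1"
    unfolding cond_cdf_def using Rats_le_nonempty by (intro cSUP_least) (auto simp: cond_limit_def)
qed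

lemma cond_cdf_mono: "q \<le> q' \<Longrightarrow> cond_cdf \<mu> q y \<le> cond_cdf \<mu> q' y"
  unfolding cond_cdf_def using Rats_le_nonempty by (intro cSUP_subset_mono cond_cdf_bdd) auto

text \<open>For \<open>t \<le> 1\<close> the default value 1 is never below \<open>t\<close>, so
  only genuine thresholds can witness the left side.\<close>

lemma cond_quantile_less_iff:
  assumes "t \<le> 1"
  shows "cond_quantile \<mu> y u < t \<longleftrightarrow> (\<exists>q\<in>\<rat> \<inter> {0..1}. q < t \<and> u < cond_cdf \<mu> q y)"
proof -
  have "(0::real) \<in> \<rat> \<inter> {0..1}" by simp
  then have "\<rat> \<inter> {0..1::real} \<noteq> {}" by blast
  then have "cond_quantile \<mu> y u < t \<longleftrightarrow> (\<exists>q\<in>\<rat> \<inter> {0..1}. (if u < cond_cdf \<mu> q y then q else 1) < t)"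
    unfolding cond_quantile_def by (intro cINF_less_iff) (auto intro!: bdd_belowI2[where m=0])
  also have "\<dots> \<longleftrightarrow> (\<exists>q\<in>\<rat> \<inter> {0..1}. q < t \<and> u < cond_cdf \<mu> q y)"
    using assms by (auto split: if_splits)
  finally show ?thesis .
qed

lemma cond_quantile_bounds: "0 \<le> cond_quantile \<mu> y u" "cond_quantile \<mu> y u \<le> 1"
proof -
  have 0: "(0::real) \<in> \<rat> \<inter> {0..1}" by simp
  then show "0 \<le> cond_quantile \<mu> y u"
    unfolding cond_quantile_def by (intro cINF_greatest) (auto split: if_splits)
  have "cond_quantile \<mu> y u \<le> (if u < cond_cdf \<mu> 0 y then 0 else 1)"
    unfolding cond_quantile_def using 0 by (intro cINF_lower) (auto intro!: bdd_belowI2[where m=0])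
  then show "cond_quantile \<mu> y u \<le> 1" by (auto split: if_splits)
qed

lemma cond_cdf_param_measurable:
  assumes \<kappa>: "\<kappa> \<in> N \<rightarrow>\<^sub>M prob_algebra (borel \<Otimes>\<^sub>M borel)"
  shows "(\<lambda>w. cond_cdf (\<kappa> (fst w)) q (snd w)) \<in> borel_measurable (N \<Otimes>\<^sub>M borel)"
  unfolding cond_cdf_def
proof (rule borel_measurable_cSUP)
  show "(\<lambda>w. cond_limit (\<kappa> (fst w)) {..i} (snd w)) \<in> borel_measurable (N \<Otimes>\<^sub>M borel)" for i
    using cond_limit_param_measurable[OF \<kappa>, of "{..i}"] by (simp add: split_beta')
qed (auto intro: cond_cdf_bdd)

lemma cond_quantile_param_measurable:
  assumes \<kappa>: "\<kappa> \<in> N \<rightarrow>\<^sub>M prob_algebra (borel \<Otimes>\<^sub>M borel)"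
  shows "(\<lambda>(z, y, u). cond_quantile (\<kappa> z) y u) \<in> borel_measurable (N \<Otimes>\<^sub>M borel \<Otimes>\<^sub>M borel)"
  unfolding cond_quantile_def split_beta'
proof (rule borel_measurable_cINF)
  have c [measurable]: "(\<lambda>w. cond_cdf (\<kappa> (fst w)) q (fst (snd w))) \<in> borel_measurable (N \<Otimes>\<^sub>M borel \<Otimes>\<^sub>M borel)" for q
  proof -
    have "(\<lambda>w. (fst w, fst (snd w))) \<in> N \<Otimes>\<^sub>M borel \<Otimes>\<^sub>M borel \<rightarrow>\<^sub>M N \<Otimes>\<^sub>M borel"
      by measurable
    from measurable_compose[OF this cond_cdf_param_measurable[OF \<kappa>, of q]]
    show ?thesis by simp
  qed
  show "(\<lambda>w. if snd (snd w) < cond_cdf (\<kappa> (fst w)) q (fst (snd w)) then q else 1)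
      \<in> borel_measurable (N \<Otimes>\<^sub>M borel \<Otimes>\<^sub>M borel)" for q
    by measurable
  show "countable (\<rat> \<inter> {0..1::real})"
    by (rule countable_subset[OF _ countable_rat]) auto
qed (auto intro!: bdd_belowI2[where m=0])

locale real_pair_prob_space = prob_space \<mu> for \<mu> :: "(real \<times> real) measure" +
  assumes sets_mu [measurable_cong]: "sets \<mu> = sets (borel \<Otimes>\<^sub>M borel)"
begin

lemma pair: "A \<in> sets borel \<Longrightarrow> real_pair_prob \<mu> A"
  using sets_mu prob_space_axioms by (simp add: real_pair_prob_def real_pair_prob_axioms_def)

text \<open>A single measure is a kernel over a discrete parameter space; measurability for fixed
  \<open>\<mu>\<close> thus becomes an instance of the parametrized statements.\<close>

lemma kernel_const: "(\<lambda>_. \<mu>) \<in> count_space UNIV \<rightarrow>\<^sub>M prob_algebra (borel \<Otimes>\<^sub>M borel)"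
  using sets_mu prob_space_axioms by (simp add: space_prob_algebra)

lemma cond_cdf_measurable [measurable]: "cond_cdf \<mu> q \<in> borel_measurable borel"
proof -
  have "(\<lambda>y. (undefined, y)) \<in> borel \<rightarrow>\<^sub>M count_space UNIV \<Otimes>\<^sub>M borel" by measurable
  from measurable_compose[OF this cond_cdf_param_measurable[OF kernel_const]]
  show ?thesis by simp
qed

lemma cond_quantile_measurable [measurable]:
  "(\<lambda>(y, u). cond_quantile \<mu> y u) \<in> borel_measurable (borel \<Otimes>\<^sub>M borel)"
proof -
  have "(\<lambda>w. (undefined, w)) \<in> borel \<Otimes>\<^sub>M borel \<rightarrow>\<^sub>M count_space UNIV \<Otimes>\<^sub>M borel \<Otimes>\<^sub>M borel" by measurable
  from measurable_compose[OF this cond_quantile_param_measurable[OF kernel_const]]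
  show ?thesis by simp
qed

lemma integrable_cond_limit:
  "integrable \<mu> (\<lambda>p. cond_limit \<mu> {..r} (snd p) * indicator B (snd p))" if [measurable]: "B \<in> sets borel"
proof -
  interpret real_pair_prob \<mu> "{..r}" by (rule pair) simp
  show ?thesis
    using cond_limit_bounds by (intro integrable_bounded[where B=1]) (auto split: split_indicator)
qed

text \<open>Over the set \<open>B\<close> where the order fails, the difference integrates to at
  most 0, by monotonicity of the measure in the threshold. As the integrand is nonnegative, it
  vanishes almost everywhere.\<close>

lemma AE_cond_limit_mono:
  assumes "r \<le> q"
  shows "AE p in \<mu>. cond_limit \<mu> {..r} (snd p) \<le> cond_limit \<mu> {..q} (snd p)"
proof -
  interpret r: real_pair_prob \<mu> "{..r}" by (rule pair) simp
  interpret q: real_pair_prob \<mu> "{..q}" by (rule pair) simp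
  let ?h = "\<lambda>r. cond_limit \<mu> {..r}"
  define B where "B = {y. ?h q y < ?h r y}"
  have B [measurable]: "B \<in> sets borel"
    unfolding B_def using r.cond_limit_measurable q.cond_limit_measurable by measurable
  have int: "integrable \<mu> (\<lambda>p. (?h r (snd p) - ?h q (snd p)) * indicator B (snd p))"
    using integrable_cond_limit[OF B] by (simp add: left_diff_distrib)
  have "(\<integral>p. (?h r (snd p) - ?h q (snd p)) * indicator B (snd p) \<partial>\<mu>) = measure \<mu> ({..r} \<times> B) - measure \<mu> ({..q} \<times> B)"
    using integrable_cond_limit[OF B] r.integral_cond_limit[OF B] q.integral_cond_limit[OF B]
    by (simp add: left_diff_distrib)
  also have "\<dots> \<le> 0"
    using assms by (auto intro!: finite_measure_mono)
  finally have "(\<integral>p. (?h r (snd p) - ?h q (snd p)) * indicator B (snd p) \<partial>\<mu>) \<le> 0" .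
  moreover have nonneg: "0 \<le> (?h r (snd p) - ?h q (snd p)) * indicator B (snd p)" for p
    by (auto simp: B_def split: split_indicator)
  ultimately have "(\<integral>p. (?h r (snd p) - ?h q (snd p)) * indicator B (snd p) \<partial>\<mu>) = 0"
    using nonneg by (intro order.antisym Bochner_Integration.integral_nonneg)
  then have "AE p in \<mu>. (?h r (snd p) - ?h q (snd p)) * indicator B (snd p) = 0"
    using integral_nonneg_eq_0_iff_AE[OF int AE_I2] nonneg by blast
  then show ?thesis
    by eventually_elim (auto simp: B_def split: split_indicator_asm)
qed

lemma AE_cond_cdf:
  assumes "q \<in> \<rat>"
  shows "AE p in \<mu>. cond_cdf \<mu> q (snd p) = cond_limit \<mu> {..q} (snd p)"
proof -
  have "AE p in \<mu>. \<forall>r\<in>{r\<in>\<rat>. r \<le> q}. cond_limit \<mu> {..r} (snd p) \<le> cond_limit \<mu> {..q} (snd p)"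
    by (subst AE_ball_countable) (auto intro: AE_cond_limit_mono)
  then show ?thesis
  proof eventually_elim
    case (elim p)
    have "cond_cdf \<mu> q (snd p) \<le> cond_limit \<mu> {..q} (snd p)"
      unfolding cond_cdf_def using elim Rats_le_nonempty by (intro cSUP_least) auto
    moreover have "cond_limit \<mu> {..q} (snd p) \<le> cond_cdf \<mu> q (snd p)"
      unfolding cond_cdf_def using assms by (intro cSUP_upper cond_cdf_bdd) simp
    ultimately show ?case by simp
  qed
qed

lemma nn_integral_cond_cdf:
  assumes q: "q \<in> \<rat>" and B [measurable]: "B \<in> sets borel"
  shows "(\<integral>\<^sup>+p. ennreal (cond_cdf \<mu> q (snd p)) * indicator B (snd p) \<partial>\<mu>) = emeasure \<mu> ({..q} \<times> B)"
proof -
  interpret q: real_pair_prob \<mu> "{..q}" by (rule pair) simp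
  have "(\<integral>\<^sup>+p. ennreal (cond_cdf \<mu> q (snd p)) * indicator B (snd p) \<partial>\<mu>) =
      (\<integral>\<^sup>+p. ennreal (cond_limit \<mu> {..q} (snd p) * indicator B (snd p)) \<partial>\<mu>)"
    using AE_cond_cdf[OF q] by (intro nn_integral_cong_AE) (auto split: split_indicator)
  also have "\<dots> = ennreal (\<integral>p. cond_limit \<mu> {..q} (snd p) * indicator B (snd p) \<partial>\<mu>)"
    using q.cond_limit_bounds by (intro nn_integral_eq_integral integrable_cond_limit B) auto
  finally show ?thesis
    by (simp add: q.integral_cond_limit emeasure_eq_measure)
qed

text \<open>Approximation strictly from below writes the strict event
  \<open>cond_quantile \<mu> y u < t\<close> as a countable increasing union.\<close>

lemma rational_approx_below:
  assumes "0 < (t::real)" "t \<le> 1"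
  obtains r where "incseq r" "\<And>n. r n \<in> \<rat> \<inter> {0..1}" "\<And>n. r n < t" "\<And>s. s < t \<Longrightarrow> \<exists>n. s < r n"
proof -
  have "\<exists>q\<in>\<rat>. t - t / Suc n < q \<and> q < t" for n
    using assms by (intro Rats_dense_in_real) simp
  then obtain q where q: "\<And>n. q n \<in> \<rat>" "\<And>n. t - t / Suc n < q n" "\<And>n. q n < t"
    by metis
  \<comment> \<open>Running maxima make the chosen rationals increasing without leaving the set of
    chosen points.\<close>
  define r where "r n = Max (q ` {..n})" for n
  have r: "r n \<in> q ` {..n}" for n
    unfolding r_def by (intro Max_in) auto
  have pos: "0 \<le> q n" for n
  proof -
    have "t / Suc n \<le> t" using assms by (simp add: field_simps)
    then show ?thesis using q(2)[of n] by linarith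
  qed
  have le1: "q n \<le> 1" for n using q(3)[of n] assms(2) by linarith
  show thesis
  proof
    show "incseq r"
      unfolding r_def by (intro incseq_SucI Max_mono) auto
    show "r n \<in> \<rat> \<inter> {0..1}" "r n < t" for n
      using r[of n] q(1,3) pos le1 by auto
    fix s assume "s < t"
    then have "0 < t - s" by simp
    obtain n :: nat where "t / (t - s) < n" using reals_Archimedean2 by blast
    then have "t < n * (t - s)"
      using \<open>0 < t - s\<close> by (simp add: pos_divide_less_eq)
    also have "\<dots> \<le> Suc n * (t - s)"
      using \<open>0 < t - s\<close> by (intro mult_right_mono) auto
    finally have n: "t / Suc n < t - s"
      by (simp add: pos_divide_less_eq mult.commute)
    have "q n \<le> r n" unfolding r_def by (intro Max_ge) auto
    then have "s < r n" using n q(2)[of n] by linarith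
    then show "\<exists>n. s < r n" ..
  qed
qed

text \<open>For \<open>0 < t \<le> 1\<close> the event is the increasing union of the regions below
  the graphs of \<open>cond_cdf \<mu> (r n)\<close> over \<open>B\<close>. Each section has uniform
  measure equal to the height of the graph, and the heights integrate to the mass of
  \<open>{..r n} \<times> B\<close>. For other \<open>t\<close> the range of the quantile and the
  assumption \<open>bd\<close> decide.\<close>

lemma emeasure_cond_quantile:
  assumes B [measurable]: "B \<in> sets borel" and bd: "AE p in \<mu>. fst p \<in> {0..1}"
  shows "emeasure (distr \<mu> borel snd \<Otimes>\<^sub>M unit_uniform) {(y, u). cond_quantile \<mu> y u < t \<and> y \<in> B} =
    emeasure \<mu> ({..<t} \<times> B)"
proof -
  let ?\<nu> = "distr \<mu> borel snd"
  let ?P = "?\<nu> \<Otimes>\<^sub>M unit_uniform"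
  interpret U: prob_space unit_uniform by (rule prob_space_unit_uniform)
  interpret V: prob_space ?\<nu> by (rule prob_space_distr) measurable
  interpret P: pair_prob_space ?\<nu> unit_uniform ..
  have [measurable_cong]: "sets unit_uniform = sets borel" by simp
  consider "t \<le> 0" | "1 < t" | "0 < t" "t \<le> 1" by linarith
  then show ?thesis
  proof cases
    case 1
    have "{(y, u). cond_quantile \<mu> y u < t \<and> y \<in> B} = {}"
      using cond_quantile_bounds(1)[of \<mu>] 1 by (auto simp: not_less intro: order_trans)
    moreover have "emeasure \<mu> ({..<t} \<times> B) = 0"
    proof -
      have "AE p in \<mu>. p \<notin> {..<t} \<times> B"
        using bd by eventually_elim (use 1 in auto)
      then show ?thesis
        by (subst (asm) AE_iff_measurable[of "{..<t} \<times> B"])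
          (use sets_eq_imp_space_eq[OF sets_mu] in \<open>auto simp: space_pair_measure\<close>)
    qed
    ultimately show ?thesis by (simp only: emeasure_empty)
  next
    case 2
    have "cond_quantile \<mu> y u < t" for y u
      using cond_quantile_bounds(2)[of \<mu> y u] 2 by linarith
    then have "{(y, u). cond_quantile \<mu> y u < t \<and> y \<in> B} = B \<times> UNIV" by auto
    then have "emeasure ?P {(y, u). cond_quantile \<mu> y u < t \<and> y \<in> B} = emeasure ?\<nu> B"
      using U.emeasure_space_1 by (simp add: U.emeasure_pair_measure_Times)
    also have "\<dots> = emeasure \<mu> (UNIV \<times> B)"
      using sets_eq_imp_space_eq[OF sets_mu]
      by (subst emeasure_distr) (auto simp: space_pair_measure intro!: arg_cong[where f="emeasure \<mu>"])
    also have "\<dots> = emeasure \<mu> ({..<t} \<times> B)"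
    proof (rule emeasure_eq_AE)
      show "AE p in \<mu>. p \<in> UNIV \<times> B \<longleftrightarrow> p \<in> {..<t} \<times> B"
        using bd by eventually_elim (use 2 in auto)
    qed measurable
    finally show ?thesis .
  next
    case 3
    obtain r where r: "incseq r" "\<And>n. r n \<in> \<rat> \<inter> {0..1}" "\<And>n. r n < t" "\<And>s. s < t \<Longrightarrow> \<exists>n. s < r n"
      using rational_approx_below[OF 3] by blast
    let ?S = "\<lambda>n. {(y, u). u < cond_cdf \<mu> (r n) y \<and> y \<in> B}"
    have "cond_quantile \<mu> y u < t \<longleftrightarrow> (\<exists>n. u < cond_cdf \<mu> (r n) y)" for y u
      unfolding cond_quantile_less_iff[OF 3(2)]
    proof safe
      fix q assume "q < t" "u < cond_cdf \<mu> q y"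
      moreover obtain n where "q < r n" using r(4)[OF \<open>q < t\<close>] by blast
      ultimately show "\<exists>n. u < cond_cdf \<mu> (r n) y"
        using cond_cdf_mono[of q "r n" \<mu> y] by (auto intro!: exI[of _ n])
    next
      fix n assume "u < cond_cdf \<mu> (r n) y"
      then show "\<exists>q\<in>\<rat> \<inter> {0..1}. q < t \<and> u < cond_cdf \<mu> q y"
        using r(2,3)[of n] by blast
    qed
    then have eq: "{(y, u). cond_quantile \<mu> y u < t \<and> y \<in> B} = (\<Union>n. ?S n)"
      by auto
    have S [measurable]: "?S n \<in> sets (borel \<Otimes>\<^sub>M borel)" for n
    proof -
      have "{w \<in> space (borel \<Otimes>\<^sub>M borel). snd w < cond_cdf \<mu> (r n) (fst w) \<and> fst w \<in> B} \<in> sets (borel \<Otimes>\<^sub>M borel)"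
        by measurable
      then show ?thesis by (simp add: space_pair_measure split_beta')
    qed
    have inc: "incseq ?S"
      using r(1) cond_cdf_mono[of "r _" "r _" \<mu>]
      by (auto simp: incseq_def intro: order.strict_trans2)
    have Sn: "emeasure ?P (?S n) = emeasure \<mu> ({..r n} \<times> B)" for n
    proof -
      have "emeasure ?P (?S n) = (\<integral>\<^sup>+y. emeasure unit_uniform (Pair y -` ?S n) \<partial>?\<nu>)"
        using S[of n] by (intro U.emeasure_pair_measure_alt) (simp cong: sets_pair_measure_cong)
      also have "\<dots> = (\<integral>\<^sup>+y. ennreal (cond_cdf \<mu> (r n) y) * indicator B y \<partial>?\<nu>)"
      proof (intro nn_integral_cong)
        fix y
        have "Pair y -` ?S n = (if y \<in> B then {..<cond_cdf \<mu> (r n) y} else {})" by auto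
        then show "emeasure unit_uniform (Pair y -` ?S n) = ennreal (cond_cdf \<mu> (r n) y) * indicator B y"
          using emeasure_unit_uniform_lessThan[OF cond_cdf_bounds] by auto
      qed
      also have "\<dots> = (\<integral>\<^sup>+p. ennreal (cond_cdf \<mu> (r n) (snd p)) * indicator B (snd p) \<partial>\<mu>)"
        by (subst nn_integral_distr) auto
      also have "\<dots> = emeasure \<mu> ({..r n} \<times> B)"
        using r(2) by (intro nn_integral_cond_cdf) auto
      finally show ?thesis .
    qed
    have "emeasure ?P (\<Union>n. ?S n) = (SUP n. emeasure ?P (?S n))"
      using S inc by (intro SUP_emeasure_incseq[symmetric]) (auto cong: sets_pair_measure_cong)
    also have "\<dots> = (SUP n. emeasure \<mu> ({..r n} \<times> B))"
      by (simp add: Sn)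
    also have "\<dots> = emeasure \<mu> (\<Union>n. {..r n} \<times> B)"
    proof (rule SUP_emeasure_incseq)
      show "range (\<lambda>n. {..r n} \<times> B) \<subseteq> sets \<mu>" by auto
      show "incseq (\<lambda>n. {..r n} \<times> B)"
        using r(1) by (auto simp: incseq_def intro: order_trans)
    qed
    also have "(\<Union>n. {..r n} \<times> B) = {..<t} \<times> B"
    proof (intro set_eqI iffI)
      fix p assume "p \<in> (\<Union>n. {..r n} \<times> B)"
      then obtain n where "fst p \<le> r n" "snd p \<in> B" by auto
      then show "p \<in> {..<t} \<times> B" using r(3)[of n] by (cases p) auto
    next
      fix p assume p: "p \<in> {..<t} \<times> B"
      then obtain n where "fst p < r n" using r(4)[of "fst p"] by auto
      then show "p \<in> (\<Union>n. {..r n} \<times> B)" using p by (cases p) (auto intro!: exI[of _ n])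
    qed
    finally show ?thesis
      unfolding eq .
  qed
qed

text \<open>For fixed \<open>B\<close> both sides are finite measures of the first factor of a
  rectangle, so open lower half-lines suffice, where \<open>emeasure_cond_quantile\<close> applies.
  Rectangles then determine the measure on the plane.\<close>

lemma distr_cond_quantile:
  assumes bd: "AE p in \<mu>. fst p \<in> {0..1}"
  shows "distr (distr \<mu> borel snd \<Otimes>\<^sub>M unit_uniform) (borel \<Otimes>\<^sub>M borel) (\<lambda>(y, u). (cond_quantile \<mu> y u, y)) = \<mu>"
    (is "?L = _")
proof -
  let ?\<nu> = "distr \<mu> borel snd"
  let ?P = "?\<nu> \<Otimes>\<^sub>M unit_uniform"
  interpret U: prob_space unit_uniform by (rule prob_space_unit_uniform)
  interpret V: prob_space ?\<nu> by (rule prob_space_distr) measurable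
  interpret P: pair_prob_space ?\<nu> unit_uniform ..
  have [measurable_cong]: "sets unit_uniform = sets borel" by simp
  have m [measurable]: "(\<lambda>(y, u). (cond_quantile \<mu> y u, y)) \<in> ?P \<rightarrow>\<^sub>M borel \<Otimes>\<^sub>M borel"
    by measurable
  interpret L: prob_space ?L by (rule P.prob_space_distr) (rule m)
  have spP: "space ?P = UNIV" by (simp add: space_pair_measure)
  have sp: "space \<mu> = UNIV"
    using sets_eq_imp_space_eq[OF sets_mu] by (simp add: space_pair_measure)
  have rect: "emeasure ?L (A \<times> B) = emeasure \<mu> (A \<times> B)"
    if A: "A \<in> sets borel" and B [measurable]: "B \<in> sets borel" for A B :: "real set"
  proof -
    define M1 where "M1 = distr (density ?L (\<lambda>p. indicator B (snd p))) borel fst"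
    define M2 where "M2 = distr (density \<mu> (\<lambda>p. indicator B (snd p))) borel fst"
    have e: "emeasure (distr (density R (\<lambda>p. indicator B (snd p))) borel fst) X = emeasure R (X \<times> B)"
      if [measurable_cong]: "sets R = sets (borel \<Otimes>\<^sub>M borel)" and [measurable]: "X \<in> sets borel" 
      for R :: "(real \<times> real) measure" and X :: "real set"
    proof -
      have "space R = UNIV"
        using sets_eq_imp_space_eq[OF that(1)] by (simp add: space_pair_measure)
      then have "emeasure (distr (density R (\<lambda>p. indicator B (snd p))) borel fst) X =
          (\<integral>\<^sup>+p. indicator B (snd p) * indicator (fst -` X) p \<partial>R)"
        using measurable_sets[of fst R borel X] by (subst emeasure_distr) (auto simp: emeasure_density)
      also have "\<dots> = (\<integral>\<^sup>+p. indicator (X \<times> B) p \<partial>R)"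
        by (intro nn_integral_cong) (auto split: split_indicator)
      also have "\<dots> = emeasure R (X \<times> B)"
        by (intro nn_integral_indicator) measurable
      finally show ?thesis .
    qed
    have e1: "emeasure M1 X = emeasure ?L (X \<times> B)" if "X \<in> sets borel" for X
      unfolding M1_def using that by (intro e) simp_all
    have e2: "emeasure M2 X = emeasure \<mu> (X \<times> B)" if "X \<in> sets borel" for X
      unfolding M2_def using that by (intro e sets_mu)
    have "M1 = M2"
    proof (rule measure_eqI_generator_eq[where \<Omega>=UNIV and E="range lessThan" and A="\<lambda>i. {..<real i}"])
      show "Int_stable (range lessThan :: real set set)"
      proof (rule Int_stableI, safe)
        fix a b :: real
        have "{..<a} \<inter> {..<b} = {..<min a b}" by auto
        then show "{..<a} \<inter> {..<b} \<in> range lessThan" by (rule range_eqI)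
      qed
      have "sets (borel :: real measure) = sigma_sets UNIV (range lessThan)"
        unfolding borel_Iio by (rule sets_measure_of) simp
      then show "sets M1 = sigma_sets UNIV (range lessThan)" "sets M2 = sigma_sets UNIV (range lessThan)"
        by (simp_all only: M1_def M2_def sets_distr)
      show "(\<Union>i. {..<real i}) = UNIV"
        using reals_Archimedean2 by auto
      show "emeasure M1 {..<real i} \<noteq> \<infinity>" for i
        using e1[of "{..<real i}"] L.emeasure_finite by simp
      fix X :: "real set" assume "X \<in> range lessThan"
      then obtain t where X: "X = {..<t}" by auto
      have "emeasure M1 X = emeasure ?P {(y, u). cond_quantile \<mu> y u < t \<and> y \<in> B}"
        unfolding X
        by (subst e1, simp, subst emeasure_distr[OF m]) (auto simp: spP intro!: arg_cong[where f="emeasure ?P"])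
      then show "emeasure M1 X = emeasure M2 X"
        using emeasure_cond_quantile[OF B bd, of t] e2[of X] X by simp
    qed auto
    then show ?thesis
      using e1[OF A] e2[OF A] by simp
  qed
  show ?thesis
  proof (rule measure_eqI_generator_eq[where \<Omega>=UNIV and E="{a \<times> b | a b. a \<in> sets borel \<and> b \<in> sets borel}" and A="\<lambda>_. UNIV"])
    show "Int_stable {a \<times> b | a b. a \<in> sets (borel :: real measure) \<and> b \<in> sets (borel :: real measure)}"
      by (rule Int_stable_pair_measure_generator)
    show "sets ?L = sigma_sets UNIV {a \<times> b | a b. a \<in> sets borel \<and> b \<in> sets borel}"
      "sets \<mu> = sigma_sets UNIV {a \<times> b | a b. a \<in> sets borel \<and> b \<in> sets borel}"
      using sets_mu by (simp_all add: sets_pair_measure)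
    show "range (\<lambda>_. UNIV) \<subseteq> {a \<times> b | a b. a \<in> sets (borel :: real measure) \<and> b \<in> sets (borel :: real measure)}"
      by (auto intro!: exI[of _ UNIV])
    show "emeasure ?L UNIV \<noteq> \<infinity>" by simp
    show "emeasure ?L X = emeasure \<mu> X" if "X \<in> {a \<times> b | a b. a \<in> sets borel \<and> b \<in> sets borel}" for X
      using that rect by auto
  qed auto
qed

end

theorem real_kernel_disintegration:
  assumes \<kappa>: "\<kappa> \<in> N \<rightarrow>\<^sub>M prob_algebra (borel \<Otimes>\<^sub>M borel :: (real \<times> real) measure)"
    and bd: "\<And>z. z \<in> space N \<Longrightarrow> AE p in \<kappa> z. fst p \<in> {0..1}"
  obtains \<Xi> where "(\<lambda>(z, y, u). \<Xi> z y u) \<in> borel_measurable (N \<Otimes>\<^sub>M borel \<Otimes>\<^sub>M borel)"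
    "\<And>z. z \<in> space N \<Longrightarrow>
       distr (distr (\<kappa> z) borel snd \<Otimes>\<^sub>M unit_uniform) (borel \<Otimes>\<^sub>M borel) (\<lambda>(y, u). (\<Xi> z y u, y)) = \<kappa> z"
proof
  show "(\<lambda>(z, y, u). cond_quantile (\<kappa> z) y u) \<in> borel_measurable (N \<Otimes>\<^sub>M borel \<Otimes>\<^sub>M borel)"
    by (rule cond_quantile_param_measurable[OF \<kappa>])
  fix z assume z: "z \<in> space N"
  interpret real_pair_prob_space "\<kappa> z"
    using real_pair_probI[OF \<kappa> z, of UNIV]
    by (simp add: real_pair_prob_def real_pair_prob_axioms_def real_pair_prob_space_def real_pair_prob_space_axioms_def)
  show "distr (distr (\<kappa> z) borel snd \<Otimes>\<^sub>M unit_uniform) (borel \<Otimes>\<^sub>M borel)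
      (\<lambda>(y, u). (cond_quantile (\<kappa> z) y u, y)) = \<kappa> z"
    by (rule distr_cond_quantile[OF bd[OF z]])
qed

section \<open>Universal measurability\<close>

definition universal :: "'a measure \<Rightarrow> 'a measure" where
  "universal M = sigma (space M) (universally_measurable_sets M)"

lemma universal_omega_eq: "universal_omega = universal borel_omega"
  by (simp add: universal_omega_def universal_def)

lemma space_universal [simp]: "space (universal M) = space M"
  by (simp add: universal_def space_measure_of_conv)

lemma sets_universal: "sets (universal M) = universally_measurable_sets M"
  using sigma_algebra.sets_measure_of_eq[OF sigma_algebra_universally_measurable_sets[of M]]
  by (simp add: universal_def)

lemma space_prob_algebraD:
  assumes "\<mu> \<in> space (prob_algebra M)"
  shows "prob_space \<mu>" "sets \<mu> = sets M" "space \<mu> = space M"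
  using assms by (auto simp: space_prob_algebra dest: sets_eq_imp_space_eq)

lemma distr_in_prob_algebra:
  assumes "\<mu> \<in> space (prob_algebra M)" "f \<in> M \<rightarrow>\<^sub>M N"
  shows "distr \<mu> N f \<in> space (prob_algebra N)"
  using measurable_distr_prob_space[OF assms(2)] assms(1) by (rule measurable_space)

lemma sets_subset_universal: "sets M \<subseteq> sets (universal M)"
proof
  fix A assume A: "A \<in> sets M"
  then have "A \<in> sets (completion \<mu>)" if "\<mu> \<in> space (prob_algebra M)" for \<mu>
    using space_prob_algebraD[OF that] by auto
  then show "A \<in> sets (universal M)"
    using sets.sets_into_space[OF A] by (auto simp: sets_universal universally_measurable_sets_def)
qed

lemma measurable_universal_id: "(\<lambda>x. x) \<in> universal M \<rightarrow>\<^sub>M M"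
  using sets_subset_universal[of M] by (auto simp: measurable_def Int_absorb2 sets.sets_into_space)

lemma measurable_universalI1: "f \<in> M \<rightarrow>\<^sub>M N \<Longrightarrow> f \<in> universal M \<rightarrow>\<^sub>M N"
  using measurable_compose[OF measurable_universal_id] by auto

lemma universal_sandwich:
  assumes "A \<in> sets (universal M)" "\<mu> \<in> space (prob_algebra M)"
  obtains S N where "S \<in> sets M" "N \<in> null_sets \<mu>" "S \<subseteq> A" "A \<subseteq> S \<union> N"
proof -
  have "A \<in> sets (completion \<mu>)"
    using assms by (auto simp: sets_universal universally_measurable_sets_def)
  then obtain S N N' where "A = S \<union> N" "N \<subseteq> N'" "N' \<in> null_sets \<mu>" "S \<in> sets \<mu>"
    by (rule sets_completionE)
  then show thesis
    using space_prob_algebraD[OF assms(2)] by (intro that[of S N']) auto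
qed

lemma measurable_completion_universal:
  assumes "\<mu> \<in> space (prob_algebra M)" "f \<in> universal M \<rightarrow>\<^sub>M N"
  shows "f \<in> completion \<mu> \<rightarrow>\<^sub>M N"
  using assms space_prob_algebraD[OF assms(1)]
  by (auto simp: measurable_def sets_universal universally_measurable_sets_def)

lemma prob_space_completion: "prob_space \<mu> \<Longrightarrow> prob_space (completion \<mu>)"
  by (rule prob_spaceI) (simp add: prob_space.emeasure_space_1)

text \<open>A completion contains every set that is almost everywhere equal to one of its members.
  The comparison set \<open>B\<close> may depend on \<open>\<mu>\<close>.\<close>

lemma universal_setI:
  assumes "A \<subseteq> space M"
    "\<And>\<mu>. \<mu> \<in> space (prob_algebra M) \<Longrightarrow>
       \<exists>B\<in>sets (completion \<mu>). AE x in completion \<mu>. x \<in> B \<longleftrightarrow> x \<in> A"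
  shows "A \<in> sets (universal M)"
proof -
  have "A \<in> sets (completion \<mu>)" if \<mu>: "\<mu> \<in> space (prob_algebra M)" for \<mu>
  proof -
    obtain B where "B \<in> sets (completion \<mu>)" "AE x in completion \<mu>. x \<in> B \<longleftrightarrow> x \<in> A"
      using assms(2)[OF \<mu>] by blast
    then show ?thesis
      using completion.in_sets_AE[of B A \<mu>]
        assms(1) space_prob_algebraD[OF \<mu>] by simp
  qed
  then show ?thesis
    using assms(1) by (simp add: sets_universal universally_measurable_sets_def)
qed

text \<open>Passing to universally measurable sets in the target is free: the completed law is
  pushed forward, the set is squeezed there, and the null part pulls back to a null set.
  Consequently universally measurable maps compose.\<close>

lemma measurable_universalI:
  assumes f: "f \<in> universal M \<rightarrow>\<^sub>M N"
  shows "f \<in> universal M \<rightarrow>\<^sub>M universal N"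
proof (rule measurableI)
  show "f x \<in> space (universal N)" if "x \<in> space (universal M)" for x
    using measurable_space[OF f that] by simp
  fix A assume A: "A \<in> sets (universal N)"
  show "f -` A \<inter> space (universal M) \<in> sets (universal M)"
  proof (rule universal_setI)
    fix \<mu> assume \<mu>: "\<mu> \<in> space (prob_algebra M)"
    have f': "f \<in> completion \<mu> \<rightarrow>\<^sub>M N"
      using measurable_completion_universal[OF \<mu> f] .
    have "distr (completion \<mu>) N f \<in> space (prob_algebra N)"
      using prob_space.prob_space_distr[OF prob_space_completion f'] space_prob_algebraD(1)[OF \<mu>]
      by (simp add: space_prob_algebra)
    then obtain S N' where S: "S \<in> sets N" "N' \<in> null_sets (distr (completion \<mu>) N f)"
      "S \<subseteq> A" "A \<subseteq> S \<union> N'"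
      by (rule universal_sandwich[OF A])
    have "AE x in distr (completion \<mu>) N f. x \<notin> N'"
      using S(2) by (rule AE_not_in)
    then have "AE x in completion \<mu>. f x \<notin> N'"
      by (rule AE_distrD[OF f'])
    then have "AE x in completion \<mu>. x \<in> f -` S \<inter> space (completion \<mu>) \<longleftrightarrow> x \<in> f -` A \<inter> space (universal M)"
    proof eventually_elim
      case (elim x)
      then show ?case using S(3,4) space_prob_algebraD(3)[OF \<mu>] by auto
    qed
    then show "\<exists>B\<in>sets (completion \<mu>). AE x in completion \<mu>. x \<in> B \<longleftrightarrow> x \<in> f -` A \<inter> space (universal M)"
      using measurable_sets[OF f' S(1)] by blast
  qed auto
qed

text \<open>For a probability measure this is its completion restricted to the universally
  measurable sets; by \<open>universal_eqI\<close> no other probability measure extends it to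
  them.\<close>

definition universal_extension :: "'a measure \<Rightarrow> 'a measure \<Rightarrow> 'a measure" where
  "universal_extension M \<mu> = distr (completion \<mu>) (universal M) (\<lambda>x. x)"

lemma universal_extension:
  assumes \<mu>: "\<mu> \<in> space (prob_algebra M)"
  shows "universal_extension M \<mu> \<in> space (prob_algebra (universal M))"
    and "\<And>A. A \<in> sets M \<Longrightarrow> emeasure (universal_extension M \<mu>) A = emeasure \<mu> A"
proof -
  have m: "(\<lambda>x. x) \<in> completion \<mu> \<rightarrow>\<^sub>M universal M"
    by (rule measurable_completion_universal[OF \<mu>]) simp
  show "universal_extension M \<mu> \<in> space (prob_algebra (universal M))"
    using prob_space.prob_space_distr[OF prob_space_completion m] space_prob_algebraD(1)[OF \<mu>]
    by (simp add: space_prob_algebra universal_extension_def)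
  show "emeasure (universal_extension M \<mu>) A = emeasure \<mu> A" if A: "A \<in> sets M" for A
    using A sets_subset_universal[of M] space_prob_algebraD[OF \<mu>] sets.sets_into_space[OF A]
    unfolding universal_extension_def
    by (subst emeasure_distr[OF m]) (auto simp: Int_absorb2)
qed

text \<open>The squeezing sets are chosen for the restriction of \<open>P\<close> to
  \<open>sets M\<close>. The null part is null for \<open>Q\<close> too because \<open>P\<close> and
  \<open>Q\<close> agree on \<open>sets M\<close>.\<close>

lemma universal_eqI:
  assumes P: "P \<in> space (prob_algebra (universal M))" and Q: "Q \<in> space (prob_algebra (universal M))"
    and eq: "\<And>A. A \<in> sets M \<Longrightarrow> emeasure P A = emeasure Q A"
  shows "P = Q"
proof (rule measure_eqI)
  note D = space_prob_algebraD[OF P] space_prob_algebraD[OF Q]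
  show "sets P = sets Q" using D by simp
  fix A assume "A \<in> sets P"
  then have A: "A \<in> sets (universal M)" using D by simp
  have "distr P M (\<lambda>x. x) \<in> space (prob_algebra M)"
    by (rule distr_in_prob_algebra[OF P measurable_universal_id])
  then obtain S N where S: "S \<in> sets M" "N \<in> null_sets (distr P M (\<lambda>x. x))" "S \<subseteq> A" "A \<subseteq> S \<union> N"
    by (rule universal_sandwich[OF A])
  have idP: "(\<lambda>x. x) \<in> P \<rightarrow>\<^sub>M M"
    using measurable_universal_id[of M] D by (simp cong: measurable_cong_sets)
  have N: "N \<in> sets M" "emeasure P N = 0"
    using S(2) sets.sets_into_space[of N M] D
    by (auto simp: null_sets_def emeasure_distr[OF idP] Int_absorb2)
  have "emeasure R A = emeasure R S"
    if R: "R \<in> space (prob_algebra (universal M))" "emeasure R N = 0" for R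
  proof (rule antisym)
    note DR = space_prob_algebraD[OF R(1)]
    have sR: "S \<in> sets R" "N \<in> sets R" "A \<in> sets R"
      using DR S(1) N(1) A sets_subset_universal[of M] by auto
    have "emeasure R A \<le> emeasure R (S \<union> N)"
      using S(4) sR by (intro emeasure_mono) auto
    also have "\<dots> \<le> emeasure R S + emeasure R N"
      using sR by (intro emeasure_subadditive) auto
    finally show "emeasure R A \<le> emeasure R S"
      using R(2) by simp
    show "emeasure R S \<le> emeasure R A"
      using S(3) sR by (intro emeasure_mono) auto
  qed
  from this[OF P N(2)] this[OF Q] eq[OF N(1)] eq[OF S(1)] N(2)
  show "emeasure P A = emeasure Q A" by simp
qed

text \<open>A universally measurable subset of a product is sandwiched between measurable sets that
  differ by a null set of the product measure, so almost all of its sections are squeezed as well.\<close>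

lemma universal_section_eq:
  assumes E: "E \<in> sets (universal (M \<Otimes>\<^sub>M N))"
    and \<mu>: "\<mu> \<in> space (prob_algebra M)" and Q: "Q \<in> space (prob_algebra (universal N))"
  obtains S where "S \<in> sets (M \<Otimes>\<^sub>M N)"
    "AE x in \<mu>. emeasure Q (Pair x -` E) = emeasure (distr Q N (\<lambda>x. x)) (Pair x -` S)"
    "\<And>P. P \<in> space (prob_algebra (universal M)) \<Longrightarrow> distr P M (\<lambda>x. x) = \<mu> \<Longrightarrow>
       AE y in distr Q N (\<lambda>x. x). emeasure P ((\<lambda>x. (x, y)) -` E) = emeasure \<mu> ((\<lambda>x. (x, y)) -` S)"
proof -
  define \<nu> where "\<nu> = distr Q N (\<lambda>x. x)"
  have \<nu>: "\<nu> \<in> space (prob_algebra N)"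
    unfolding \<nu>_def by (rule distr_in_prob_algebra[OF Q measurable_universal_id])
  note D = space_prob_algebraD[OF \<mu>] space_prob_algebraD[OF \<nu>] space_prob_algebraD[OF Q]
  interpret \<mu>: prob_space \<mu> by (rule D)
  interpret \<nu>: prob_space \<nu> by (rule D)
  interpret pair_prob_space \<mu> \<nu> ..
  have sp: "sets (\<mu> \<Otimes>\<^sub>M \<nu>) = sets (M \<Otimes>\<^sub>M N)"
    using D by (intro sets_pair_measure_cong)
  have "\<mu> \<Otimes>\<^sub>M \<nu> \<in> space (prob_algebra (M \<Otimes>\<^sub>M N))"
    using sp prob_space_axioms by (simp add: space_prob_algebra)
  then obtain S T where S: "S \<in> sets (M \<Otimes>\<^sub>M N)" "T \<in> null_sets (\<mu> \<Otimes>\<^sub>M \<nu>)" "S \<subseteq> E" "E \<subseteq> S \<union> T"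
    by (rule universal_sandwich[OF E])
  have T: "T \<in> sets (M \<Otimes>\<^sub>M N)"
    using S(2) sp by auto
  \<comment> \<open>Stated for an arbitrary space so that it can be applied to the sections in both
    directions.\<close>
  have squeeze: "emeasure R E' = emeasure (distr R L (\<lambda>x. x)) S'"
    if R: "R \<in> space (prob_algebra (universal L))" and "E' \<in> sets (universal L)" "S' \<in> sets L" "T' \<in> sets L"
      "S' \<subseteq> E'" "E' \<subseteq> S' \<union> T'" "emeasure (distr R L (\<lambda>x. x)) T' = 0"
    for R :: "'c measure" and L E' S' T'
  proof -
    note DR = space_prob_algebraD[OF R]
    have i: "(\<lambda>x. x) \<in> R \<rightarrow>\<^sub>M L"
      using measurable_universal_id[of L] DR by (simp cong: measurable_cong_sets)
    have e: "emeasure (distr R L (\<lambda>x. x)) B = emeasure R B" if "B \<in> sets L" for B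
      using that sets.sets_into_space[OF that] DR by (simp add: emeasure_distr[OF i] Int_absorb2)
    have sR: "S' \<in> sets R" "T' \<in> sets R" "E' \<in> sets R"
      using DR that sets_subset_universal[of L] by auto
    have "emeasure R E' \<le> emeasure R (S' \<union> T')"
      using that sR by (intro emeasure_mono) auto
    also have "\<dots> \<le> emeasure R S' + emeasure R T'"
      using sR by (intro emeasure_subadditive) auto
    finally have "emeasure R E' \<le> emeasure R S'"
      using that e by simp
    moreover have "emeasure R S' \<le> emeasure R E'"
      using that sR by (intro emeasure_mono) auto
    ultimately show ?thesis using e that by simp
  qed
  have ae: "AE z in \<mu> \<Otimes>\<^sub>M \<nu>. z \<notin> T"
    using S(2) by (rule AE_not_in)
  have aeT: "AE x in \<mu>. AE y in \<nu>. (x, y) \<notin> T"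
    using AE_pair[OF ae] .
  have aeT': "AE y in \<nu>. AE x in \<mu>. (x, y) \<notin> T"
  proof -
    have "{x \<in> space (\<mu> \<Otimes>\<^sub>M \<nu>). x \<notin> T} = space (\<mu> \<Otimes>\<^sub>M \<nu>) - T"
      by auto
    also have "\<dots> \<in> sets (\<mu> \<Otimes>\<^sub>M \<nu>)"
      using T sp by (intro sets.compl_sets) simp
    finally show ?thesis
      using AE_commute[of "\<lambda>x y. (x, y) \<notin> T"] aeT by simp
  qed
  have 1: "AE x in \<mu>. emeasure Q (Pair x -` E) = emeasure \<nu> (Pair x -` S)"
    using aeT AE_space
  proof eventually_elim
    case (elim x)
    have x: "x \<in> space M" using elim D by simp
    have "Pair x \<in> universal N \<rightarrow>\<^sub>M M \<Otimes>\<^sub>M N"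
      using x by (intro measurable_universalI1) simp
    from measurable_sets[OF measurable_universalI[OF this] E]
    have E': "Pair x -` E \<inter> space N \<in> sets (universal N)"
      by simp
    have sub: "Pair x -` E \<subseteq> space N"
      using sets.sets_into_space[OF E] by (auto simp: space_pair_measure)
    have "emeasure \<nu> (Pair x -` T) = 0"
      using elim(1) sets_Pair1[OF T, of x] D by (subst AE_iff_measurable[symmetric, where P="\<lambda>y. (x, y) \<notin> T"])
        (use sets.sets_into_space[OF T] in \<open>auto simp: space_pair_measure\<close>)
    then show ?case
      unfolding \<nu>_def
      using sub S(3,4) E' sets_Pair1[OF S(1), of x] sets_Pair1[OF T, of x]
      by (intro squeeze[OF Q, of _ _ "Pair x -` T"]) (auto simp: Int_absorb2)
  qed
  have 2: "AE y in \<nu>. emeasure P ((\<lambda>x. (x, y)) -` E) = emeasure \<mu> ((\<lambda>x. (x, y)) -` S)"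
    if P: "P \<in> space (prob_algebra (universal M))" "distr P M (\<lambda>x. x) = \<mu>" for P
    using aeT' AE_space
  proof eventually_elim
    case (elim y)
    have y: "y \<in> space N" using elim D by simp
    have "(\<lambda>x. (x, y)) \<in> universal M \<rightarrow>\<^sub>M M \<Otimes>\<^sub>M N"
      using y by (intro measurable_universalI1) simp
    from measurable_sets[OF measurable_universalI[OF this] E]
    have E': "(\<lambda>x. (x, y)) -` E \<inter> space M \<in> sets (universal M)"
      by simp
    have sub: "(\<lambda>x. (x, y)) -` E \<subseteq> space M"
      using sets.sets_into_space[OF E] by (auto simp: space_pair_measure)
    have "emeasure \<mu> ((\<lambda>x. (x, y)) -` T) = 0"
      using elim(1) sets_Pair2[OF T, of y] D by (subst AE_iff_measurable[symmetric, where P="\<lambda>x. (x, y) \<notin> T"])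
        (use sets.sets_into_space[OF T] in \<open>auto simp: space_pair_measure\<close>)
    then show ?case
      using sub S(3,4) E' sets_Pair2[OF S(1), of y] sets_Pair2[OF T, of y] P(2)
      by (subst P(2)[symmetric], intro squeeze[OF P(1), of _ _ "(\<lambda>x. (x, y)) -` T"]) (auto simp: Int_absorb2)
  qed
  show thesis
    using that[OF S(1)] 1 2 unfolding \<nu>_def by blast
qed

text \<open>For each \<open>\<mu>\<close> the section function equals almost everywhere that of a
  measurable set \<open>S\<close>, whose section function is measurable. That \<open>S\<close>
  depends on \<open>\<mu>\<close> is harmless by \<open>universal_setI\<close>.\<close>

lemma universal_sections_measurable:
  assumes E: "E \<in> sets (universal (M \<Otimes>\<^sub>M N))" and Q: "Q \<in> space (prob_algebra (universal N))"
  shows "(\<lambda>x. emeasure Q (Pair x -` E)) \<in> borel_measurable (universal M)"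
proof (rule measurableI)
  fix A :: "ennreal set" assume A: "A \<in> sets borel"
  show "(\<lambda>x. emeasure Q (Pair x -` E)) -` A \<inter> space (universal M) \<in> sets (universal M)"
  proof (rule universal_setI)
    fix \<mu> assume \<mu>: "\<mu> \<in> space (prob_algebra M)"
    obtain S where S: "S \<in> sets (M \<Otimes>\<^sub>M N)"
      "AE x in \<mu>. emeasure Q (Pair x -` E) = emeasure (distr Q N (\<lambda>x. x)) (Pair x -` S)"
      using universal_section_eq[OF E \<mu> Q] by blast
    have "distr Q N (\<lambda>x. x) \<in> space (prob_algebra N)"
      by (rule distr_in_prob_algebra[OF Q measurable_universal_id])
    note \<nu> = space_prob_algebraD[OF this]
    interpret \<nu>: prob_space "distr Q N (\<lambda>x. x)" by (rule \<nu>)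
    have "S \<in> sets (M \<Otimes>\<^sub>M distr Q N (\<lambda>x. x))"
      using S(1) by (simp cong: sets_pair_measure_cong)
    then have "(\<lambda>x. emeasure (distr Q N (\<lambda>x. x)) (Pair x -` S)) \<in> borel_measurable M"
      by (rule \<nu>.measurable_emeasure_Pair)
    from measurable_sets[OF this A]
    have B: "(\<lambda>x. emeasure (distr Q N (\<lambda>x. x)) (Pair x -` S)) -` A \<inter> space M \<in> sets (completion \<mu>)"
      using space_prob_algebraD[OF \<mu>] by auto
    have "AE x in completion \<mu>. emeasure Q (Pair x -` E) = emeasure (distr Q N (\<lambda>x. x)) (Pair x -` S)"
      using S(2) by (rule AE_completion)
    then have "AE x in completion \<mu>. x \<in> (\<lambda>x. emeasure (distr Q N (\<lambda>x. x)) (Pair x -` S)) -` A \<inter> space M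
        \<longleftrightarrow> x \<in> (\<lambda>x. emeasure Q (Pair x -` E)) -` A \<inter> space (universal M)"
      by eventually_elim auto
    with B show "\<exists>B\<in>sets (completion \<mu>). AE x in completion \<mu>. x \<in> B \<longleftrightarrow>
        x \<in> (\<lambda>x. emeasure Q (Pair x -` E)) -` A \<inter> space (universal M)"
      by blast
  qed auto
qed simp

text \<open>One measurable set \<open>S\<close> serves both orders of integration: its sections have
  almost everywhere the same measure as those of \<open>E\<close>, in either direction, and for
  \<open>S\<close> the classical theorem applies.\<close>

lemma universal_Fubini:
  assumes E: "E \<in> sets (universal (M \<Otimes>\<^sub>M N))"
    and P: "P \<in> space (prob_algebra (universal M))" and Q: "Q \<in> space (prob_algebra (universal N))"
  shows "(\<integral>\<^sup>+x. emeasure Q (Pair x -` E) \<partial>P) = (\<integral>\<^sup>+y. emeasure P ((\<lambda>x. (x, y)) -` E) \<partial>Q)"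
proof -
  define \<mu> \<nu> where "\<mu> = distr P M (\<lambda>x. x)" and "\<nu> = distr Q N (\<lambda>x. x)"
  have \<mu>: "\<mu> \<in> space (prob_algebra M)"
    unfolding \<mu>_def by (rule distr_in_prob_algebra[OF P measurable_universal_id])
  have \<nu>: "\<nu> \<in> space (prob_algebra N)"
    unfolding \<nu>_def by (rule distr_in_prob_algebra[OF Q measurable_universal_id])
  note D = space_prob_algebraD[OF \<mu>] space_prob_algebraD[OF \<nu>] space_prob_algebraD[OF Q] space_prob_algebraD[OF P]
  interpret \<mu>: prob_space \<mu> by (rule D)
  interpret \<nu>: prob_space \<nu> by (rule D)
  interpret pair_prob_space \<mu> \<nu> ..
  have sp: "sets (\<mu> \<Otimes>\<^sub>M \<nu>) = sets (M \<Otimes>\<^sub>M N)"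
    using D by (intro sets_pair_measure_cong)
  have idP: "(\<lambda>x. x) \<in> P \<rightarrow>\<^sub>M M" and idQ: "(\<lambda>x. x) \<in> Q \<rightarrow>\<^sub>M N"
    using measurable_universal_id[of M] measurable_universal_id[of N] D by (simp_all cong: measurable_cong_sets)
  obtain S where S: "S \<in> sets (M \<Otimes>\<^sub>M N)"
    "AE x in \<mu>. emeasure Q (Pair x -` E) = emeasure \<nu> (Pair x -` S)"
    "AE y in \<nu>. emeasure P ((\<lambda>x. (x, y)) -` E) = emeasure \<mu> ((\<lambda>x. (x, y)) -` S)"
  proof (rule universal_section_eq[OF E \<mu> Q])
    fix S assume a: "S \<in> sets (M \<Otimes>\<^sub>M N)"
      "AE x in \<mu>. emeasure Q (Pair x -` E) = emeasure (distr Q N (\<lambda>x. x)) (Pair x -` S)"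
    assume b: "\<And>P. P \<in> space (prob_algebra (universal M)) \<Longrightarrow> distr P M (\<lambda>x. x) = \<mu> \<Longrightarrow>
       AE y in distr Q N (\<lambda>x. x). emeasure P ((\<lambda>x. (x, y)) -` E) = emeasure \<mu> ((\<lambda>x. (x, y)) -` S)"
    show thesis
      using that[OF a(1) a(2)[folded \<nu>_def] b[OF P \<mu>_def[symmetric], folded \<nu>_def]] .
  qed
  have S': "S \<in> sets (\<mu> \<Otimes>\<^sub>M \<nu>)" using S(1) sp by simp
  have "(\<integral>\<^sup>+x. emeasure Q (Pair x -` E) \<partial>P) = (\<integral>\<^sup>+x. emeasure \<nu> (Pair x -` S) \<partial>P)"
    using AE_distrD[OF idP S(2)[unfolded \<mu>_def]] by (intro nn_integral_cong_AE)
  also have "\<dots> = (\<integral>\<^sup>+x. emeasure \<nu> (Pair x -` S) \<partial>\<mu>)"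
    unfolding \<mu>_def using \<nu>.measurable_emeasure_Pair[OF S'] D
    by (intro nn_integral_distr[symmetric] idP) (simp cong: measurable_cong_sets)
  also have "\<dots> = (\<integral>\<^sup>+y. emeasure \<mu> ((\<lambda>x. (x, y)) -` S) \<partial>\<nu>)"
    using S' by (simp flip: \<nu>.emeasure_pair_measure_alt emeasure_pair_measure_alt2)
  also have "\<dots> = (\<integral>\<^sup>+y. emeasure \<mu> ((\<lambda>x. (x, y)) -` S) \<partial>Q)"
    unfolding \<nu>_def using measurable_emeasure_Pair2[OF S'] D
    by (intro nn_integral_distr idQ) (simp cong: measurable_cong_sets)
  also have "\<dots> = (\<integral>\<^sup>+y. emeasure P ((\<lambda>x. (x, y)) -` E) \<partial>Q)"
    using AE_distrD[OF idQ S(3)[unfolded \<nu>_def]] by (intro nn_integral_cong_AE) auto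
  finally show ?thesis .
qed

section \<open>Quasi-measurable maps\<close>

lemma rvars_points:
  assumes "quasi_universal_space X" "\<xi> \<in> rvars X"
  shows "\<xi> \<omega> \<in> points X"
proof -
  have "\<xi> \<in> UNIV \<rightarrow> points X"
    using assms unfolding quasi_universal_space_def by (meson subsetD)
  then show ?thesis by (rule Pi_mem) simp
qed

lemma rvars_const: "quasi_universal_space X \<Longrightarrow> x \<in> points X \<Longrightarrow> (\<lambda>_. x) \<in> rvars X"
  unfolding quasi_universal_space_def by blast

lemma rvars_comp:
  assumes "quasi_universal_space X" "\<xi> \<in> rvars X" "\<Phi> \<in> universal_omega \<rightarrow>\<^sub>M universal_omega"
  shows "(\<lambda>\<omega>. \<xi> (\<Phi> \<omega>)) \<in> rvars X"
  using assms unfolding quasi_universal_space_def comp_def by blast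

lemma quasi_measurable_points: "f \<in> quasi_measurable X Y \<Longrightarrow> x \<in> points X \<Longrightarrow> f x \<in> points Y"
  unfolding quasi_measurable_def by blast

lemma quasi_measurable_rvars:
  "f \<in> quasi_measurable X Y \<Longrightarrow> \<xi> \<in> rvars X \<Longrightarrow> (\<lambda>\<omega>. f (\<xi> \<omega>)) \<in> rvars Y"
  unfolding quasi_measurable_def comp_def by blast

lemma quasi_measurableI:
  assumes "\<And>x. x \<in> points X \<Longrightarrow> f x \<in> points Y" "\<And>\<xi>. \<xi> \<in> rvars X \<Longrightarrow> (\<lambda>\<omega>. f (\<xi> \<omega>)) \<in> rvars Y"
  shows "f \<in> quasi_measurable X Y"
  using assms unfolding quasi_measurable_def comp_def by blast

lemma quasi_measurable_compose:
  assumes "f \<in> quasi_measurable X Y" "g \<in> quasi_measurable Y Z"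
  shows "(\<lambda>x. g (f x)) \<in> quasi_measurable X Z"
  using assms by (auto intro!: quasi_measurableI dest: quasi_measurable_points quasi_measurable_rvars)

lemma quasi_measurable_const:
  "quasi_universal_space Y \<Longrightarrow> y \<in> points Y \<Longrightarrow> (\<lambda>_. y) \<in> quasi_measurable X Y"
  by (auto intro!: quasi_measurableI rvars_const)

lemma quasi_measurable_ident: "(\<lambda>x. x) \<in> quasi_measurable X X"
  by (auto intro!: quasi_measurableI)

lemma quasi_measurable_cong:
  assumes "quasi_universal_space X" "f \<in> quasi_measurable X Y" "\<And>x. x \<in> points X \<Longrightarrow> f x = g x"
  shows "g \<in> quasi_measurable X Y"
proof (rule quasi_measurableI)
  show "g x \<in> points Y" if "x \<in> points X" for x
    using quasi_measurable_points[OF assms(2) that] assms(3)[OF that] by simp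
  show "(\<lambda>\<omega>. g (\<xi> \<omega>)) \<in> rvars Y" if "\<xi> \<in> rvars X" for \<xi>
    using quasi_measurable_rvars[OF assms(2) that] assms(3)[OF rvars_points[OF assms(1) that]] by simp
qed

lemma points_prod_space [simp]: "points (prod_space X Y) = points X \<times> points Y"
  by (simp add: prod_space_def)

lemma rvars_prod_space:
  "\<zeta> \<in> rvars (prod_space X Y) \<longleftrightarrow> (\<lambda>\<omega>. fst (\<zeta> \<omega>)) \<in> rvars X \<and> (\<lambda>\<omega>. snd (\<zeta> \<omega>)) \<in> rvars Y"
  by (simp add: prod_space_def comp_def)

lemma quasi_measurable_fst: "fst \<in> quasi_measurable (prod_space X Y) X"
  and quasi_measurable_snd: "snd \<in> quasi_measurable (prod_space X Y) Y"
  by (auto intro!: quasi_measurableI simp: rvars_prod_space)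

lemma quasi_measurable_Pair:
  assumes "f \<in> quasi_measurable Z X" "g \<in> quasi_measurable Z Y"
  shows "(\<lambda>z. (f z, g z)) \<in> quasi_measurable Z (prod_space X Y)"
  using assms by (auto intro!: quasi_measurableI simp: rvars_prod_space dest: quasi_measurable_points quasi_measurable_rvars)

lemma points_Pi_space: "points (Pi_space D X) = (\<Pi>\<^sub>E v\<in>D. points (X v))"
  by (simp add: Pi_space_def)

lemma rvars_Pi_space:
  "\<xi> \<in> rvars (Pi_space D X) \<longleftrightarrow> (\<forall>\<omega>. \<xi> \<omega> \<in> extensional D) \<and> (\<forall>v\<in>D. (\<lambda>\<omega>. \<xi> \<omega> v) \<in> rvars (X v))"
  by (simp add: Pi_space_def)

lemma quasi_measurable_component: "v \<in> D \<Longrightarrow> (\<lambda>x. x v) \<in> quasi_measurable (Pi_space D X) (X v)"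
  by (auto intro!: quasi_measurableI simp: rvars_Pi_space points_Pi_space)

lemma quasi_measurable_PiI:
  assumes "quasi_universal_space Z" "\<And>z. z \<in> points Z \<Longrightarrow> f z \<in> extensional D"
    "\<And>v. v \<in> D \<Longrightarrow> (\<lambda>z. f z v) \<in> quasi_measurable Z (X v)"
  shows "f \<in> quasi_measurable Z (Pi_space D X)"
proof (rule quasi_measurableI)
  show "f z \<in> points (Pi_space D X)" if "z \<in> points Z" for z
    using assms(2)[OF that] quasi_measurable_points[OF assms(3) that]
    by (auto simp: points_Pi_space PiE_def)
  show "(\<lambda>\<omega>. f (\<xi> \<omega>)) \<in> rvars (Pi_space D X)" if "\<xi> \<in> rvars Z" for \<xi>
    using assms(2)[OF rvars_points[OF assms(1) that]] quasi_measurable_rvars[OF assms(3) that]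
    by (auto simp: rvars_Pi_space)
qed

lemma quasi_universal_spaceI:
  assumes "\<And>\<xi> \<omega>. \<xi> \<in> rvars X \<Longrightarrow> \<xi> \<omega> \<in> points X" "\<And>x. x \<in> points X \<Longrightarrow> (\<lambda>_. x) \<in> rvars X"
    "\<And>\<xi> \<Phi>. \<xi> \<in> rvars X \<Longrightarrow> \<Phi> \<in> universal_omega \<rightarrow>\<^sub>M universal_omega \<Longrightarrow> (\<lambda>\<omega>. \<xi> (\<Phi> \<omega>)) \<in> rvars X"
  shows "quasi_universal_space X"
  using assms unfolding quasi_universal_space_def comp_def by blast

lemma quasi_universal_prod_space:
  assumes X: "quasi_universal_space X" and Y: "quasi_universal_space Y"
  shows "quasi_universal_space (prod_space X Y)"
proof (rule quasi_universal_spaceI)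
  show "\<xi> \<omega> \<in> points (prod_space X Y)" if "\<xi> \<in> rvars (prod_space X Y)" for \<xi> \<omega>
    using that rvars_points[OF X, of "\<lambda>\<omega>. fst (\<xi> \<omega>)" \<omega>] rvars_points[OF Y, of "\<lambda>\<omega>. snd (\<xi> \<omega>)" \<omega>]
    by (cases "\<xi> \<omega>") (auto simp: rvars_prod_space)
  show "(\<lambda>_. x) \<in> rvars (prod_space X Y)" if "x \<in> points (prod_space X Y)" for x
    using that rvars_const[OF X] rvars_const[OF Y] by (auto simp: rvars_prod_space)
  show "(\<lambda>\<omega>. \<xi> (\<Phi> \<omega>)) \<in> rvars (prod_space X Y)"
    if "\<xi> \<in> rvars (prod_space X Y)" "\<Phi> \<in> universal_omega \<rightarrow>\<^sub>M universal_omega" for \<xi> \<Phi>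
    using that rvars_comp[OF X, of "\<lambda>\<omega>. fst (\<xi> \<omega>)"] rvars_comp[OF Y, of "\<lambda>\<omega>. snd (\<xi> \<omega>)"]
    by (auto simp: rvars_prod_space)
qed

lemma quasi_universal_Pi_space:
  assumes X: "\<And>v. v \<in> D \<Longrightarrow> quasi_universal_space (X v)"
  shows "quasi_universal_space (Pi_space D X)"
proof (rule quasi_universal_spaceI)
  show "\<xi> \<omega> \<in> points (Pi_space D X)" if "\<xi> \<in> rvars (Pi_space D X)" for \<xi> \<omega>
    using that rvars_points[OF X, where \<xi>="\<lambda>\<omega>. \<xi> \<omega> _"] by (auto simp: rvars_Pi_space points_Pi_space PiE_def)
  show "(\<lambda>_. x) \<in> rvars (Pi_space D X)" if "x \<in> points (Pi_space D X)" for x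
    using that rvars_const[OF X] by (auto simp: rvars_Pi_space points_Pi_space PiE_def)
  show "(\<lambda>\<omega>. \<xi> (\<Phi> \<omega>)) \<in> rvars (Pi_space D X)"
    if "\<xi> \<in> rvars (Pi_space D X)" "\<Phi> \<in> universal_omega \<rightarrow>\<^sub>M universal_omega" for \<xi> \<Phi>
    using that rvars_comp[OF X, where \<xi>="\<lambda>\<omega>. \<xi> \<omega> _"] by (auto simp: rvars_Pi_space)
qed

lemma points_omega_space [simp]: "points omega_space = UNIV"
  and rvars_omega_space: "rvars omega_space = universal_omega \<rightarrow>\<^sub>M universal_omega"
  by (simp_all add: omega_space_def)

lemma quasi_universal_omega_space: "quasi_universal_space omega_space"
  by (rule quasi_universal_spaceI) (auto simp: rvars_omega_space)

lemma in_induced_setsI: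
  assumes "A \<subseteq> points X" "\<And>\<xi>. \<xi> \<in> rvars X \<Longrightarrow> \<xi> -` A \<in> sets universal_omega"
  shows "A \<in> induced_sets X"
  using assms by (simp add: induced_sets_def)

lemma measurable_rvars:
  assumes "quasi_universal_space X" "\<xi> \<in> rvars X"
  shows "\<xi> \<in> universal_omega \<rightarrow>\<^sub>M induced X"
  using assms rvars_points[OF assms]
  by (auto intro!: measurableI simp: sets_induced induced_sets_def)

lemma measurable_inducedI:
  assumes "quasi_universal_space X" "\<And>x. x \<in> points X \<Longrightarrow> f x \<in> space N"
    "\<And>\<xi>. \<xi> \<in> rvars X \<Longrightarrow> (\<lambda>\<omega>. f (\<xi> \<omega>)) \<in> universal_omega \<rightarrow>\<^sub>M N"
  shows "f \<in> induced X \<rightarrow>\<^sub>M N"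
proof (rule measurableI)
  show "f x \<in> space N" if "x \<in> space (induced X)" for x
    using assms(2) that by simp
  fix A assume A: "A \<in> sets N"
  have "f -` A \<inter> points X \<in> induced_sets X"
  proof (rule in_induced_setsI)
    fix \<xi> assume \<xi>: "\<xi> \<in> rvars X"
    have "\<xi> -` (f -` A \<inter> points X) = (\<lambda>\<omega>. f (\<xi> \<omega>)) -` A \<inter> space universal_omega"
      using rvars_points[OF assms(1) \<xi>] by auto
    also have "\<dots> \<in> sets universal_omega"
      using assms(3)[OF \<xi>] A by (rule measurable_sets)
    finally show "\<xi> -` (f -` A \<inter> points X) \<in> sets universal_omega" .
  qed simp
  then show "f -` A \<inter> space (induced X) \<in> sets (induced X)"
    by (simp add: sets_induced[OF assms(1)])
qed

lemma measurable_quasi_measurable: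
  assumes "quasi_universal_space X" "quasi_universal_space Y" "f \<in> quasi_measurable X Y"
  shows "f \<in> induced X \<rightarrow>\<^sub>M induced Y"
  using assms by (intro measurable_inducedI)
    (auto intro!: measurable_rvars dest: quasi_measurable_points quasi_measurable_rvars)

subsection \<open>The sample space and its square\<close>

lemma Rep_unit_interval_measurable [measurable]: "(\<lambda>\<omega>. Rep_unit_interval (\<omega> n)) \<in> borel_measurable borel_omega"
proof -
  have "(\<lambda>\<omega>. \<omega> n) \<in> borel_omega \<rightarrow>\<^sub>M vimage_algebra UNIV Rep_unit_interval borel"
    unfolding borel_omega_def by (rule measurable_component_singleton) simp
  moreover have "Rep_unit_interval \<in> vimage_algebra UNIV Rep_unit_interval borel \<rightarrow>\<^sub>M borel"
    by (rule measurable_vimage_algebra1) simp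
  ultimately show ?thesis by (rule measurable_compose)
qed

lemma measurable_borel_omegaI:
  assumes "\<And>n. (\<lambda>x. Rep_unit_interval (f x n)) \<in> borel_measurable M"
  shows "f \<in> M \<rightarrow>\<^sub>M borel_omega"
  unfolding borel_omega_def
proof (rule measurable_PiM_single')
  show "(\<lambda>x. f x n) \<in> M \<rightarrow>\<^sub>M vimage_algebra UNIV Rep_unit_interval borel" for n
    using assms by (intro measurable_vimage_algebra2) auto
qed simp

text \<open>Even and odd coordinates identify the sample space with its own square, which reduces
  two independent arguments to one.\<close>

definition omega_fst :: "omega \<Rightarrow> omega" where "omega_fst \<omega> = (\<lambda>n. \<omega> (2 * n))"

definition omega_snd :: "omega \<Rightarrow> omega" where "omega_snd \<omega> = (\<lambda>n. \<omega> (Suc (2 * n)))"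

definition omega_pair :: "omega \<times> omega \<Rightarrow> omega" where
  "omega_pair p = (\<lambda>n. if even n then fst p (n div 2) else snd p (n div 2))"

lemma omega_pair_simps [simp]: "omega_fst (omega_pair p) = fst p" "omega_snd (omega_pair p) = snd p"
  by (auto simp: omega_fst_def omega_snd_def omega_pair_def)

lemma measurable_omega_fst [measurable]: "omega_fst \<in> borel_omega \<rightarrow>\<^sub>M borel_omega"
  and measurable_omega_snd [measurable]: "omega_snd \<in> borel_omega \<rightarrow>\<^sub>M borel_omega"
  by (rule measurable_borel_omegaI, simp add: omega_fst_def omega_snd_def)+

lemma measurable_omega_pair [measurable]: "omega_pair \<in> borel_omega \<Otimes>\<^sub>M borel_omega \<rightarrow>\<^sub>M borel_omega"
proof (rule measurable_borel_omegaI)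
  fix n
  have "(\<lambda>x. Rep_unit_interval (fst x (n div 2))) \<in> borel_measurable (borel_omega \<Otimes>\<^sub>M borel_omega)"
    "(\<lambda>x. Rep_unit_interval (snd x (n div 2))) \<in> borel_measurable (borel_omega \<Otimes>\<^sub>M borel_omega)"
    by (rule measurable_compose[OF measurable_fst Rep_unit_interval_measurable]
        measurable_compose[OF measurable_snd Rep_unit_interval_measurable])+
  then show "(\<lambda>x. Rep_unit_interval (omega_pair x n)) \<in> borel_measurable (borel_omega \<Otimes>\<^sub>M borel_omega)"
    by (cases "even n") (simp_all add: omega_pair_def)
qed

lemma measurable_universal_omegaI:
  "f \<in> universal_omega \<rightarrow>\<^sub>M borel_omega \<Longrightarrow> f \<in> universal_omega \<rightarrow>\<^sub>M universal_omega"
  unfolding universal_omega_eq by (rule measurable_universalI)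

lemma measurable_universal_omega_borel:
  "f \<in> borel_omega \<rightarrow>\<^sub>M N \<Longrightarrow> f \<in> universal_omega \<rightarrow>\<^sub>M N"
  unfolding universal_omega_eq by (rule measurable_universalI1)

text \<open>The splitting map is itself an admissible random variable of the square, and pulling an
  induced set back along its inverse \<open>omega_pair\<close> shows it to be universally
  measurable. Conversely every admissible random variable of the square is a universally measurable
  map.\<close>

lemma sets_induced_omega2:
  "sets (induced (prod_space omega_space omega_space)) = sets (universal (borel_omega \<Otimes>\<^sub>M borel_omega))"
proof -
  let ?O = "prod_space omega_space omega_space"
  have "E \<in> induced_sets ?O \<longleftrightarrow> E \<in> sets (universal (borel_omega \<Otimes>\<^sub>M borel_omega))" for E
  proof
    assume E: "E \<in> induced_sets ?O"
    have "(\<lambda>\<omega>. (omega_fst \<omega>, omega_snd \<omega>)) \<in> rvars ?O"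
      using measurable_universal_omegaI[OF measurable_universal_omega_borel[OF measurable_omega_fst]]
        measurable_universal_omegaI[OF measurable_universal_omega_borel[OF measurable_omega_snd]]
      by (simp add: rvars_prod_space rvars_omega_space)
    then have "(\<lambda>\<omega>. (omega_fst \<omega>, omega_snd \<omega>)) -` E \<in> sets (universal borel_omega)"
      using E unfolding induced_sets_def universal_omega_eq by blast
    moreover have "omega_pair \<in> universal (borel_omega \<Otimes>\<^sub>M borel_omega) \<rightarrow>\<^sub>M universal borel_omega"
      by (intro measurable_universalI measurable_universalI1) measurable
    ultimately have "omega_pair -` ((\<lambda>\<omega>. (omega_fst \<omega>, omega_snd \<omega>)) -` E) \<inter> space (universal (borel_omega \<Otimes>\<^sub>M borel_omega))
        \<in> sets (universal (borel_omega \<Otimes>\<^sub>M borel_omega))"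
      by (rule measurable_sets[rotated])
    then show "E \<in> sets (universal (borel_omega \<Otimes>\<^sub>M borel_omega))"
      by (simp add: space_pair_measure vimage_def)
  next
    assume E: "E \<in> sets (universal (borel_omega \<Otimes>\<^sub>M borel_omega))"
    show "E \<in> induced_sets ?O"
    proof (rule in_induced_setsI)
      fix \<xi> assume "\<xi> \<in> rvars ?O"
      then have "(\<lambda>\<omega>. fst (\<xi> \<omega>)) \<in> universal_omega \<rightarrow>\<^sub>M universal_omega" "(\<lambda>\<omega>. snd (\<xi> \<omega>)) \<in> universal_omega \<rightarrow>\<^sub>M universal_omega"
        by (auto simp: rvars_prod_space rvars_omega_space)
      then have "(\<lambda>\<omega>. (fst (\<xi> \<omega>), snd (\<xi> \<omega>))) \<in> universal borel_omega \<rightarrow>\<^sub>M borel_omega \<Otimes>\<^sub>M borel_omega"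
        unfolding universal_omega_eq
        using measurable_compose[OF _ measurable_universal_id] by (intro measurable_Pair) blast+
      then have "\<xi> \<in> universal borel_omega \<rightarrow>\<^sub>M universal (borel_omega \<Otimes>\<^sub>M borel_omega)"
        by (intro measurable_universalI) simp
      from measurable_sets[OF this E] show "\<xi> -` E \<in> sets universal_omega"
        by (simp add: universal_omega_eq)
    qed simp
  qed
  then show ?thesis
    by (auto simp: sets_induced quasi_universal_prod_space quasi_universal_omega_space)
qed

section \<open>Markov kernels\<close>

lemma rvars_rvarsI:
  assumes X: "quasi_universal_space X"
    and \<Xi>: "\<And>\<alpha> \<beta>. \<alpha> \<in> universal_omega \<rightarrow>\<^sub>M universal_omega \<Longrightarrow> \<beta> \<in> universal_omega \<rightarrow>\<^sub>M universal_omega \<Longrightarrow>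
      (\<lambda>\<omega>. \<Xi> (\<alpha> \<omega>) (\<beta> \<omega>)) \<in> rvars X"
  shows "\<Xi> \<in> rvars_rvars X"
proof -
  \<comment> \<open>A constant substitution in the first argument shows that the sections are
    admissible.\<close>
  have r: "\<Xi> \<omega> \<in> rvars X" for \<omega>
    by (rule \<Xi>[of "\<lambda>_. \<omega>" "\<lambda>\<omega>. \<omega>"]) auto
  have "(\<lambda>p. \<Xi> (fst p) (snd p)) \<in> quasi_measurable (prod_space omega_space omega_space) X"
  proof (rule quasi_measurableI)
    show "\<Xi> (fst p) (snd p) \<in> points X" for p
      by (rule rvars_points[OF X r])
    fix \<xi> assume "\<xi> \<in> rvars (prod_space omega_space omega_space)"
    then show "(\<lambda>\<omega>. \<Xi> (fst (\<xi> \<omega>)) (snd (\<xi> \<omega>))) \<in> rvars X"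
      unfolding rvars_prod_space rvars_omega_space by (elim conjE) (rule \<Xi>)
  qed
  then show ?thesis
    using r by (simp add: rvars_rvars_def split_beta')
qed

lemma rvars_rvarsD:
  assumes "\<Xi> \<in> rvars_rvars X" "\<alpha> \<in> universal_omega \<rightarrow>\<^sub>M universal_omega" "\<beta> \<in> universal_omega \<rightarrow>\<^sub>M universal_omega"
  shows "(\<lambda>\<omega>. \<Xi> (\<alpha> \<omega>) (\<beta> \<omega>)) \<in> rvars X"
proof -
  have "(\<lambda>\<omega>. (\<alpha> \<omega>, \<beta> \<omega>)) \<in> rvars (prod_space omega_space omega_space)"
    using assms by (simp add: rvars_prod_space rvars_omega_space)
  from quasi_measurable_rvars[OF _ this, where f="\<lambda>(\<omega>, \<omega>'). \<Xi> \<omega> \<omega>'" and Y=X] assms(1)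
  show ?thesis by (simp add: rvars_rvars_def)
qed

lemma rvars_rvars_section: "\<Xi> \<in> rvars_rvars X \<Longrightarrow> \<Xi> \<omega> \<in> rvars X"
  by (simp add: rvars_rvars_def)

lemma points_P_spaceE:
  assumes "Q \<in> points (P_space X)"
  obtains \<xi> P where "\<xi> \<in> rvars X" "P \<in> space (prob_algebra universal_omega)" "Q = distr P (induced X) \<xi>"
  using assms by (auto simp: P_space_def)

lemma points_P_space_prob:
  assumes X: "quasi_universal_space X" and Q: "Q \<in> points (P_space X)"
  shows "Q \<in> space (prob_algebra (induced X))"
proof -
  obtain \<xi> P where "\<xi> \<in> rvars X" "P \<in> space (prob_algebra universal_omega)" "Q = distr P (induced X) \<xi>"
    using Q by (rule points_P_spaceE)
  then show ?thesis
    using distr_in_prob_algebra measurable_rvars[OF X] by blast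
qed

lemma rvars_P_spaceE:
  assumes "\<kappa> \<in> rvars (P_space X)"
  obtains \<Xi> P where "\<Xi> \<in> rvars_rvars X" "P \<in> space (prob_algebra universal_omega)"
    "\<And>\<omega>. \<kappa> \<omega> = distr P (induced X) (\<Xi> \<omega>)"
  using assms by (auto simp: P_space_def)

lemma rvars_P_spaceI:
  assumes "\<Xi> \<in> rvars_rvars X" "P \<in> space (prob_algebra universal_omega)"
    "\<And>\<omega>. \<kappa> \<omega> = distr P (induced X) (\<Xi> \<omega>)"
  shows "\<kappa> \<in> rvars (P_space X)"
proof -
  have "\<kappa> = (\<lambda>\<omega>. distr P (induced X) (\<Xi> \<omega>))" using assms(3) by auto
  then show ?thesis using assms(1,2) by (auto simp: P_space_def)
qed

lemma P_space_rvars_points: "\<kappa> \<in> rvars (P_space X) \<Longrightarrow> \<kappa> \<omega> \<in> points (P_space X)"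
  by (auto simp: P_space_def dest: rvars_rvars_section)

lemma markov_kernelsI:
  assumes Z: "quasi_universal_space Z" and K: "\<And>\<zeta>. \<zeta> \<in> rvars Z \<Longrightarrow> (\<lambda>\<omega>. K (\<zeta> \<omega>)) \<in> rvars (P_space X)"
  shows "K \<in> markov_kernels Z X"
  unfolding markov_kernels_def
proof (rule quasi_measurableI)
  show "K z \<in> points (P_space X)" if "z \<in> points Z" for z
    using P_space_rvars_points[OF K[OF rvars_const[OF Z that]]] .
qed (rule K)

lemma markov_kernels_points: "K \<in> markov_kernels Z X \<Longrightarrow> z \<in> points Z \<Longrightarrow> K z \<in> points (P_space X)"
  unfolding markov_kernels_def by (rule quasi_measurable_points)

lemma markov_kernels_rvars: "K \<in> markov_kernels Z X \<Longrightarrow> \<zeta> \<in> rvars Z \<Longrightarrow> (\<lambda>\<omega>. K (\<zeta> \<omega>)) \<in> rvars (P_space X)"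
  unfolding markov_kernels_def by (rule quasi_measurable_rvars)

lemma markov_kernels_compose:
  "f \<in> quasi_measurable W Z \<Longrightarrow> K \<in> markov_kernels Z X \<Longrightarrow> (\<lambda>w. K (f w)) \<in> markov_kernels W X"
  unfolding markov_kernels_def by (rule quasi_measurable_compose)

lemma markov_kernels_cong:
  "quasi_universal_space Z \<Longrightarrow> K \<in> markov_kernels Z X \<Longrightarrow> (\<And>z. z \<in> points Z \<Longrightarrow> K z = L z) \<Longrightarrow> L \<in> markov_kernels Z X"
  unfolding markov_kernels_def by (rule quasi_measurable_cong)

lemma markov_kernels_constant:
  assumes "quasi_universal_space X" "Q \<in> points (P_space X)"
  shows "(\<lambda>_. Q) \<in> markov_kernels Z X"
  unfolding markov_kernels_def
proof (rule quasi_measurableI)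
  obtain \<xi> P where \<xi>: "\<xi> \<in> rvars X" "P \<in> space (prob_algebra universal_omega)" "Q = distr P (induced X) \<xi>"
    using assms(2) by (rule points_P_spaceE)
  have "(\<lambda>_. \<xi>) \<in> rvars_rvars X"
    by (rule rvars_rvarsI[OF assms(1)]) (rule rvars_comp[OF assms(1) \<xi>(1)])
  then show "(\<lambda>\<omega>. Q) \<in> rvars (P_space X)"
    using \<xi> by (intro rvars_P_spaceI)
qed (rule assms)

text \<open>The noise law is kept and only the representing map is composed with \<open>g\<close>.
  Letting \<open>g\<close> read the conditioning value too covers maps that append a draw to a given
  configuration.\<close>

lemma markov_kernels_push:
  assumes Z: "quasi_universal_space Z" and X: "quasi_universal_space X" and Y: "quasi_universal_space Y"
    and K: "K \<in> markov_kernels Z X" and g: "g \<in> quasi_measurable (prod_space X Z) Y"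
  shows "(\<lambda>z. distr (K z) (induced Y) (\<lambda>x. g (x, z))) \<in> markov_kernels Z Y"
proof (rule markov_kernelsI[OF Z])
  fix \<zeta> assume \<zeta>: "\<zeta> \<in> rvars Z"
  obtain \<Xi> P where \<Xi>: "\<Xi> \<in> rvars_rvars X" "P \<in> space (prob_algebra universal_omega)"
    "\<And>\<omega>. K (\<zeta> \<omega>) = distr P (induced X) (\<Xi> \<omega>)"
    using rvars_P_spaceE[OF markov_kernels_rvars[OF K \<zeta>]] by blast
  show "(\<lambda>\<omega>. distr (K (\<zeta> \<omega>)) (induced Y) (\<lambda>x. g (x, \<zeta> \<omega>))) \<in> rvars (P_space Y)"
  proof (rule rvars_P_spaceI[of "\<lambda>\<omega> \<omega>'. g (\<Xi> \<omega> \<omega>', \<zeta> \<omega>)"])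
    show "(\<lambda>\<omega> \<omega>'. g (\<Xi> \<omega> \<omega>', \<zeta> \<omega>)) \<in> rvars_rvars Y"
    proof (rule rvars_rvarsI[OF Y])
      fix \<alpha> \<beta> :: "omega \<Rightarrow> omega"
      assume "\<alpha> \<in> universal_omega \<rightarrow>\<^sub>M universal_omega" "\<beta> \<in> universal_omega \<rightarrow>\<^sub>M universal_omega"
      then have "(\<lambda>\<omega>. (\<Xi> (\<alpha> \<omega>) (\<beta> \<omega>), \<zeta> (\<alpha> \<omega>))) \<in> rvars (prod_space X Z)"
        using rvars_rvarsD[OF \<Xi>(1), of \<alpha> \<beta>] rvars_comp[OF Z \<zeta>, of \<alpha>] by (simp add: rvars_prod_space)
      then show "(\<lambda>\<omega>. g (\<Xi> (\<alpha> \<omega>) (\<beta> \<omega>), \<zeta> (\<alpha> \<omega>))) \<in> rvars Y"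
        by (rule quasi_measurable_rvars[OF g])
    qed
    fix \<omega>
    have "(\<lambda>x. (x, \<zeta> \<omega>)) \<in> quasi_measurable X (prod_space X Z)"
      by (intro quasi_measurable_Pair quasi_measurable_ident quasi_measurable_const Z rvars_points[OF Z \<zeta>])
    from quasi_measurable_compose[OF this g]
    have "(\<lambda>x. g (x, \<zeta> \<omega>)) \<in> induced X \<rightarrow>\<^sub>M induced Y"
      by (rule measurable_quasi_measurable[OF X Y])
    moreover have "\<Xi> \<omega> \<in> P \<rightarrow>\<^sub>M induced X"
      using measurable_rvars[OF X rvars_rvars_section[OF \<Xi>(1)]] space_prob_algebraD(2)[OF \<Xi>(2)]
      by (simp cong: measurable_cong_sets)
    ultimately show "distr (K (\<zeta> \<omega>)) (induced Y) (\<lambda>x. g (x, \<zeta> \<omega>)) = distr P (induced Y) (\<lambda>\<omega>'. g (\<Xi> \<omega> \<omega>', \<zeta> \<omega>))"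
      by (simp add: \<Xi>(3) distr_distr comp_def)
  qed (rule \<Xi>)
qed

lemma rvars_rvars_vimage:
  assumes X: "quasi_universal_space X" and \<Xi>: "\<Xi> \<in> rvars_rvars X" and A: "A \<in> sets (induced X)"
  shows "{(\<omega>, \<omega>'). \<Xi> \<omega> \<omega>' \<in> A} \<in> sets (universal (borel_omega \<Otimes>\<^sub>M borel_omega))"
proof -
  have "(\<lambda>p. \<Xi> (fst p) (snd p)) \<in> quasi_measurable (prod_space omega_space omega_space) X"
    using \<Xi> by (simp add: rvars_rvars_def split_beta')
  then have "(\<lambda>p. \<Xi> (fst p) (snd p)) \<in> induced (prod_space omega_space omega_space) \<rightarrow>\<^sub>M induced X"
    by (intro measurable_quasi_measurable quasi_universal_prod_space quasi_universal_omega_space X)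
  from measurable_sets[OF this A] show ?thesis
    by (simp add: sets_induced_omega2 vimage_def split_beta')
qed

text \<open>Along an admissible random variable, the kernel evaluated at a set is the noise measure
  of the sections of a universally measurable subset of the square. For nonempty standard targets
  the converse is \<open>standard_markov_kernelsI\<close>.\<close>

lemma markov_kernels_measurable:
  assumes Z: "quasi_universal_space Z" and X: "quasi_universal_space X" and K: "K \<in> markov_kernels Z X"
  shows "K \<in> induced Z \<rightarrow>\<^sub>M prob_algebra (induced X)"
proof (rule measurable_inducedI[OF Z])
  show "K z \<in> space (prob_algebra (induced X))" if "z \<in> points Z" for z
    by (rule points_P_space_prob[OF X markov_kernels_points[OF K that]])
  fix \<zeta> assume \<zeta>: "\<zeta> \<in> rvars Z"
  obtain \<Xi> P where \<Xi>: "\<Xi> \<in> rvars_rvars X" "P \<in> space (prob_algebra universal_omega)"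
    "\<And>\<omega>. K (\<zeta> \<omega>) = distr P (induced X) (\<Xi> \<omega>)"
    using rvars_P_spaceE[OF markov_kernels_rvars[OF K \<zeta>]] by blast
  have p: "K (\<zeta> \<omega>) \<in> space (prob_algebra (induced X))" for \<omega>
    by (rule points_P_space_prob[OF X markov_kernels_points[OF K rvars_points[OF Z \<zeta>]]])
  show "(\<lambda>\<omega>. K (\<zeta> \<omega>)) \<in> universal_omega \<rightarrow>\<^sub>M prob_algebra (induced X)"
  proof (rule measurable_prob_algebraI)
    show "prob_space (K (\<zeta> \<omega>))" for \<omega>
      using space_prob_algebraD(1)[OF p] .
    show "(\<lambda>\<omega>. K (\<zeta> \<omega>)) \<in> universal_omega \<rightarrow>\<^sub>M subprob_algebra (induced X)"
    proof (rule measurable_subprob_algebra)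
      show "subprob_space (K (\<zeta> \<omega>))" "sets (K (\<zeta> \<omega>)) = sets (induced X)" for \<omega>
        using space_prob_algebraD[OF p] by (auto intro: prob_space_imp_subprob_space)
      fix A assume A: "A \<in> sets (induced X)"
      let ?E = "{(\<omega>, \<omega>'). \<Xi> \<omega> \<omega>' \<in> A}"
      have "emeasure (K (\<zeta> \<omega>)) A = emeasure P (Pair \<omega> -` ?E)" for \<omega>
      proof -
        have "\<Xi> \<omega> \<in> P \<rightarrow>\<^sub>M induced X"
          using measurable_rvars[OF X rvars_rvars_section[OF \<Xi>(1)]] space_prob_algebraD(2)[OF \<Xi>(2)]
          by (simp cong: measurable_cong_sets)
        then show ?thesis
          using A space_prob_algebraD(3)[OF \<Xi>(2)] by (simp add: \<Xi>(3) emeasure_distr vimage_def)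
      qed
      then show "(\<lambda>\<omega>. emeasure (K (\<zeta> \<omega>)) A) \<in> borel_measurable universal_omega"
        using universal_sections_measurable[OF rvars_rvars_vimage[OF X \<Xi>(1) A]] \<Xi>(2)
        by (simp add: universal_omega_eq)
    qed
  qed
qed

lemma markov_kernels_push_measurable:
  assumes "quasi_universal_space Z" "quasi_universal_space X" "quasi_universal_space Y"
    and "K \<in> markov_kernels Z X" "g \<in> quasi_measurable (prod_space X Z) Y"
  shows "(\<lambda>z. distr (K z) (induced Y) (\<lambda>x. g (x, z))) \<in> induced Z \<rightarrow>\<^sub>M prob_algebra (induced Y)"
  using assms by (intro markov_kernels_measurable markov_kernels_push)

lemma markov_kernels_return:
  assumes Z: "quasi_universal_space Z" and X: "quasi_universal_space X" and f: "f \<in> quasi_measurable Z X"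
  shows "(\<lambda>z. return (induced X) (f z)) \<in> markov_kernels Z X"
proof (rule markov_kernelsI[OF Z])
  fix \<zeta> assume \<zeta>: "\<zeta> \<in> rvars Z"
  \<comment> \<open>Any noise law would do, since the representing map ignores its noise
    argument.\<close>
  define P where "P = return universal_omega undefined"
  have P: "P \<in> space (prob_algebra universal_omega)"
    by (simp add: P_def space_prob_algebra prob_space_return)
  show "(\<lambda>\<omega>. return (induced X) (f (\<zeta> \<omega>))) \<in> rvars (P_space X)"
  proof (rule rvars_P_spaceI[OF _ P])
    show "(\<lambda>\<omega> _. f (\<zeta> \<omega>)) \<in> rvars_rvars X"
      by (rule rvars_rvarsI[OF X], rule quasi_measurable_rvars[OF f], rule rvars_comp[OF Z \<zeta>])
    show "return (induced X) (f (\<zeta> \<omega>)) = distr P (induced X) (\<lambda>_. f (\<zeta> \<omega>))" for \<omega>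
      using quasi_measurable_points[OF f rvars_points[OF Z \<zeta>]]
      by (simp add: P_def distr_return)
  qed
qed

text \<open>The \<open>\<sigma>\<close>-algebra of a product space is larger than the product \<open>\<sigma>\<close>-algebra, so the library's
  Fubini theorem does not apply.\<close>

lemma markov_commute:
  assumes X: "quasi_universal_space X" and Y: "quasi_universal_space Y" and W: "quasi_universal_space W"
    and Q: "Q \<in> points (P_space X)" and N: "N \<in> points (P_space Y)"
    and f: "f \<in> quasi_measurable (prod_space X Y) W"
  shows "(Q \<bind> (\<lambda>x. distr N (induced W) (\<lambda>y. f (x, y)))) = (N \<bind> (\<lambda>y. distr Q (induced W) (\<lambda>x. f (x, y))))"
proof -
  have f': "(\<lambda>p. f (snd p, fst p)) \<in> quasi_measurable (prod_space Y X) W"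
    by (intro quasi_measurable_compose[OF _ f] quasi_measurable_Pair quasi_measurable_fst quasi_measurable_snd)
  have mN: "(\<lambda>x. distr N (induced W) (\<lambda>y. f (x, y))) \<in> induced X \<rightarrow>\<^sub>M prob_algebra (induced W)"
    using markov_kernels_push_measurable[OF X Y W markov_kernels_constant[OF Y N] f'] by simp
  have mQ: "(\<lambda>y. distr Q (induced W) (\<lambda>x. f (x, y))) \<in> induced Y \<rightarrow>\<^sub>M prob_algebra (induced W)"
    using markov_kernels_push_measurable[OF Y X W markov_kernels_constant[OF X Q] f] by simp
  note pQ = points_P_space_prob[OF X Q] and pN = points_P_space_prob[OF Y N]
  show ?thesis
  proof (rule measure_eqI)
    show "sets (Q \<bind> (\<lambda>x. distr N (induced W) (\<lambda>y. f (x, y)))) = sets (N \<bind> (\<lambda>y. distr Q (induced W) (\<lambda>x. f (x, y))))"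
      by (simp add: sets_bind'[OF pQ mN] sets_bind'[OF pN mQ])
    fix A assume "A \<in> sets (Q \<bind> (\<lambda>x. distr N (induced W) (\<lambda>y. f (x, y))))"
    then have A: "A \<in> sets (induced W)"
      by (simp add: sets_bind'[OF pQ mN])
    obtain \<xi> P where \<xi>: "\<xi> \<in> rvars X" "P \<in> space (prob_algebra universal_omega)" "Q = distr P (induced X) \<xi>"
      using Q by (rule points_P_spaceE)
    obtain \<eta> P' where \<eta>: "\<eta> \<in> rvars Y" "P' \<in> space (prob_algebra universal_omega)" "N = distr P' (induced Y) \<eta>"
      using N by (rule points_P_spaceE)
    have m\<xi>: "\<xi> \<in> P \<rightarrow>\<^sub>M induced X" and m\<eta>: "\<eta> \<in> P' \<rightarrow>\<^sub>M induced Y"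
      using measurable_rvars[OF X \<xi>(1)] measurable_rvars[OF Y \<eta>(1)] space_prob_algebraD(2)[OF \<xi>(2)] space_prob_algebraD(2)[OF \<eta>(2)]
      by (simp_all cong: measurable_cong_sets)
    \<comment> \<open>Both measures are replaced by representing random variables on the sample
      space, so the claim turns into \<open>universal_Fubini\<close> for \<open>?E\<close>.\<close>
    have "(\<lambda>\<omega> \<omega>'. f (\<xi> \<omega>, \<eta> \<omega>')) \<in> rvars_rvars W"
    proof (rule rvars_rvarsI[OF W])
      fix \<alpha> \<beta> :: "omega \<Rightarrow> omega"
      assume "\<alpha> \<in> universal_omega \<rightarrow>\<^sub>M universal_omega" "\<beta> \<in> universal_omega \<rightarrow>\<^sub>M universal_omega"
      then have "(\<lambda>\<omega>. (\<xi> (\<alpha> \<omega>), \<eta> (\<beta> \<omega>))) \<in> rvars (prod_space X Y)"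
        using rvars_comp[OF X \<xi>(1), of \<alpha>] rvars_comp[OF Y \<eta>(1), of \<beta>] by (simp add: rvars_prod_space)
      then show "(\<lambda>\<omega>. f (\<xi> (\<alpha> \<omega>), \<eta> (\<beta> \<omega>))) \<in> rvars W"
        by (rule quasi_measurable_rvars[OF f])
    qed
    from rvars_rvars_vimage[OF W this A]
    have E: "{(\<omega>, \<omega>'). f (\<xi> \<omega>, \<eta> \<omega>') \<in> A} \<in> sets (universal (borel_omega \<Otimes>\<^sub>M borel_omega))"
      (is "?E \<in> _") .
    have 1: "emeasure (distr N (induced W) (\<lambda>y. f (\<xi> \<omega>, y))) A = emeasure P' (Pair \<omega> -` ?E)" for \<omega>
    proof -
      have "(\<lambda>y. f (\<xi> \<omega>, y)) \<in> induced Y \<rightarrow>\<^sub>M induced W"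
        by (intro measurable_quasi_measurable Y W quasi_measurable_compose[OF _ f] quasi_measurable_Pair
            quasi_measurable_ident quasi_measurable_const X rvars_points[OF X \<xi>(1)])
      then show ?thesis
        using A m\<eta> space_prob_algebraD(3)[OF \<eta>(2)]
        by (simp add: \<eta>(3) distr_distr comp_def emeasure_distr measurable_compose[OF m\<eta>] vimage_def)
    qed
    have 2: "emeasure (distr Q (induced W) (\<lambda>x. f (x, \<eta> \<omega>'))) A = emeasure P ((\<lambda>\<omega>. (\<omega>, \<omega>')) -` ?E)" for \<omega>'
    proof -
      have "(\<lambda>x. f (x, \<eta> \<omega>')) \<in> induced X \<rightarrow>\<^sub>M induced W"
        by (intro measurable_quasi_measurable X W quasi_measurable_compose[OF _ f] quasi_measurable_Pair
            quasi_measurable_ident quasi_measurable_const Y rvars_points[OF Y \<eta>(1)])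
      then show ?thesis
        using A m\<xi> space_prob_algebraD(3)[OF \<xi>(2)]
        by (simp add: \<xi>(3) distr_distr comp_def emeasure_distr measurable_compose[OF m\<xi>] vimage_def)
    qed
    have b: "(\<lambda>x. emeasure (R x) A) \<in> borel_measurable L" if "R \<in> L \<rightarrow>\<^sub>M prob_algebra (induced W)" for R :: "'d \<Rightarrow> 'c measure" and L
      using measurable_compose[OF measurable_prob_algebraD[OF that] measurable_emeasure_subprob_algebra[OF A]] .
    have "emeasure (Q \<bind> (\<lambda>x. distr N (induced W) (\<lambda>y. f (x, y)))) A = (\<integral>\<^sup>+\<omega>. emeasure P' (Pair \<omega> -` ?E) \<partial>P)"
      by (subst emeasure_bind_prob_algebra[OF pQ mN A], subst \<xi>(3), subst nn_integral_distr[OF m\<xi>])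
         (simp_all add: b[OF mN] 1)
    also have "\<dots> = (\<integral>\<^sup>+\<omega>'. emeasure P ((\<lambda>\<omega>. (\<omega>, \<omega>')) -` ?E) \<partial>P')"
      using universal_Fubini[OF E] \<xi>(2) \<eta>(2) by (simp add: universal_omega_eq)
    also have "\<dots> = emeasure (N \<bind> (\<lambda>y. distr Q (induced W) (\<lambda>x. f (x, y)))) A"
      by (subst emeasure_bind_prob_algebra[OF pN mQ A], subst \<eta>(3), subst nn_integral_distr[OF m\<eta>])
         (simp_all add: b[OF mQ] 2)
    finally show "emeasure (Q \<bind> (\<lambda>x. distr N (induced W) (\<lambda>y. f (x, y)))) A =
        emeasure (N \<bind> (\<lambda>y. distr Q (induced W) (\<lambda>x. f (x, y)))) A" .
  qed
qed

text \<open>\<open>kernel_prod\<close> is built from a bare set function. Recognizing it as a bind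
  supplies countable additivity and opens it to the rules for composition and push-forward.\<close>

lemma kernel_prod_eq_bind:
  assumes X: "quasi_universal_space X" and Y: "quasi_universal_space Y"
    and K: "(\<lambda>y. K (y, z)) \<in> markov_kernels Y X" and Q: "Q z \<in> space (prob_algebra (induced Y))"
  shows "kernel_prod X Y K Q z = (Q z \<bind> (\<lambda>y. distr (K (y, z)) (induced (prod_space X Y)) (\<lambda>x. (x, y))))"
    (is "_ = ?B")
proof -
  let ?XY = "prod_space X Y"
  have XY: "quasi_universal_space ?XY" by (rule quasi_universal_prod_space[OF X Y])
  have m: "(\<lambda>y. distr (K (y, z)) (induced ?XY) (\<lambda>x. (x, y))) \<in> induced Y \<rightarrow>\<^sub>M prob_algebra (induced ?XY)"
    using markov_kernels_push_measurable[OF Y X XY K quasi_measurable_ident] .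
  have sets: "sets ?B = induced_sets ?XY"
    using sets_bind'[OF Q m] sets_induced[OF XY] by simp
  have space: "space ?B = points ?XY"
    using sets_eq_imp_space_eq[OF sets_bind'[OF Q m]] by simp
  have "?B = measure_of (space ?B) (sets ?B) (emeasure ?B)"
    by (rule measure_of_of_measure[symmetric])
  also have "\<dots> = measure_of (points ?XY) (induced_sets ?XY) (\<lambda>D. \<integral>\<^sup>+ y. emeasure (K (y, z)) {x. (x, y) \<in> D} \<partial>Q z)"
    unfolding space sets
  proof (rule measure_of_eq)
    show "induced_sets ?XY \<subseteq> Pow (points ?XY)" by (auto simp: induced_sets_def)
    fix D assume "D \<in> sigma_sets (points ?XY) (induced_sets ?XY)"
    then have D: "D \<in> sets (induced ?XY)"
      using sets.sigma_sets_eq[of ?B] sets space sets_induced[OF XY] by simp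
    have "emeasure (distr (K (y, z)) (induced ?XY) (\<lambda>x. (x, y))) D = emeasure (K (y, z)) {x. (x, y) \<in> D}"
      if y: "y \<in> points Y" for y
    proof -
      note p = space_prob_algebraD[OF points_P_space_prob[OF X markov_kernels_points[OF K y]]]
      have "(\<lambda>x. (x, y)) \<in> induced X \<rightarrow>\<^sub>M induced ?XY"
        by (intro measurable_quasi_measurable X XY quasi_measurable_Pair quasi_measurable_ident quasi_measurable_const Y y)
      then have "(\<lambda>x. (x, y)) \<in> K (y, z) \<rightarrow>\<^sub>M induced ?XY"
        using p by (simp cong: measurable_cong_sets)
      then show ?thesis
        using D p sets.sets_into_space[OF D]
        by (subst emeasure_distr) (auto intro!: arg_cong[where f="emeasure (K (y, z))"])
    qed
    then show "emeasure ?B D = (\<integral>\<^sup>+ y. emeasure (K (y, z)) {x. (x, y) \<in> D} \<partial>Q z)"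
      unfolding emeasure_bind_prob_algebra[OF Q m D] using space_prob_algebraD(3)[OF Q]
      by (intro nn_integral_cong) simp
  qed
  finally show ?thesis by (simp add: kernel_prod_def)
qed

lemma distr_bind_prob:
  assumes "M \<in> space (prob_algebra L)" "f \<in> L \<rightarrow>\<^sub>M prob_algebra N" "g \<in> N \<rightarrow>\<^sub>M R"
  shows "distr (M \<bind> f) R g = (M \<bind> (\<lambda>x. distr (f x) R g))"
  using assms space_prob_algebraD[OF assms(1)] prob_space.not_empty[of M]
  by (intro distr_bind[where K=N]) (auto dest: measurable_prob_algebraD cong: measurable_cong_sets)

lemma bind_distr_prob:
  assumes "M \<in> space (prob_algebra L)" "h \<in> L \<rightarrow>\<^sub>M N" "f \<in> N \<rightarrow>\<^sub>M prob_algebra R"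
  shows "(distr M N h \<bind> f) = (M \<bind> (\<lambda>x. f (h x)))"
  using assms space_prob_algebraD[OF assms(1)] prob_space.not_empty[of M]
  by (intro bind_distr[where K=R]) (auto dest: measurable_prob_algebraD cong: measurable_cong_sets)

lemma bind_assoc_prob:
  assumes "M \<in> space (prob_algebra L)" "f \<in> L \<rightarrow>\<^sub>M prob_algebra N" "g \<in> N \<rightarrow>\<^sub>M prob_algebra R"
  shows "((M \<bind> f) \<bind> g) = (M \<bind> (\<lambda>x. f x \<bind> g))"
  using assms space_prob_algebraD[OF assms(1)]
  by (intro bind_assoc[where N=N and R=R]) (auto dest: measurable_prob_algebraD cong: measurable_cong_sets)

lemma bind_prob_algebra:
  assumes "M \<in> space (prob_algebra L)" "f \<in> L \<rightarrow>\<^sub>M prob_algebra N"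
  shows "M \<bind> f \<in> space (prob_algebra N)"
  using prob_space_bind'[OF assms] sets_bind'[OF assms] by (simp add: space_prob_algebra)

lemma distr_distr_prob:
  assumes "M \<in> space (prob_algebra L)" "f \<in> L \<rightarrow>\<^sub>M N" "g \<in> N \<rightarrow>\<^sub>M R"
  shows "distr (distr M N f) R g = distr M R (\<lambda>x. g (f x))"
  using assms space_prob_algebraD[OF assms(1)]
  by (subst distr_distr) (auto simp: comp_def cong: measurable_cong_sets)

lemma distr_cong_prob:
  assumes "M \<in> space (prob_algebra L)" "\<And>x. x \<in> space L \<Longrightarrow> f x = g x"
  shows "distr M N f = distr M N g"
  using assms space_prob_algebraD[OF assms(1)] by (intro distr_cong) auto

lemma bind_cong_prob:
  assumes "M \<in> space (prob_algebra L)" "\<And>x. x \<in> space L \<Longrightarrow> f x = g x"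
  shows "M \<bind> f = M \<bind> g"
  using assms space_prob_algebraD[OF assms(1)] by (intro bind_cong) auto

section \<open>Standard spaces\<close>

subsection \<open>The sample space as a retract of the real line\<close>

definition unit_clamp :: "real \<Rightarrow> unit_interval" where
  "unit_clamp x = Abs_unit_interval (max 0 (min 1 x))"

lemma Rep_unit_clamp: "Rep_unit_interval (unit_clamp x) = max 0 (min 1 x)"
  unfolding unit_clamp_def by (rule Abs_unit_interval_inverse) auto

lemma Rep_unit_interval_bounds: "0 \<le> Rep_unit_interval u" "Rep_unit_interval u \<le> 1"
  using Rep_unit_interval[of u] by auto

lemma unit_clamp_Rep: "unit_clamp (Rep_unit_interval u) = u"
  using Rep_unit_interval_bounds[of u] by (simp add: unit_clamp_def Rep_unit_interval_inverse)

definition binary_digit :: "nat \<Rightarrow> real \<Rightarrow> int" where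
  "binary_digit k x = \<lfloor>2 ^ k * x\<rfloor> mod 2"

text \<open>The partial sums telescope to the dyadic floor approximations of \<open>x\<close>.
  Starting the digits at \<open>k = 0\<close> admits \<open>x = 1\<close>, whose zeroth digit is
  1.\<close>

lemma binary_digit_sums:
  assumes "0 \<le> x" "x \<le> 1"
  shows "(\<lambda>k. real_of_int (binary_digit k x) / 2 ^ k) sums x"
proof -
  have part: "(\<Sum>k\<le>n. real_of_int (binary_digit k x) / 2 ^ k) = \<lfloor>2 ^ n * x\<rfloor> / 2 ^ n" for n
  proof (induction n)
    case 0
    have "0 \<le> \<lfloor>x\<rfloor>" "\<lfloor>x\<rfloor> \<le> 1" using assms by (simp_all add: floor_le_iff)
    then show ?case by (simp add: binary_digit_def)
  next
    case (Suc n)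
    have "\<lfloor>2 ^ n * x\<rfloor> = \<lfloor>2 ^ Suc n * x\<rfloor> div 2"
      using floor_divide_real_eq_div[of 2 "2 ^ Suc n * x"] by simp
    then have "\<lfloor>2 ^ Suc n * x\<rfloor> = 2 * \<lfloor>2 ^ n * x\<rfloor> + binary_digit (Suc n) x"
      unfolding binary_digit_def by simp
    then have "real_of_int \<lfloor>2 ^ Suc n * x\<rfloor> = 2 * \<lfloor>2 ^ n * x\<rfloor> + binary_digit (Suc n) x"
      by (metis of_int_add of_int_mult of_int_numeral)
    then show ?case
      using Suc by (simp add: field_simps)
  qed
  have "(\<lambda>n. \<lfloor>2 ^ n * x\<rfloor> / 2 ^ n) \<longlonglongrightarrow> x"
  proof (rule real_tendsto_sandwich[of "\<lambda>n. x - (1 / 2) ^ n" _ _ "\<lambda>_. x"])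
    have "2 ^ n * x - 1 \<le> \<lfloor>2 ^ n * x\<rfloor>" for n by linarith
    then have "(2 ^ n * x - 1) / 2 ^ n \<le> \<lfloor>2 ^ n * x\<rfloor> / 2 ^ n" for n
      by (intro divide_right_mono) auto
    then show "\<forall>\<^sub>F n in sequentially. x - (1 / 2) ^ n \<le> \<lfloor>2 ^ n * x\<rfloor> / 2 ^ n"
      by (simp add: diff_divide_distrib power_one_over)
    have "\<lfloor>2 ^ n * x\<rfloor> / 2 ^ n \<le> 2 ^ n * x / 2 ^ n" for n
      by (intro divide_right_mono) auto
    then show "\<forall>\<^sub>F n in sequentially. \<lfloor>2 ^ n * x\<rfloor> / 2 ^ n \<le> x" by simp
    have "(\<lambda>n. x - (1 / 2) ^ n) \<longlonglongrightarrow> x - 0"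
      by (intro tendsto_diff tendsto_const LIMSEQ_power_zero) simp
    then show "(\<lambda>n. x - (1 / 2) ^ n) \<longlonglongrightarrow> x" by simp
  qed simp
  then show ?thesis
    unfolding sums_def_le part .
qed

text \<open>After scaling, the digits beyond \<open>m\<close> contribute at most 1/3, so no carry
  occurs and the floor is an integer whose last base-4 digit is \<open>c m\<close>.\<close>

lemma floor_base4:
  assumes c: "\<And>m. c m \<in> {0, 1 :: int}"
  shows "\<lfloor>4 ^ Suc m * (\<Sum>i. real_of_int (c i) / 4 ^ Suc i)\<rfloor> mod 4 = c m"
    and "(\<Sum>i. real_of_int (c i) / 4 ^ Suc i) \<in> {0..1}"
proof -
  let ?f = "\<lambda>i. real_of_int (c i) / 4 ^ Suc i"
  have b: "0 \<le> real_of_int (c i)" "real_of_int (c i) \<le> 1" for i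
    using c[of i] by auto
  have geo: "summable (\<lambda>i. (1 / 4 :: real) ^ Suc i)"
    unfolding summable_Suc_iff by (rule summable_geometric) simp
  have geo_sum: "(\<Sum>i. (1 / 4 :: real) ^ Suc i) = 1 / 3"
    using suminf_mult[of "\<lambda>i. (1 / 4 :: real) ^ i" "1 / 4"] suminf_geometric[of "1 / 4 :: real"]
    by (simp add: summable_geometric)
  have le: "real_of_int (c k) / 4 ^ Suc i \<le> (1 / 4) ^ Suc i" for i k
    using b[of k] by (simp add: power_one_over divide_right_mono)
  have sf: "summable (\<lambda>i. real_of_int (c (i + k)) / 4 ^ Suc i)" for k
    using b le by (intro summable_comparison_test'[OF geo, of 0]) auto
  have tail: "0 \<le> (\<Sum>i. real_of_int (c (i + k)) / 4 ^ Suc i)" "(\<Sum>i. real_of_int (c (i + k)) / 4 ^ Suc i) \<le> 1 / 3" for k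
  proof -
    show "0 \<le> (\<Sum>i. real_of_int (c (i + k)) / 4 ^ Suc i)"
      using b by (intro suminf_nonneg sf) auto
    show "(\<Sum>i. real_of_int (c (i + k)) / 4 ^ Suc i) \<le> 1 / 3"
      unfolding geo_sum[symmetric] by (intro suminf_le le sf geo)
  qed
  show "(\<Sum>i. ?f i) \<in> {0..1}"
    using tail[of 0] by simp
  \<comment> \<open>\<open>N\<close> is the integer written in base 4 by the digits before position
    \<open>m\<close>.\<close>
  define N where "N = (\<Sum>i<m. c i * 4 ^ (m - i - 1))"
  have "(\<Sum>i. ?f i) = (\<Sum>i. ?f (i + Suc m)) + (\<Sum>i<Suc m. ?f i)"
    using sf[of 0] by (intro suminf_split_initial_segment) simp
  also have "(\<Sum>i. ?f (i + Suc m)) = (\<Sum>i. real_of_int (c (i + Suc m)) / 4 ^ Suc i / 4 ^ Suc m)"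
    by (simp add: power_add mult_ac)
  also have "\<dots> = (\<Sum>i. real_of_int (c (i + Suc m)) / 4 ^ Suc i) / 4 ^ Suc m"
    by (intro suminf_divide sf)
  finally have "4 ^ Suc m * (\<Sum>i. ?f i) = (\<Sum>i. real_of_int (c (i + Suc m)) / 4 ^ Suc i) + 4 ^ Suc m * (\<Sum>i<Suc m. ?f i)"
    by (simp add: distrib_left)
  moreover have "4 ^ Suc m * (\<Sum>i<Suc m. ?f i) = real_of_int (4 * N + c m)"
  proof -
    have "4 ^ Suc m * ?f i = real_of_int (4 * (c i * 4 ^ (m - i - 1)))" if "i < m" for i
    proof -
      obtain d where "m = Suc (i + d)" using \<open>i < m\<close> less_iff_Suc_add by auto
      then show ?thesis by (simp add: power_add)
    qed
    then have "4 ^ Suc m * (\<Sum>i<m. ?f i) = real_of_int (4 * N)"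
      unfolding N_def sum_distrib_left of_int_sum by (intro sum.cong) auto
    then show ?thesis by (simp add: distrib_left)
  qed
  ultimately have "\<lfloor>4 ^ Suc m * (\<Sum>i. ?f i)\<rfloor> = 4 * N + c m"
    using tail[of "Suc m"] by (intro floor_unique) auto
  then show "\<lfloor>4 ^ Suc m * (\<Sum>i. ?f i)\<rfloor> mod 4 = c m"
    using c[of m] by auto
qed

definition omega_digit :: "omega \<Rightarrow> nat \<Rightarrow> int" where
  "omega_digit \<omega> m = (case prod_decode m of (n, k) \<Rightarrow> binary_digit k (Rep_unit_interval (\<omega> n)))"

text \<open>All binary digits of all coordinates, written in base 4: since only the digits 0 and 1 occur,
  they can be read off from the number.\<close>

definition omega_code :: "omega \<Rightarrow> real" where
  "omega_code \<omega> = (\<Sum>m. real_of_int (omega_digit \<omega> m) / 4 ^ Suc m)"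

definition omega_decode :: "real \<Rightarrow> omega" where
  "omega_decode y n = unit_clamp (\<Sum>k. real_of_int (\<lfloor>4 ^ Suc (prod_encode (n, k)) * y\<rfloor> mod 4) / 2 ^ k)"

lemma omega_digit_01: "omega_digit \<omega> m \<in> {0, 1}"
  by (auto simp: omega_digit_def binary_digit_def split: prod.split)

lemma omega_code_bounds: "omega_code \<omega> \<in> {0..1}"
  unfolding omega_code_def by (rule floor_base4(2)[OF omega_digit_01])

lemma omega_decode_code: "omega_decode (omega_code \<omega>) = \<omega>"
proof
  fix n
  have "\<lfloor>4 ^ Suc (prod_encode (n, k)) * omega_code \<omega>\<rfloor> mod 4 = binary_digit k (Rep_unit_interval (\<omega> n))" for k
    unfolding omega_code_def floor_base4(1)[OF omega_digit_01] by (simp add: omega_digit_def)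
  then show "omega_decode (omega_code \<omega>) n = \<omega> n"
    using sums_unique[OF binary_digit_sums[OF Rep_unit_interval_bounds, of "\<omega> n"]]
    by (simp add: omega_decode_def unit_clamp_Rep del: power_Suc)
qed

lemma measurable_omega_code [measurable]: "omega_code \<in> borel_measurable borel_omega"
proof -
  have [measurable]: "(\<lambda>\<omega>. real_of_int (omega_digit \<omega> m)) \<in> borel_measurable borel_omega" for m
  proof -
    obtain n k where "prod_decode m = (n, k)" by fastforce
    moreover have "(\<lambda>\<omega>. real_of_int (binary_digit k (Rep_unit_interval (\<omega> n)))) \<in> borel_measurable borel_omega"
      unfolding binary_digit_def by measurable
    ultimately show ?thesis by (simp add: omega_digit_def)
  qed
  show ?thesis unfolding omega_code_def by measurable
qed

lemma measurable_omega_decode [measurable]: "omega_decode \<in> borel \<rightarrow>\<^sub>M borel_omega"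
  by (rule measurable_borel_omegaI) (simp add: omega_decode_def Rep_unit_clamp)

subsection \<open>The real line as a quasi-universal space\<close>

definition real_space :: "real quspace" where
  "real_space = \<lparr>points = UNIV, rvars = borel_measurable universal_omega\<rparr>"

lemma points_real_space [simp]: "points real_space = UNIV"
  and rvars_real_space: "rvars real_space = borel_measurable universal_omega"
  by (simp_all add: real_space_def)

lemma quasi_universal_real_space: "quasi_universal_space real_space"
  by (rule quasi_universal_spaceI) (auto simp: rvars_real_space intro: measurable_compose[rotated])

lemma quasi_universal_real_pair: "quasi_universal_space (prod_space real_space real_space)"
  by (intro quasi_universal_prod_space quasi_universal_real_space)

lemma measurable_induced_real: "(\<lambda>x. x) \<in> borel_measurable (induced real_space)"
  by (rule measurable_inducedI[OF quasi_universal_real_space]) (auto simp: rvars_real_space)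

lemma measurable_induced_real_pair:
  "(\<lambda>x. x) \<in> induced (prod_space real_space real_space) \<rightarrow>\<^sub>M borel \<Otimes>\<^sub>M borel"
proof (rule measurable_inducedI[OF quasi_universal_real_pair])
  fix \<xi> :: "omega \<Rightarrow> real \<times> real" assume "\<xi> \<in> rvars (prod_space real_space real_space)"
  then have "(\<lambda>\<omega>. (fst (\<xi> \<omega>), snd (\<xi> \<omega>))) \<in> universal_omega \<rightarrow>\<^sub>M borel \<Otimes>\<^sub>M borel"
    by (intro measurable_Pair) (auto simp: rvars_prod_space rvars_real_space)
  then show "\<xi> \<in> universal_omega \<rightarrow>\<^sub>M borel \<Otimes>\<^sub>M borel" by simp
qed (simp add: space_pair_measure)

text \<open>The map \<open>x / (1 + \<bar>x\<bar>)\<close> carries the line onto the open interval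
  from -1 to 1; rescaling moves it into the unit interval, with the explicit left inverse
  \<open>unsquash\<close>.\<close>

definition squash :: "real \<Rightarrow> unit_interval" where
  "squash x = unit_clamp (1 / 2 + x / (1 + \<bar>x\<bar>) / 2)"

definition unsquash :: "unit_interval \<Rightarrow> real" where
  "unsquash u = (2 * Rep_unit_interval u - 1) / (1 - \<bar>2 * Rep_unit_interval u - 1\<bar>)"

lemma unsquash_squash: "unsquash (squash x) = x"
proof -
  have a: "\<bar>x / (1 + \<bar>x\<bar>)\<bar> = \<bar>x\<bar> / (1 + \<bar>x\<bar>)" by (simp add: abs_divide)
  then have "\<bar>x / (1 + \<bar>x\<bar>)\<bar> < 1" by (simp add: divide_less_eq)
  moreover have "2 * max 0 (min 1 (1 / 2 + w / 2)) - 1 = w" if "\<bar>w\<bar> < 1" for w :: real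
    using that by (auto simp: max_def min_def abs_less_iff)
  ultimately have R: "2 * Rep_unit_interval (squash x) - 1 = x / (1 + \<bar>x\<bar>)"
    unfolding squash_def Rep_unit_clamp by blast
  have "1 - \<bar>x / (1 + \<bar>x\<bar>)\<bar> = 1 / (1 + \<bar>x\<bar>)"
    unfolding a by (simp add: field_simps)
  then show ?thesis
    unfolding unsquash_def R by simp
qed

lemma measurable_unsquash: "(\<lambda>\<omega>. unsquash (\<omega> n)) \<in> borel_measurable borel_omega"
  unfolding unsquash_def by measurable

text \<open>The line later serves as the auxiliary coordinate to condition on in
  \<open>standard_markov_kernelsI\<close>, so it must be standard itself.\<close>

lemma standard_real_space: "standard_space real_space"
  unfolding standard_space_def
proof (intro disjI2 bexI[of _ "\<lambda>x _. squash x"] bexI[of _ "\<lambda>\<omega>. unsquash (\<omega> 0)"] ballI)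
  show "(\<lambda>x _. squash x) \<in> quasi_measurable real_space omega_space"
  proof (rule quasi_measurableI)
    fix \<xi> assume "\<xi> \<in> rvars real_space"
    then have "\<xi> \<in> borel_measurable universal_omega" by (simp add: rvars_real_space)
    then have "(\<lambda>\<omega> _. squash (\<xi> \<omega>)) \<in> universal_omega \<rightarrow>\<^sub>M borel_omega"
      by (intro measurable_borel_omegaI) (simp add: squash_def Rep_unit_clamp)
    then show "(\<lambda>\<omega> _. squash (\<xi> \<omega>)) \<in> rvars omega_space"
      unfolding rvars_omega_space by (rule measurable_universal_omegaI)
  qed simp
  show "(\<lambda>\<omega>. unsquash (\<omega> 0)) \<in> quasi_measurable omega_space real_space"
  proof (rule quasi_measurableI)
    fix \<xi> assume "\<xi> \<in> rvars omega_space"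
    then have "\<xi> \<in> universal_omega \<rightarrow>\<^sub>M universal_omega" by (simp add: rvars_omega_space)
    from measurable_compose[OF this measurable_universal_omega_borel[OF measurable_unsquash]]
    show "(\<lambda>\<omega>. unsquash (\<xi> \<omega> 0)) \<in> rvars real_space"
      by (simp add: rvars_real_space)
  qed simp
qed (simp add: unsquash_squash)

text \<open>The plane is a retract of the sample space through \<open>\<rho>\<close> and
  \<open>\<xi>\<close>, and sets are pulled back along both. With \<open>universal_eqI\<close>,
  probability measures on the induced sigma-algebra are therefore determined by their values on
  Borel sets.\<close>

lemma sets_induced_real_pair:
  "sets (induced (prod_space real_space real_space)) = sets (universal (borel \<Otimes>\<^sub>M borel))"
proof (intro set_eqI iffI)
  let ?R = "prod_space real_space real_space"
  fix E assume "E \<in> sets (induced ?R)"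
  then have E: "E \<in> induced_sets ?R" by (simp add: sets_induced quasi_universal_real_pair)
  define \<xi> where "\<xi> \<omega> = (unsquash (\<omega> 0), unsquash (\<omega> 1))" for \<omega> :: omega
  define \<rho> where "\<rho> p n = squash (if n = 0 then fst p else snd p)" for p :: "real \<times> real" and n :: nat
  have "\<xi> \<in> rvars ?R"
    using measurable_universal_omega_borel[OF measurable_unsquash] by (simp add: rvars_prod_space rvars_real_space \<xi>_def)
  then have "\<xi> -` E \<in> sets (universal borel_omega)"
    using E unfolding induced_sets_def universal_omega_eq by blast
  moreover have "\<rho> \<in> universal (borel \<Otimes>\<^sub>M borel) \<rightarrow>\<^sub>M universal borel_omega"
  proof (intro measurable_universalI measurable_universalI1 measurable_borel_omegaI)
    fix n
    show "(\<lambda>x. Rep_unit_interval (\<rho> x n)) \<in> borel_measurable (borel \<Otimes>\<^sub>M borel)"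
      by (cases "n = 0") (simp_all add: \<rho>_def squash_def Rep_unit_clamp)
  qed
  ultimately have "\<rho> -` (\<xi> -` E) \<inter> space (universal (borel \<Otimes>\<^sub>M borel)) \<in> sets (universal (borel \<Otimes>\<^sub>M borel))"
    by (rule measurable_sets[rotated])
  moreover have "\<rho> -` (\<xi> -` E) = E"
    by (auto simp: \<xi>_def \<rho>_def unsquash_squash)
  ultimately show "E \<in> sets (universal (borel \<Otimes>\<^sub>M borel))"
    by (simp add: space_pair_measure)
next
  let ?R = "prod_space real_space real_space"
  fix E assume E: "E \<in> sets (universal (borel \<Otimes>\<^sub>M borel :: (real \<times> real) measure))"
  have "E \<in> induced_sets ?R"
  proof (rule in_induced_setsI)
    fix \<xi> assume "\<xi> \<in> rvars ?R"
    then have "\<xi> \<in> universal_omega \<rightarrow>\<^sub>M borel \<Otimes>\<^sub>M borel"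
      using measurable_compose[OF measurable_rvars[OF quasi_universal_real_pair] measurable_induced_real_pair] by blast
    then have "\<xi> \<in> universal borel_omega \<rightarrow>\<^sub>M universal (borel \<Otimes>\<^sub>M borel)"
      unfolding universal_omega_eq by (rule measurable_universalI)
    from measurable_sets[OF this E] show "\<xi> -` E \<in> sets universal_omega"
      by (simp add: universal_omega_eq)
  qed simp
  then show "E \<in> sets (induced ?R)"
    by (simp add: sets_induced quasi_universal_real_pair)
qed

text \<open>The sample space is a retract of the line through its digit code. The codes stay in the
  unit interval, the range that the quantile transform presupposes.\<close>

lemma standard_retract:
  assumes X: "quasi_universal_space X" "standard_space X" "points X \<noteq> {}"
  obtains e d where "e \<in> quasi_measurable X real_space" "d \<in> quasi_measurable real_space X"
    "\<And>x. x \<in> points X \<Longrightarrow> d (e x) = x" "\<And>x. e x \<in> {0..1}"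
proof -
  obtain i r where i: "i \<in> quasi_measurable X omega_space" and r: "r \<in> quasi_measurable omega_space X"
    and ri: "\<And>x. x \<in> points X \<Longrightarrow> r (i x) = x"
    using X by (auto simp: standard_space_def)
  have "omega_code \<in> quasi_measurable omega_space real_space"
    using measurable_compose[OF _ measurable_universal_omega_borel[OF measurable_omega_code]]
    by (intro quasi_measurableI) (auto simp: rvars_omega_space rvars_real_space)
  then have e: "(\<lambda>x. omega_code (i x)) \<in> quasi_measurable X real_space"
    by (rule quasi_measurable_compose[OF i])
  have "omega_decode \<in> quasi_measurable real_space omega_space"
    by (intro quasi_measurableI)
      (auto simp: rvars_omega_space rvars_real_space intro!: measurable_universal_omegaI measurable_compose[OF _ measurable_omega_decode])
  then have d: "(\<lambda>y. r (omega_decode y)) \<in> quasi_measurable real_space X"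
    by (rule quasi_measurable_compose[OF _ r])
  show thesis
    by (rule that[OF e d]) (simp_all add: omega_decode_code ri omega_code_bounds del: atLeastAtMost_iff)
qed

subsection \<open>Disintegration\<close>

text \<open>The common noise law: one uniform variable copied into every coordinate, of which only
  coordinate 0 is read later. The extension makes it a measure on the universally measurable sets,
  as \<open>P_space\<close> demands.\<close>

definition omega_uniform :: "omega measure" where
  "omega_uniform = universal_extension borel_omega (distr unit_uniform borel_omega (\<lambda>u _. unit_clamp u))"

lemma measurable_clamp_omega: "(\<lambda>u _. unit_clamp u) \<in> borel \<rightarrow>\<^sub>M borel_omega"
  by (rule measurable_borel_omegaI) (simp add: Rep_unit_clamp)

lemma omega_uniform_prob: "omega_uniform \<in> space (prob_algebra universal_omega)"
  and distr_omega_uniform: "distr omega_uniform borel (\<lambda>\<omega>. Rep_unit_interval (\<omega> 0)) = unit_uniform"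
proof -
  let ?\<mu> = "distr unit_uniform borel_omega (\<lambda>u _. unit_clamp u)"
  have m: "(\<lambda>u _. unit_clamp u) \<in> unit_uniform \<rightarrow>\<^sub>M borel_omega"
    using measurable_clamp_omega by (simp cong: measurable_cong_sets)
  have \<mu>: "?\<mu> \<in> space (prob_algebra borel_omega)"
    using prob_space.prob_space_distr[OF prob_space_unit_uniform m] by (simp add: space_prob_algebra)
  show P: "omega_uniform \<in> space (prob_algebra universal_omega)"
    unfolding omega_uniform_def universal_omega_eq by (rule universal_extension(1)[OF \<mu>])
  show "distr omega_uniform borel (\<lambda>\<omega>. Rep_unit_interval (\<omega> 0)) = unit_uniform"
  proof (rule measure_eqI)
    fix A :: "real set" assume "A \<in> sets (distr omega_uniform borel (\<lambda>\<omega>. Rep_unit_interval (\<omega> 0)))"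
    then have A [measurable]: "A \<in> sets borel" by simp
    have U: "(\<lambda>\<omega>. Rep_unit_interval (\<omega> 0)) \<in> borel_measurable omega_uniform"
      using measurable_universal_omega_borel[OF Rep_unit_interval_measurable] space_prob_algebraD(2)[OF P]
      by (simp cong: measurable_cong_sets)
    have UA: "(\<lambda>\<omega>. Rep_unit_interval (\<omega> 0)) -` A \<in> sets borel_omega"
      using measurable_sets[OF Rep_unit_interval_measurable A] by simp
    have "emeasure (distr omega_uniform borel (\<lambda>\<omega>. Rep_unit_interval (\<omega> 0))) A = emeasure omega_uniform ((\<lambda>\<omega>. Rep_unit_interval (\<omega> 0)) -` A)"
      using space_prob_algebraD(3)[OF P] by (simp add: emeasure_distr[OF U])
    also have "\<dots> = emeasure ?\<mu> ((\<lambda>\<omega>. Rep_unit_interval (\<omega> 0)) -` A)"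
      unfolding omega_uniform_def by (rule universal_extension(2)[OF \<mu> UA])
    also have "\<dots> = emeasure unit_uniform {u. max 0 (min 1 u) \<in> A}"
      by (subst emeasure_distr[OF m UA]) (simp add: vimage_def Rep_unit_clamp)
    also have "\<dots> = emeasure unit_uniform A"
    proof -
      have 1: "{u. max 0 (min 1 u) \<in> A} \<in> sets borel"
        by measurable
      have "{0..1} \<inter> {u. max 0 (min 1 u) \<in> A} = {0..1} \<inter> A" by auto
      then show ?thesis using 1 A by simp
    qed
    finally show "emeasure (distr omega_uniform borel (\<lambda>\<omega>. Rep_unit_interval (\<omega> 0))) A = emeasure unit_uniform A" .
  qed simp
qed

text \<open>The kernel is restricted to Borel sets and disintegrated there; coordinate 0 of the
  sample space then replaces the uniform variable in \<open>\<Xi>\<close>. The resulting identity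
  holds on Borel sets and extends to all induced sets by \<open>universal_eqI\<close>.\<close>

lemma real_markov_disintegration:
  assumes Z: "quasi_universal_space Z"
    and K: "K \<in> induced Z \<rightarrow>\<^sub>M prob_algebra (induced (prod_space real_space real_space))"
    and bd: "\<And>z. z \<in> points Z \<Longrightarrow> AE p in K z. fst p \<in> {0..1}"
  obtains Q where "Q \<in> markov_kernels (prod_space real_space Z) real_space"
    "\<And>z. z \<in> points Z \<Longrightarrow> K z = distr (K z) (induced real_space) snd \<bind>
       (\<lambda>y. distr (Q (y, z)) (induced (prod_space real_space real_space)) (\<lambda>x. (x, y)))"
proof -
  let ?R = real_space
  let ?RR = "prod_space ?R ?R"
  let ?U = "\<lambda>\<omega> :: omega. Rep_unit_interval (\<omega> 0)"
  note R = quasi_universal_real_space and RR = quasi_universal_real_pair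
  define \<kappa> where "\<kappa> z = distr (K z) (borel \<Otimes>\<^sub>M borel) (\<lambda>x. x)" for z
  have Kp: "K z \<in> space (prob_algebra (induced ?RR))" if "z \<in> points Z" for z
    using measurable_space[OF K] that by simp
  have idK: "(\<lambda>x. x) \<in> K z \<rightarrow>\<^sub>M borel \<Otimes>\<^sub>M borel" if "z \<in> points Z" for z
    using measurable_induced_real_pair space_prob_algebraD(2)[OF Kp[OF that]] by (simp cong: measurable_cong_sets)
  have \<kappa>: "\<kappa> \<in> induced Z \<rightarrow>\<^sub>M prob_algebra (borel \<Otimes>\<^sub>M borel)"
    unfolding \<kappa>_def by (rule measurable_compose[OF K measurable_distr_prob_space[OF measurable_induced_real_pair]])
  have bd': "AE p in \<kappa> z. fst p \<in> {0..1}" if "z \<in> space (induced Z)" for z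
    unfolding \<kappa>_def using that bd[of z] by (subst AE_distr_iff[OF idK]) auto
  obtain \<Xi> where \<Xi>: "(\<lambda>(z, y, u). \<Xi> z y u) \<in> borel_measurable (induced Z \<Otimes>\<^sub>M borel \<Otimes>\<^sub>M borel)"
    "\<And>z. z \<in> space (induced Z) \<Longrightarrow>
       distr (distr (\<kappa> z) borel snd \<Otimes>\<^sub>M unit_uniform) (borel \<Otimes>\<^sub>M borel) (\<lambda>(y, u). (\<Xi> z y u, y)) = \<kappa> z"
    using real_kernel_disintegration[OF \<kappa> bd'] by blast
  have U: "?U \<in> borel_measurable universal_omega"
    by (rule measurable_universal_omega_borel[OF Rep_unit_interval_measurable])
  have \<Xi>rv: "(\<lambda>\<omega> \<omega>'. \<Xi> (\<zeta> \<omega>) (\<eta> \<omega>) (?U \<omega>')) \<in> rvars_rvars ?R"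
    if "\<zeta> \<in> rvars Z" "\<eta> \<in> rvars ?R" for \<zeta> \<eta>
  proof (rule rvars_rvarsI[OF R])
    fix \<alpha> \<beta> :: "omega \<Rightarrow> omega"
    assume ab: "\<alpha> \<in> universal_omega \<rightarrow>\<^sub>M universal_omega" "\<beta> \<in> universal_omega \<rightarrow>\<^sub>M universal_omega"
    have "(\<lambda>\<omega>. (\<zeta> (\<alpha> \<omega>), \<eta> (\<alpha> \<omega>), ?U (\<beta> \<omega>))) \<in> universal_omega \<rightarrow>\<^sub>M induced Z \<Otimes>\<^sub>M borel \<Otimes>\<^sub>M borel"
      using measurable_compose[OF ab(1) measurable_rvars[OF Z that(1)]] that(2)[unfolded rvars_real_space, THEN measurable_compose[OF ab(1)]]
        measurable_compose[OF ab(2) U]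
      by (intro measurable_Pair)
    from measurable_compose[OF this \<Xi>(1)]
    show "(\<lambda>\<omega>. \<Xi> (\<zeta> (\<alpha> \<omega>)) (\<eta> (\<alpha> \<omega>)) (?U (\<beta> \<omega>))) \<in> rvars ?R"
      by (simp add: rvars_real_space)
  qed
  define Q where "Q p = distr omega_uniform (induced ?R) (\<lambda>\<omega>'. \<Xi> (snd p) (fst p) (?U \<omega>'))" for p
  have Q: "Q \<in> markov_kernels (prod_space ?R Z) ?R"
  proof (rule markov_kernelsI[OF quasi_universal_prod_space[OF R Z]])
    fix \<zeta> assume "\<zeta> \<in> rvars (prod_space ?R Z)"
    then have "(\<lambda>\<omega>. fst (\<zeta> \<omega>)) \<in> rvars ?R" "(\<lambda>\<omega>. snd (\<zeta> \<omega>)) \<in> rvars Z"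
      by (simp_all add: rvars_prod_space)
    from \<Xi>rv[OF this(2,1)] show "(\<lambda>\<omega>. Q (\<zeta> \<omega>)) \<in> rvars (P_space ?R)"
      by (rule rvars_P_spaceI[OF _ omega_uniform_prob]) (simp add: Q_def)
  qed
  have "K z = distr (K z) (induced ?R) snd \<bind> (\<lambda>y. distr (Q (y, z)) (induced ?RR) (\<lambda>x. (x, y)))" (is "_ = ?M")
    if z: "z \<in> points Z" for z
  proof -
    have snd: "snd \<in> induced ?RR \<rightarrow>\<^sub>M induced ?R"
      by (intro measurable_quasi_measurable RR R quasi_measurable_snd)
    have Y: "distr (K z) (induced ?R) snd \<in> space (prob_algebra (induced ?R))"
      by (rule distr_in_prob_algebra[OF Kp[OF z] snd])
    have "(\<lambda>y. (y, z)) \<in> quasi_measurable ?R (prod_space ?R Z)"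
      by (intro quasi_measurable_Pair quasi_measurable_ident quasi_measurable_const Z z)
    from markov_kernels_push_measurable[OF R R RR markov_kernels_compose[OF this Q] quasi_measurable_ident]
    have m: "(\<lambda>y. distr (Q (y, z)) (induced ?RR) (\<lambda>x. (x, y))) \<in> induced ?R \<rightarrow>\<^sub>M prob_algebra (induced ?RR)" .
    have pM: "?M \<in> space (prob_algebra (induced ?RR))"
      using prob_space_bind'[OF Y m] sets_bind'[OF Y m] by (simp add: space_prob_algebra)
    have eqP: "prob_algebra (induced ?RR) = prob_algebra (universal (borel \<Otimes>\<^sub>M borel))"
      by (simp add: prob_algebra_def sets_induced_real_pair cong: subprob_algebra_cong)
    show ?thesis
    proof (rule universal_eqI)
      show "K z \<in> space (prob_algebra (universal (borel \<Otimes>\<^sub>M borel)))" "?M \<in> space (prob_algebra (universal (borel \<Otimes>\<^sub>M borel)))"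
        using Kp[OF z] pM by (simp_all add: eqP)
      fix A :: "(real \<times> real) set" assume A: "A \<in> sets (borel \<Otimes>\<^sub>M borel)"
      then have A': "A \<in> sets (induced ?RR)"
        using sets_subset_universal by (auto simp: sets_induced_real_pair)
      \<comment> \<open>Evaluated at \<open>A\<close>, both sides of the identity become the
        integral of this section function against the second marginal.\<close>
      define g where "g y = emeasure unit_uniform {u. (\<Xi> z y u, y) \<in> A}" for y
      interpret V: prob_space unit_uniform by (rule prob_space_unit_uniform)
      have [measurable_cong]: "sets unit_uniform = sets borel" by simp
      have \<Xi>z: "(\<lambda>(y, u). (\<Xi> z y u, y)) \<in> borel \<Otimes>\<^sub>M unit_uniform \<rightarrow>\<^sub>M borel \<Otimes>\<^sub>M borel"
      proof -
        have "(\<lambda>w. (z, fst w, snd w)) \<in> borel \<Otimes>\<^sub>M borel \<rightarrow>\<^sub>M induced Z \<Otimes>\<^sub>M borel \<Otimes>\<^sub>M borel"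
          using z by (intro measurable_Pair measurable_const measurable_fst measurable_snd) simp
        from measurable_compose[OF this \<Xi>(1)]
        have "(\<lambda>w. (\<Xi> z (fst w) (snd w), fst w)) \<in> borel \<Otimes>\<^sub>M borel \<rightarrow>\<^sub>M borel \<Otimes>\<^sub>M borel"
          by (intro measurable_Pair measurable_fst) simp
        moreover have "sets (borel \<Otimes>\<^sub>M unit_uniform) = sets (borel \<Otimes>\<^sub>M borel)"
          by (intro sets_pair_measure_cong) simp_all
        ultimately show ?thesis
          by (simp add: split_beta' cong: measurable_cong_sets)
      qed
      define S where "S = {(y, u). (\<Xi> z y u, y) \<in> A}"
      have S: "S \<in> sets (borel \<Otimes>\<^sub>M unit_uniform)"
        using measurable_sets[OF \<Xi>z A] by (simp add: space_pair_measure vimage_def S_def split_beta')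
      have gm: "g \<in> borel_measurable borel"
        using V.measurable_emeasure_Pair[OF S] by (simp add: g_def[abs_def] S_def vimage_def)
      have q: "emeasure (distr (Q (y, z)) (induced ?RR) (\<lambda>x. (x, y))) A = g y" for y
      proof -
        have \<Xi>U: "(\<lambda>\<omega>'. \<Xi> z y (?U \<omega>')) \<in> rvars ?R"
          using rvars_rvars_section[OF \<Xi>rv[OF rvars_const[OF Z z] rvars_const[OF R, of y]]] by simp
        have mU: "?U \<in> borel_measurable omega_uniform" "(\<lambda>\<omega>'. \<Xi> z y (?U \<omega>')) \<in> omega_uniform \<rightarrow>\<^sub>M induced ?R"
          using U measurable_rvars[OF R \<Xi>U] space_prob_algebraD(2)[OF omega_uniform_prob]
          by (simp_all cong: measurable_cong_sets)
        have p: "(\<lambda>x. (x, y)) \<in> induced ?R \<rightarrow>\<^sub>M induced ?RR"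
          by (intro measurable_quasi_measurable R RR quasi_measurable_Pair quasi_measurable_ident quasi_measurable_const) simp
        have Sy: "{u. (\<Xi> z y u, y) \<in> A} \<in> sets borel"
          using sets_Pair1[OF S, of y] by (simp add: S_def vimage_def)
        have "emeasure (distr (Q (y, z)) (induced ?RR) (\<lambda>x. (x, y))) A = emeasure omega_uniform (?U -` {u. (\<Xi> z y u, y) \<in> A})"
          using A' space_prob_algebraD(3)[OF omega_uniform_prob]
          by (simp add: Q_def distr_distr[OF p mU(2)] comp_def emeasure_distr measurable_compose[OF mU(2) p] vimage_def)
        also have "\<dots> = emeasure (distr omega_uniform borel ?U) {u. (\<Xi> z y u, y) \<in> A}"
          using Sy mU(1) space_prob_algebraD(3)[OF omega_uniform_prob] by (simp add: emeasure_distr)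
        finally show ?thesis by (simp add: distr_omega_uniform g_def)
      qed
      have sndK: "snd \<in> K z \<rightarrow>\<^sub>M induced ?R" "snd \<in> borel_measurable (K z)"
        using snd measurable_compose[OF measurable_induced_real_pair measurable_snd] space_prob_algebraD(2)[OF Kp[OF z]]
        by (simp_all cong: measurable_cong_sets)
      have "emeasure ?M A = (\<integral>\<^sup>+y. g y \<partial>distr (K z) (induced ?R) snd)"
        by (simp add: emeasure_bind_prob_algebra[OF Y m A'] q)
      also have "\<dots> = (\<integral>\<^sup>+p. g (snd p) \<partial>K z)"
        using measurable_compose[OF measurable_induced_real gm] by (intro nn_integral_distr sndK) auto
      also have "\<dots> = (\<integral>\<^sup>+y. g y \<partial>distr (K z) borel snd)"
        by (intro nn_integral_distr[symmetric] sndK) (simp add: gm)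
      also have "distr (K z) borel snd = distr (\<kappa> z) borel snd"
        unfolding \<kappa>_def by (subst distr_distr[OF measurable_snd idK[OF z]]) (simp add: comp_def)
      also have "(\<integral>\<^sup>+y. g y \<partial>distr (\<kappa> z) borel snd) = emeasure (distr (\<kappa> z) borel snd \<Otimes>\<^sub>M unit_uniform) S"
        using S by (subst V.emeasure_pair_measure_alt) (auto simp: g_def[abs_def] S_def vimage_def cong: sets_pair_measure_cong)
      also have "\<dots> = emeasure (distr (distr (\<kappa> z) borel snd \<Otimes>\<^sub>M unit_uniform) (borel \<Otimes>\<^sub>M borel) (\<lambda>(y, u). (\<Xi> z y u, y))) A"
        using \<Xi>z A by (subst emeasure_distr) (auto simp: space_pair_measure S_def split_beta' intro!: arg_cong2[where f=emeasure] cong: measurable_cong_sets sets_pair_measure_cong)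
      also have "\<dots> = emeasure (\<kappa> z) A"
        using \<Xi>(2)[of z] z by simp
      also have "\<dots> = emeasure (K z) A"
        using sets.sets_into_space[OF A'] space_prob_algebraD(3)[OF Kp[OF z]]
        by (simp add: \<kappa>_def emeasure_distr[OF idK[OF z] A])
      finally show "emeasure (K z) A = emeasure ?M A" by simp
    qed
  qed
  with Q show thesis by (rule that)
qed

text \<open>Both coordinates are encoded in the line, the disintegration is done there, and the
  result is decoded. Decoding undoes encoding on points, so the detour changes no law.\<close>

lemma standard_markov_disintegration:
  assumes Z: "quasi_universal_space Z"
    and X: "quasi_universal_space X" "standard_space X" "points X \<noteq> {}"
    and Y: "quasi_universal_space Y" "standard_space Y" "points Y \<noteq> {}"
    and K: "K \<in> induced Z \<rightarrow>\<^sub>M prob_algebra (induced (prod_space X Y))"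
  obtains Q where "Q \<in> markov_kernels (prod_space Y Z) X"
    "\<And>z. z \<in> points Z \<Longrightarrow> K z = distr (K z) (induced Y) snd \<bind>
       (\<lambda>y. distr (Q (y, z)) (induced (prod_space X Y)) (\<lambda>x. (x, y)))"
proof -
  let ?R = real_space
  let ?RR = "prod_space ?R ?R"
  let ?XY = "prod_space X Y"
  note R = quasi_universal_real_space and RR = quasi_universal_real_pair
  have XY: "quasi_universal_space ?XY" by (rule quasi_universal_prod_space[OF X(1) Y(1)])
  obtain eX dX where eX: "eX \<in> quasi_measurable X ?R" "dX \<in> quasi_measurable ?R X"
    "\<And>x. x \<in> points X \<Longrightarrow> dX (eX x) = x" "\<And>x. eX x \<in> {0..1}"
    by (rule standard_retract[OF X], rule that)
  obtain eY dY where eY: "eY \<in> quasi_measurable Y ?R" "dY \<in> quasi_measurable ?R Y"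
    "\<And>x. x \<in> points Y \<Longrightarrow> dY (eY x) = x"
    by (rule standard_retract[OF Y], rule that)
  define \<epsilon> where "\<epsilon> p = (eX (fst p), eY (snd p))" for p
  define \<delta> where "\<delta> p = (dX (fst p), dY (snd p))" for p
  have "\<epsilon> \<in> quasi_measurable ?XY ?RR" "\<delta> \<in> quasi_measurable ?RR ?XY"
    unfolding \<epsilon>_def[abs_def] \<delta>_def[abs_def]
    by (rule quasi_measurable_Pair[OF quasi_measurable_compose[OF quasi_measurable_fst eX(1)] quasi_measurable_compose[OF quasi_measurable_snd eY(1)]]
        quasi_measurable_Pair[OF quasi_measurable_compose[OF quasi_measurable_fst eX(2)] quasi_measurable_compose[OF quasi_measurable_snd eY(2)]])+
  then have m: "\<epsilon> \<in> induced ?XY \<rightarrow>\<^sub>M induced ?RR" "\<delta> \<in> induced ?RR \<rightarrow>\<^sub>M induced ?XY"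
    by (auto intro: measurable_quasi_measurable XY RR)
  have Kp: "K z \<in> space (prob_algebra (induced ?XY))" if "z \<in> points Z" for z
    using measurable_space[OF K] that by simp
  define K' where "K' z = distr (K z) (induced ?RR) \<epsilon>" for z
  have K': "K' \<in> induced Z \<rightarrow>\<^sub>M prob_algebra (induced ?RR)"
    unfolding K'_def by (rule measurable_compose[OF K measurable_distr_prob_space[OF m(1)]])
  have "AE p in K' z. fst p \<in> {0..1}" if z: "z \<in> points Z" for z
  proof -
    have "\<epsilon> \<in> K z \<rightarrow>\<^sub>M induced ?RR"
      using m(1) space_prob_algebraD(2)[OF Kp[OF z]] by (simp cong: measurable_cong_sets)
    moreover have "{p \<in> space (induced ?RR). fst p \<in> {0..1}} \<in> sets (induced ?RR)"
      using measurable_sets[OF measurable_compose[OF measurable_induced_real_pair measurable_fst], of "{0..1}"]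
      by (simp add: vimage_def del: atLeastAtMost_iff)
    ultimately show ?thesis
      unfolding K'_def using eX(4) by (subst AE_distr_iff) (auto simp: \<epsilon>_def)
  qed
  with real_markov_disintegration[OF Z K'] obtain Q' where Q': "Q' \<in> markov_kernels (prod_space ?R Z) ?R"
    "\<And>z. z \<in> points Z \<Longrightarrow> K' z = distr (K' z) (induced ?R) snd \<bind> (\<lambda>y. distr (Q' (y, z)) (induced ?RR) (\<lambda>x. (x, y)))"
    by blast
  define Q where "Q p = distr (Q' (eY (fst p), snd p)) (induced X) dX" for p
  have YZ: "quasi_universal_space (prod_space Y Z)" by (rule quasi_universal_prod_space[OF Y(1) Z])
  have "(\<lambda>p. (eY (fst p), snd p)) \<in> quasi_measurable (prod_space Y Z) (prod_space ?R Z)"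
    by (intro quasi_measurable_Pair quasi_measurable_compose[OF quasi_measurable_fst eY(1)] quasi_measurable_snd)
  from markov_kernels_push[OF YZ R X(1) markov_kernels_compose[OF this Q'(1)] quasi_measurable_compose[OF quasi_measurable_fst eX(2)]]
  have Q: "Q \<in> markov_kernels (prod_space Y Z) X"
    by (simp add: Q_def[abs_def])
  have "K z = distr (K z) (induced Y) snd \<bind> (\<lambda>y. distr (Q (y, z)) (induced ?XY) (\<lambda>x. (x, y)))"
    if z: "z \<in> points Z" for z
  proof -
    have K'p: "K' z \<in> space (prob_algebra (induced ?RR))"
      using measurable_space[OF K'] z by simp
    have snd: "snd \<in> induced ?RR \<rightarrow>\<^sub>M induced ?R" "snd \<in> induced ?XY \<rightarrow>\<^sub>M induced Y"
      by (intro measurable_quasi_measurable RR R XY Y(1) quasi_measurable_snd)+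
    have meY: "eY \<in> induced Y \<rightarrow>\<^sub>M induced ?R" and mdX: "dX \<in> induced ?R \<rightarrow>\<^sub>M induced X"
      by (intro measurable_quasi_measurable R X(1) Y(1) eX eY)+
    have "(\<lambda>y. (y, z)) \<in> quasi_measurable ?R (prod_space ?R Z)"
      by (intro quasi_measurable_Pair quasi_measurable_ident quasi_measurable_const Z z)
    note Q'z = markov_kernels_compose[OF this Q'(1)]
    note Q'm = markov_kernels_push_measurable[OF R R RR Q'z quasi_measurable_ident]
    have Q'p: "Q' (y, z) \<in> space (prob_algebra (induced ?R))" for y
      using points_P_space_prob[OF R markov_kernels_points[OF Q'z, of y]] by simp
    have pr: "(\<lambda>x. (x, y)) \<in> induced ?R \<rightarrow>\<^sub>M induced ?RR" for y
      by (intro measurable_quasi_measurable R RR quasi_measurable_Pair quasi_measurable_ident quasi_measurable_const) simp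
    have prX: "(\<lambda>x. (x, y)) \<in> induced X \<rightarrow>\<^sub>M induced ?XY" if "y \<in> points Y" for y
      by (intro measurable_quasi_measurable X(1) Y(1) XY quasi_measurable_Pair quasi_measurable_ident quasi_measurable_const that)
    have KY: "distr (K z) (induced Y) snd \<in> space (prob_algebra (induced Y))"
      by (rule distr_in_prob_algebra[OF Kp[OF z] snd(2)])
    have "K z = distr (K z) (induced ?XY) (\<lambda>x. x)"
      using space_prob_algebraD(2)[OF Kp[OF z]] by (intro distr_id2[symmetric]) simp
    also have "\<dots> = distr (K z) (induced ?XY) (\<lambda>x. \<delta> (\<epsilon> x))"
      by (rule distr_cong_prob[OF Kp[OF z]]) (auto simp: \<delta>_def \<epsilon>_def eX(3) eY(3))
    also have "\<dots> = distr (K' z) (induced ?XY) \<delta>"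
      unfolding K'_def by (rule distr_distr_prob[OF Kp[OF z] m, symmetric])
    also have "\<dots> = distr (distr (K' z) (induced ?R) snd \<bind> (\<lambda>y. distr (Q' (y, z)) (induced ?RR) (\<lambda>x. (x, y)))) (induced ?XY) \<delta>"
      using Q'(2)[OF z] by simp
    also have "\<dots> = distr (K' z) (induced ?R) snd \<bind> (\<lambda>y. distr (distr (Q' (y, z)) (induced ?RR) (\<lambda>x. (x, y))) (induced ?XY) \<delta>)"
      by (rule distr_bind_prob[OF distr_in_prob_algebra[OF K'p snd(1)] Q'm m(2)])
    also have "distr (K' z) (induced ?R) snd = distr (K z) (induced ?R) (\<lambda>p. eY (snd p))"
      unfolding K'_def by (subst distr_distr_prob[OF Kp[OF z] m(1) snd(1)]) (simp add: \<epsilon>_def)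
    also have "\<dots> = distr (distr (K z) (induced Y) snd) (induced ?R) eY"
      by (rule distr_distr_prob[OF Kp[OF z] snd(2) meY, symmetric])
    also have "\<dots> \<bind> (\<lambda>y. distr (distr (Q' (y, z)) (induced ?RR) (\<lambda>x. (x, y))) (induced ?XY) \<delta>) =
        distr (K z) (induced Y) snd \<bind> (\<lambda>y. distr (distr (Q' (eY y, z)) (induced ?RR) (\<lambda>x. (x, eY y))) (induced ?XY) \<delta>)"
      by (rule bind_distr_prob[OF KY meY measurable_compose[OF Q'm measurable_distr_prob_space[OF m(2)]]])
    also have "\<dots> = distr (K z) (induced Y) snd \<bind> (\<lambda>y. distr (Q (y, z)) (induced ?XY) (\<lambda>x. (x, y)))"
    proof (rule bind_cong_prob[OF KY])
      fix y assume "y \<in> space (induced Y)"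
      then have y: "y \<in> points Y" by simp
      show "distr (distr (Q' (eY y, z)) (induced ?RR) (\<lambda>x. (x, eY y))) (induced ?XY) \<delta> = distr (Q (y, z)) (induced ?XY) (\<lambda>x. (x, y))"
        by (simp add: distr_distr_prob[OF Q'p pr m(2)] Q_def distr_distr_prob[OF Q'p mdX prX[OF y]] \<delta>_def eY(3)[OF y])
    qed
    finally show ?thesis .
  qed
  with Q show thesis by (rule that)
qed

text \<open>The product of \<open>K z\<close> with the point mass at 0 is disintegrated along its
  second coordinate. This yields a Markov kernel, whose value at 0 is \<open>K z\<close> because the
  second marginal is that point mass. Composed kernels thus need no explicit merging of their noise
  variables.\<close>

lemma standard_markov_kernelsI:
  assumes Z: "quasi_universal_space Z" and X: "quasi_universal_space X" "standard_space X" "points X \<noteq> {}"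
    and K: "K \<in> induced Z \<rightarrow>\<^sub>M prob_algebra (induced X)"
  shows "K \<in> markov_kernels Z X"
proof -
  let ?R = real_space
  let ?XR = "prod_space X ?R"
  note R = quasi_universal_real_space
  have XR: "quasi_universal_space ?XR" by (rule quasi_universal_prod_space[OF X(1) R])
  note sR = standard_real_space
  have p0: "(\<lambda>x. (x, 0)) \<in> quasi_measurable X ?XR"
    by (intro quasi_measurable_Pair quasi_measurable_ident quasi_measurable_const R) simp
  then have m0: "(\<lambda>x. (x, 0)) \<in> induced X \<rightarrow>\<^sub>M induced ?XR"
    by (intro measurable_quasi_measurable X(1) XR)
  have mfst: "fst \<in> induced ?XR \<rightarrow>\<^sub>M induced X" and msnd: "snd \<in> induced ?XR \<rightarrow>\<^sub>M induced ?R"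
    by (intro measurable_quasi_measurable X(1) XR R quasi_measurable_fst quasi_measurable_snd)+
  define K' where "K' z = distr (K z) (induced ?XR) (\<lambda>x. (x, 0))" for z
  have K': "K' \<in> induced Z \<rightarrow>\<^sub>M prob_algebra (induced ?XR)"
    unfolding K'_def by (rule measurable_compose[OF K measurable_distr_prob_space[OF m0]])
  obtain Q where Q: "Q \<in> markov_kernels (prod_space ?R Z) X"
    "\<And>z. z \<in> points Z \<Longrightarrow> K' z = distr (K' z) (induced ?R) snd \<bind> (\<lambda>y. distr (Q (y, z)) (induced ?XR) (\<lambda>x. (x, y)))"
    using standard_markov_disintegration[OF Z X R sR _ K'] by auto
  have Q0: "(\<lambda>z. Q (0, z)) \<in> markov_kernels Z X"
    by (rule markov_kernels_compose[OF _ Q(1)])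
      (intro quasi_measurable_Pair quasi_measurable_ident quasi_measurable_const R, simp)
  show ?thesis
  proof (rule markov_kernels_cong[OF Z Q0])
    fix z assume z: "z \<in> points Z"
    have Kz: "K z \<in> space (prob_algebra (induced X))"
      using measurable_space[OF K] z by simp
    have Qz: "Q (0, z) \<in> space (prob_algebra (induced X))"
      by (rule points_P_space_prob[OF X(1) markov_kernels_points[OF Q0 z]])
    have "(\<lambda>y. (y, z)) \<in> quasi_measurable ?R (prod_space ?R Z)"
      by (intro quasi_measurable_Pair quasi_measurable_ident quasi_measurable_const Z z)
    note Qm = markov_kernels_push_measurable[OF R X(1) XR markov_kernels_compose[OF this Q(1)] quasi_measurable_ident]
    have "distr (K' z) (induced ?R) snd = distr (K z) (induced ?R) (\<lambda>_. 0)"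
      unfolding K'_def by (subst distr_distr_prob[OF Kz m0 msnd]) simp
    also have "\<dots> = return (induced ?R) 0"
      using space_prob_algebraD(1)[OF Kz] by (intro prob_space.distr_const) auto
    finally have "K' z = return (induced ?R) 0 \<bind> (\<lambda>y. distr (Q (y, z)) (induced ?XR) (\<lambda>x. (x, y)))"
      using Q(2)[OF z] by simp
    also have "\<dots> = distr (Q (0, z)) (induced ?XR) (\<lambda>x. (x, 0))"
      by (subst bind_return[OF measurable_prob_algebraD[OF Qm]]) simp_all
    finally have "distr (K' z) (induced X) fst = distr (distr (Q (0, z)) (induced ?XR) (\<lambda>x. (x, 0))) (induced X) fst"
      by simp
    then have "distr (K z) (induced X) (\<lambda>x. x) = distr (Q (0, z)) (induced X) (\<lambda>x. x)"
      unfolding K'_def by (simp add: distr_distr_prob[OF Kz m0 mfst] distr_distr_prob[OF Qz m0 mfst])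
    then show "Q (0, z) = K z"
      using space_prob_algebraD(2)[OF Kz] space_prob_algebraD(2)[OF Qz] by (simp add: distr_id2)
  qed
qed

text \<open>The pairing function stores the codes of all components in one sequence.
  \<open>None\<close> occurs only for \<open>D = {}\<close>, where a constant pads the code.\<close>

lemma standard_Pi_space:
  assumes D: "countable D" and X: "\<And>v. v \<in> D \<Longrightarrow> quasi_universal_space (X v)"
    "\<And>v. v \<in> D \<Longrightarrow> standard_space (X v)" "\<And>v. v \<in> D \<Longrightarrow> points (X v) \<noteq> {}"
  shows "standard_space (Pi_space D X)"
proof -
  have PX: "quasi_universal_space (Pi_space D X)" by (rule quasi_universal_Pi_space) (rule X)
  have "\<exists>i r. i \<in> quasi_measurable (X v) omega_space \<and> r \<in> quasi_measurable omega_space (X v) \<and> (\<forall>x\<in>points (X v). r (i x) = x)"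
    if "v \<in> D" for v
    using X(2,3)[OF that] unfolding standard_space_def by blast
  then obtain i r where i: "\<And>v. v \<in> D \<Longrightarrow> i v \<in> quasi_measurable (X v) omega_space"
    and r: "\<And>v. v \<in> D \<Longrightarrow> r v \<in> quasi_measurable omega_space (X v)"
    and ri: "\<And>v x. v \<in> D \<Longrightarrow> x \<in> points (X v) \<Longrightarrow> r v (i v x) = x"
    by metis
  define c where "c = to_nat_on D"
  define f where "f k = (if D = {} then None else Some (from_nat_into D k))" for k
  define I where "I x n = (case prod_decode n of (k, m) \<Rightarrow> (case f k of None \<Rightarrow> unit_clamp 0 | Some v \<Rightarrow> i v (x v) m))" for x n
  define R where "R \<omega> = (\<lambda>v\<in>D. r v (\<lambda>m. \<omega> (prod_encode (c v, m))))" for \<omega> :: omega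
  have fc: "f (c v) = Some v" if "v \<in> D" for v
    using that D by (auto simp: f_def c_def)
  have fD: "v \<in> D" if "f k = Some v" for k v
    using that from_nat_into[of D k] by (auto simp: f_def split: if_splits)
  have "I \<in> quasi_measurable (Pi_space D X) omega_space"
  proof (rule quasi_measurableI)
    fix \<xi> assume \<xi>: "\<xi> \<in> rvars (Pi_space D X)"
    have "(\<lambda>\<omega>. Rep_unit_interval (I (\<xi> \<omega>) n)) \<in> borel_measurable universal_omega" for n
    proof -
      obtain k m where km: "prod_decode n = (k, m)" by fastforce
      show ?thesis
      proof (cases "f k")
        case None
        then show ?thesis by (simp add: I_def km)
      next
        case (Some v)
        then have v: "v \<in> D" by (rule fD)
        have "(\<lambda>\<omega>. i v (\<xi> \<omega> v)) \<in> rvars omega_space"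
          using \<xi> v by (intro quasi_measurable_rvars[OF i[OF v]]) (simp add: rvars_Pi_space)
        then have "(\<lambda>\<omega>. i v (\<xi> \<omega> v)) \<in> universal_omega \<rightarrow>\<^sub>M universal_omega"
          by (simp add: rvars_omega_space)
        from measurable_compose[OF this measurable_universal_omega_borel[OF Rep_unit_interval_measurable]]
        show ?thesis by (simp add: I_def km Some)
      qed
    qed
    then show "(\<lambda>\<omega>. I (\<xi> \<omega>)) \<in> rvars omega_space"
      unfolding rvars_omega_space by (intro measurable_universal_omegaI measurable_borel_omegaI)
  qed simp
  moreover have "R \<in> quasi_measurable omega_space (Pi_space D X)"
  proof (rule quasi_measurable_PiI[OF quasi_universal_omega_space])
    fix v assume v: "v \<in> D"
    have "(\<lambda>\<omega> m. \<omega> (prod_encode (c v, m))) \<in> borel_omega \<rightarrow>\<^sub>M borel_omega"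
      by (rule measurable_borel_omegaI) simp
    then have "(\<lambda>\<omega> m. \<omega> (prod_encode (c v, m))) \<in> universal_omega \<rightarrow>\<^sub>M universal_omega"
      by (intro measurable_universal_omegaI measurable_universal_omega_borel)
    then have "(\<lambda>\<omega> m. \<omega> (prod_encode (c v, m))) \<in> quasi_measurable omega_space omega_space"
      by (intro quasi_measurableI) (auto simp: rvars_omega_space intro: measurable_compose[rotated])
    from quasi_measurable_compose[OF this r[OF v]]
    show "(\<lambda>\<omega>. R \<omega> v) \<in> quasi_measurable omega_space (X v)"
      using v by (simp add: R_def)
  qed (simp add: R_def)
  moreover have "R (I x) = x" if x: "x \<in> points (Pi_space D X)" for x
  proof
    fix v
    show "R (I x) v = x v"
    proof (cases "v \<in> D")
      case True
      then have "(\<lambda>m. I x (prod_encode (c v, m))) = i v (x v)"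
        by (simp add: I_def fc)
      then show ?thesis
        using True x ri[OF True, of "x v"] by (auto simp: R_def points_Pi_space)
    next
      case False
      then show ?thesis using x by (auto simp: R_def points_Pi_space PiE_def extensional_def)
    qed
  qed
  ultimately show ?thesis
    unfolding standard_space_def by blast
qed

section \<open>Causal Bayesian networks\<close>

lemma merge_Pair: "merge I J (x, y) = (\<lambda>i. if i \<in> I then x i else if i \<in> J then y i else undefined)"
  by (simp add: merge_def)

locale standard_network =
  fixes M :: "('n, 'a) bayes_net"
  assumes network: "causal_bayesian_network M"
    and standard: "\<And>v. v \<in> outputs (graph M) \<Longrightarrow> standard_space (node_space M v)"
    and inputs_nonempty: "points (X_space M (inputs (graph M))) \<noteq> {}"
begin

abbreviation "\<V> \<equiv> outputs (graph M)"
abbreviation "\<J> \<equiv> inputs (graph M)"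
abbreviation "\<N> \<equiv> nodes (graph M)"
abbreviation "pa \<equiv> Pa (graph M)"
abbreviation "XS \<equiv> X_space M"
abbreviation "IS D \<equiv> induced (X_space M D)"
abbreviation "XN \<equiv> node_space M"
abbreviation "mech \<equiv> mechanism M"

lemma dag: "CDAG (graph M)"
  using network by (simp add: causal_bayesian_network_def)

lemma V_nodes: "\<V> \<subseteq> \<N>" and J_nodes: "\<J> \<subseteq> \<N>"
  by (auto simp: nodes_def)

lemma pa_nodes: "pa v \<subseteq> \<N>"
  using dag by (auto simp: CDAG_def Pa_def)

lemma finite_nodes: "finite \<N>"
  using dag by (simp add: CDAG_def nodes_def)

lemma node_quasi_universal: "v \<in> \<N> \<Longrightarrow> quasi_universal_space (XN v)"
  using network by (simp add: causal_bayesian_network_def)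

lemma X_quasi_universal: "D \<subseteq> \<N> \<Longrightarrow> quasi_universal_space (XS D)"
  unfolding X_space_def by (intro quasi_universal_Pi_space node_quasi_universal) auto

lemma mechanism_kernel: "v \<in> \<V> \<Longrightarrow> mech v \<in> markov_kernels (XS (pa v)) (XN v)"
  using network by (simp add: causal_bayesian_network_def)

lemma points_X: "points (XS D) = (\<Pi>\<^sub>E v\<in>D. points (XN v))"
  by (simp add: X_space_def points_Pi_space)

text \<open>Induction along the edges: at an output, some parent configuration exists, and the
  mechanism there is the image of a random variable of the node, which has a value. Nonemptiness is
  what turns standardness into a retraction.\<close>

lemma points_node_nonempty: "v \<in> \<N> \<Longrightarrow> points (XN v) \<noteq> {}"
proof -
  have "edges (graph M) \<subseteq> \<N> \<times> \<V>" "finite \<V>"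
    using dag unfolding CDAG_def by blast+
  then have "finite (edges (graph M))"
    by (rule finite_subset[OF _ finite_cartesian_product[OF finite_nodes]])
  then have "wf (edges (graph M))"
    using dag by (simp add: CDAG_def finite_acyclic_wf)
  then show "v \<in> \<N> \<Longrightarrow> points (XN v) \<noteq> {}"
  proof (induction v rule: wf_induct_rule)
    case (less v)
    show ?case
    proof (cases "v \<in> \<J>")
      case True
      then show ?thesis using inputs_nonempty by (auto simp: points_X PiE_eq_empty_iff)
    next
      case False
      then have v: "v \<in> \<V>" using less.prems by (simp add: nodes_def)
      have "points (XS (pa v)) \<noteq> {}"
        using less.IH pa_nodes by (auto simp: points_X PiE_eq_empty_iff Pa_def)
      then obtain x where "x \<in> points (XS (pa v))" by blast
      from markov_kernels_points[OF mechanism_kernel[OF v] this]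
      obtain \<xi> where "\<xi> \<in> rvars (XN v)" by (rule points_P_spaceE)
      from rvars_points[OF node_quasi_universal[OF less.prems] this] show ?thesis by blast
    qed
  qed
qed

lemma points_X_nonempty: "D \<subseteq> \<N> \<Longrightarrow> points (XS D) \<noteq> {}"
  using points_node_nonempty by (auto simp: points_X PiE_eq_empty_iff)

lemma X_standard: "D \<subseteq> \<V> \<Longrightarrow> standard_space (XS D)"
  unfolding X_space_def using finite_nodes V_nodes
  by (intro standard_Pi_space standard node_quasi_universal points_node_nonempty)
    (auto intro: countable_finite finite_subset)

lemma X_extensional: "x \<in> points (XS D) \<Longrightarrow> v \<notin> D \<Longrightarrow> x v = undefined"
  by (auto simp: points_X PiE_def extensional_def)

lemma quasi_measurable_component_X: "v \<in> D \<Longrightarrow> (\<lambda>x. x v) \<in> quasi_measurable (XS D) (XN v)"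
  unfolding X_space_def by (rule quasi_measurable_component)

lemma quasi_measurable_XI:
  assumes "quasi_universal_space Z" "\<And>z. z \<in> points Z \<Longrightarrow> f z \<in> extensional D"
    "\<And>v. v \<in> D \<Longrightarrow> (\<lambda>z. f z v) \<in> quasi_measurable Z (XN v)"
  shows "f \<in> quasi_measurable Z (XS D)"
  unfolding X_space_def using assms by (rule quasi_measurable_PiI)

lemma quasi_measurable_restrict: "D \<subseteq> E \<Longrightarrow> E \<subseteq> \<N> \<Longrightarrow> (\<lambda>w. restrict w D) \<in> quasi_measurable (XS E) (XS D)"
  by (rule quasi_measurable_XI) (auto intro: X_quasi_universal quasi_measurable_component_X)

lemma quasi_measurable_merge:
  assumes "A \<subseteq> \<N>" "S \<subseteq> \<N>"
  shows "merge A S \<in> quasi_measurable (prod_space (XS A) (XS S)) (XS (A \<union> S))"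
proof (rule quasi_measurable_XI)
  fix v assume v: "v \<in> A \<union> S"
  show "(\<lambda>p. merge A S p v) \<in> quasi_measurable (prod_space (XS A) (XS S)) (XN v)"
  proof (cases "v \<in> A")
    case True
    then show ?thesis
      using quasi_measurable_compose[OF quasi_measurable_fst quasi_measurable_component_X[OF True]]
      by (simp add: merge_def split_beta')
  next
    case False
    then have "v \<in> S" using v by simp
    with False show ?thesis
      using quasi_measurable_compose[OF quasi_measurable_snd quasi_measurable_component_X[OF \<open>v \<in> S\<close>]]
      by (simp add: merge_def split_beta')
  qed
qed (auto intro!: quasi_universal_prod_space X_quasi_universal assms simp: merge_def extensional_def)

lemma quasi_measurable_upd:
  assumes "U \<subseteq> \<N>" "v \<in> \<N>"
  shows "(\<lambda>p. (snd p)(v := fst p)) \<in> quasi_measurable (prod_space (XN v) (XS U)) (XS (insert v U))"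
proof (rule quasi_measurable_XI)
  fix u assume u: "u \<in> insert v U"
  show "(\<lambda>p. ((snd p)(v := fst p)) u) \<in> quasi_measurable (prod_space (XN v) (XS U)) (XN u)"
  proof (cases "u = v")
    case True
    then show ?thesis using quasi_measurable_fst by simp
  next
    case False
    with u have "u \<in> U" by simp
    with False show ?thesis
      using quasi_measurable_compose[OF quasi_measurable_snd quasi_measurable_component_X[OF \<open>u \<in> U\<close>]] by simp
  qed
qed (auto intro!: quasi_universal_prod_space X_quasi_universal node_quasi_universal assms X_extensional simp: extensional_def)

lemmas measurable_X = measurable_quasi_measurable[OF X_quasi_universal X_quasi_universal]

lemma mechanism_restrict:
  assumes "v \<in> \<V>" "pa v \<subseteq> U" "U \<subseteq> \<N>"
  shows "(\<lambda>w. mech v (restrict w (pa v))) \<in> markov_kernels (XS U) (XN v)"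
  using quasi_measurable_restrict[OF assms(2,3)] mechanism_kernel[OF assms(1)] by (rule markov_kernels_compose)

definition step :: "'n \<Rightarrow> 'n set \<Rightarrow> ('n \<Rightarrow> 'a) \<Rightarrow> ('n \<Rightarrow> 'a) measure" where
  "step v U w = distr (mech v (restrict w (pa v))) (IS (insert v U)) (\<lambda>x. w(v := x))"

lemma measurable_step:
  assumes "v \<in> \<V>" "pa v \<subseteq> U" "U \<subseteq> \<N>"
  shows "step v U \<in> IS U \<rightarrow>\<^sub>M prob_algebra (IS (insert v U))"
proof -
  have "v \<in> \<N>" "insert v U \<subseteq> \<N>" using assms V_nodes by auto
  then show ?thesis
    using markov_kernels_push_measurable[OF X_quasi_universal node_quasi_universal X_quasi_universal
        mechanism_restrict[OF assms] quasi_measurable_upd] assms(3)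
    by (simp add: step_def[abs_def])
qed

text \<open>The recursion of \<open>kernel_along\<close> with the input values kept in the state, so
  that a mechanism reads a single configuration and each node contributes one bind.\<close>

fun law :: "'n list \<Rightarrow> ('n \<Rightarrow> 'a) \<Rightarrow> ('n \<Rightarrow> 'a) measure" where
  "law [] xJ = return (IS \<J>) xJ"
| "law (v # us) xJ = law us xJ \<bind> step v (set us \<union> \<J>)"

text \<open>The head of the list is the node added last, as in \<open>kernel_along\<close>.\<close>

fun parents_first :: "'n list \<Rightarrow> bool" where
  "parents_first [] = True"
| "parents_first (v # us) \<longleftrightarrow> parents_first us \<and> v \<in> \<V> \<and> v \<notin> set us \<and> pa v \<subseteq> set us \<union> \<J>"

lemma parents_first_outputs: "parents_first us \<Longrightarrow> set us \<subseteq> \<V>"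
  by (induction us) auto

lemma parents_first_nodes: "parents_first us \<Longrightarrow> set us \<union> \<J> \<subseteq> \<N>"
  using parents_first_outputs V_nodes J_nodes by blast

lemma parents_first_rev:
  assumes "topological_order (graph M) vs"
  shows "parents_first (rev vs)"
proof -
  note vs = assms[unfolded topological_order_def]
  have "parents_first (rev (take k vs))" if "k \<le> length vs" for k
    using that
  proof (induction k)
    case (Suc k)
    then have k: "k < length vs" by simp
    have "pa (vs ! k) \<subseteq> set (take k vs) \<union> \<J>"
    proof
      fix w assume w: "w \<in> pa (vs ! k)"
      show "w \<in> set (take k vs) \<union> \<J>"
      proof (cases "w \<in> \<J>")
        case False
        then have "w \<in> set vs" using w pa_nodes vs by (auto simp: nodes_def)
        then obtain j where j: "j < length vs" "w = vs ! j" by (auto simp: in_set_conv_nth)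
        have "\<not> k < j" using vs w j by (auto simp: Pa_def)
        moreover have "j \<noteq> k"
          using w j dag by (auto simp: Pa_def CDAG_def acyclic_def)
        ultimately have "j < k" by simp
        then show ?thesis using j k by (auto simp: in_set_conv_nth)
      qed simp
    qed
    moreover have "vs ! k \<notin> set (take k vs)"
      using vs k by (auto simp: in_set_conv_nth nth_eq_iff_index_eq)
    moreover have "vs ! k \<in> \<V>"
      using vs k nth_mem by blast
    ultimately show ?case
      using Suc k by (simp add: take_Suc_conv_app_nth)
  qed simp
  from this[of "length vs"] show ?thesis by simp
qed

lemma law_prob:
  assumes "parents_first us" "xJ \<in> points (XS \<J>)"
  shows "law us xJ \<in> space (prob_algebra (IS (set us \<union> \<J>)))"
  using assms(1)
proof (induction us)
  case Nil
  then show ?case using assms(2) by (simp add: space_prob_algebra prob_space_return)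
next
  case (Cons v us)
  then show ?case
    using bind_prob_algebra[OF Cons.IH measurable_step[of v "set us \<union> \<J>"]] parents_first_nodes[of us] by simp
qed

text \<open>Merging the fixed inputs into the configuration commutes with adding a node, so each
  kernel product becomes one \<open>step\<close>. The first claim is carried along because rewriting
  the product as a bind needs it.\<close>

lemma kernel_along_law:
  assumes "parents_first us" "xJ \<in> points (XS \<J>)"
  shows "kernel_along M us xJ \<in> space (prob_algebra (IS (set us)))"
    and "distr (kernel_along M us xJ) (IS (set us \<union> \<J>)) (\<lambda>y. merge (set us) \<J> (y, xJ)) = law us xJ"
  using assms(1)
proof (induction us)
  case Nil
  have u: "(\<lambda>_. undefined) \<in> points (XS {})" by (simp add: points_X)
  {
    case 1
    show ?case using u by (simp add: space_prob_algebra prob_space_return)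
  next
    case 2
    have "(\<lambda>y. merge {} \<J> (y, xJ)) \<in> IS {} \<rightarrow>\<^sub>M IS \<J>"
    proof (rule measurable_X)
      have "(\<lambda>y. (y, xJ)) \<in> quasi_measurable (XS {}) (prod_space (XS {}) (XS \<J>))"
        by (intro quasi_measurable_Pair quasi_measurable_ident quasi_measurable_const X_quasi_universal J_nodes assms(2))
      from quasi_measurable_compose[OF this quasi_measurable_merge] J_nodes
      show "(\<lambda>y. merge {} \<J> (y, xJ)) \<in> quasi_measurable (XS {}) (XS \<J>)" by simp
    qed (use J_nodes in auto)
    moreover have "merge {} \<J> ((\<lambda>_. undefined), xJ) = xJ"
      using X_extensional[OF assms(2)] by (auto simp: merge_Pair)
    ultimately show ?case
      using u by (simp add: distr_return)
  }
next
  case (Cons v us)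
  let ?U = "set us" and ?W = "set us \<union> \<J>"
  let ?L = "kernel_along M us xJ"
  {
    assume pf: "parents_first (v # us)"
    then have us: "parents_first us" and v: "v \<in> \<V>" "v \<notin> ?U" "pa v \<subseteq> ?W" by auto
    have vN: "v \<in> \<N>" using v V_nodes by blast
    have W: "?W \<subseteq> \<N>" "?U \<subseteq> \<N>" "insert v ?U \<subseteq> \<N>" "insert v ?W \<subseteq> \<N>"
      using parents_first_nodes[OF us] vN by auto
    have L: "?L \<in> space (prob_algebra (IS ?U))" by (rule Cons.IH(1)[OF us])
    have pairJ: "(\<lambda>y. (y, xJ)) \<in> quasi_measurable (XS D) (prod_space (XS D) (XS \<J>))" for D
      by (intro quasi_measurable_Pair quasi_measurable_ident quasi_measurable_const X_quasi_universal J_nodes assms(2))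
    have mg: "(\<lambda>y. merge D \<J> (y, xJ)) \<in> quasi_measurable (XS D) (XS (D \<union> \<J>))" if "D \<subseteq> \<N>" for D
      using quasi_measurable_compose[OF pairJ quasi_measurable_merge[OF that J_nodes]] .
    let ?K = "\<lambda>y. mech v (restrict (merge ?U \<J> (y, xJ)) (pa v))"
    have K: "?K \<in> markov_kernels (XS ?U) (XN v)"
      using markov_kernels_compose[OF mg[OF W(2)] mechanism_restrict[OF v(1,3) W(1)]] .
    let ?P = "prod_space (XN v) (XS ?U)"
    have qP: "quasi_universal_space ?P"
      by (intro quasi_universal_prod_space node_quasi_universal X_quasi_universal vN W)
    have upd: "(\<lambda>p. (snd p)(v := fst p)) \<in> induced ?P \<rightarrow>\<^sub>M IS (insert v ?U)"
      by (intro measurable_quasi_measurable qP X_quasi_universal quasi_measurable_upd vN W)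
    have m1: "(\<lambda>y. distr (?K y) (induced ?P) (\<lambda>x. (x, y))) \<in> IS ?U \<rightarrow>\<^sub>M prob_algebra (induced ?P)"
      using markov_kernels_push_measurable[OF X_quasi_universal[OF W(2)] node_quasi_universal[OF vN] qP K quasi_measurable_ident] .
    have Kp: "?K y \<in> space (prob_algebra (induced (XN v)))" if "y \<in> points (XS ?U)" for y
      by (rule points_P_space_prob[OF node_quasi_universal[OF vN] markov_kernels_points[OF K that]])
    have pr: "(\<lambda>x. (x, y)) \<in> induced (XN v) \<rightarrow>\<^sub>M induced ?P" if "y \<in> points (XS ?U)" for y
      by (intro measurable_quasi_measurable node_quasi_universal vN qP quasi_measurable_Pair quasi_measurable_ident
          quasi_measurable_const X_quasi_universal W that)
    have upy: "(\<lambda>x. y(v := x)) \<in> induced (XN v) \<rightarrow>\<^sub>M IS (insert v D)" if "y \<in> points (XS D)" "D \<subseteq> \<N>" for y D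
    proof -
      have "(\<lambda>x. (x, y)) \<in> quasi_measurable (XN v) (prod_space (XN v) (XS D))"
        by (intro quasi_measurable_Pair quasi_measurable_ident quasi_measurable_const X_quasi_universal that)
      from quasi_measurable_compose[OF this quasi_measurable_upd[OF that(2) vN]]
      show ?thesis
        using that vN by (intro measurable_quasi_measurable node_quasi_universal X_quasi_universal) auto
    qed
    have eq: "kernel_along M (v # us) xJ = (?L \<bind> (\<lambda>y. distr (?K y) (IS (insert v ?U)) (\<lambda>x. y(v := x))))"
    proof -
      have "kernel_along M (v # us) xJ = distr (?L \<bind> (\<lambda>y. distr (?K y) (induced ?P) (\<lambda>x. (x, y)))) (IS (insert v ?U)) (\<lambda>p. (snd p)(v := fst p))"
        using L K by (simp add: kernel_prod_eq_bind node_quasi_universal vN X_quasi_universal W split_beta')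
      also have "\<dots> = (?L \<bind> (\<lambda>y. distr (distr (?K y) (induced ?P) (\<lambda>x. (x, y))) (IS (insert v ?U)) (\<lambda>p. (snd p)(v := fst p))))"
        by (rule distr_bind_prob[OF L m1 upd])
      also have "\<dots> = (?L \<bind> (\<lambda>y. distr (?K y) (IS (insert v ?U)) (\<lambda>x. y(v := x))))"
        by (rule bind_cong_prob[OF L]) (simp add: distr_distr_prob[OF Kp pr upd])
      finally show ?thesis .
    qed
    have m2: "(\<lambda>y. distr (?K y) (IS (insert v ?U)) (\<lambda>x. y(v := x))) \<in> IS ?U \<rightarrow>\<^sub>M prob_algebra (IS (insert v ?U))"
      using markov_kernels_push_measurable[OF X_quasi_universal[OF W(2)] node_quasi_universal[OF vN] X_quasi_universal[OF W(3)] K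
          quasi_measurable_upd[OF W(2) vN]] by simp
    have first: "kernel_along M (v # us) xJ \<in> space (prob_algebra (IS (set (v # us))))"
      unfolding eq using bind_prob_algebra[OF L m2] by simp
    have mgU: "(\<lambda>y. merge ?U \<J> (y, xJ)) \<in> IS ?U \<rightarrow>\<^sub>M IS ?W"
      by (rule measurable_X[OF W(2,1) mg[OF W(2)]])
    have mgV: "(\<lambda>y. merge (insert v ?U) \<J> (y, xJ)) \<in> IS (insert v ?U) \<rightarrow>\<^sub>M IS (insert v ?W)"
      using measurable_X[OF W(3) _ mg[OF W(3)]] W(4) by simp
    have "distr (kernel_along M (v # us) xJ) (IS (insert v ?W)) (\<lambda>y. merge (insert v ?U) \<J> (y, xJ)) =
        (?L \<bind> (\<lambda>y. distr (distr (?K y) (IS (insert v ?U)) (\<lambda>x. y(v := x))) (IS (insert v ?W)) (\<lambda>y. merge (insert v ?U) \<J> (y, xJ))))"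
      unfolding eq by (rule distr_bind_prob[OF L m2 mgV])
    also have "\<dots> = (?L \<bind> (\<lambda>y. step v ?W (merge ?U \<J> (y, xJ))))"
    proof (rule bind_cong_prob[OF L])
      fix y assume "y \<in> space (IS ?U)"
      then have y: "y \<in> points (XS ?U)" by simp
      have "merge (insert v ?U) \<J> (y(v := x), xJ) = (merge ?U \<J> (y, xJ))(v := x)" for x
        by (auto simp: merge_Pair)
      then show "distr (distr (?K y) (IS (insert v ?U)) (\<lambda>x. y(v := x))) (IS (insert v ?W)) (\<lambda>y. merge (insert v ?U) \<J> (y, xJ)) =
          step v ?W (merge ?U \<J> (y, xJ))"
        by (simp add: distr_distr_prob[OF Kp[OF y] upy[OF y W(2)] mgV] step_def)
    qed
    also have "\<dots> = (distr ?L (IS ?W) (\<lambda>y. merge ?U \<J> (y, xJ)) \<bind> step v ?W)"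
      by (rule bind_distr_prob[OF L mgU measurable_step[OF v(1,3) W(1)], symmetric])
    also have "\<dots> = law (v # us) xJ"
      by (simp add: Cons.IH(2)[OF us])
    finally have "distr (kernel_along M (v # us) xJ) (IS (set (v # us) \<union> \<J>)) (\<lambda>y. merge (set (v # us)) \<J> (y, xJ)) = law (v # us) xJ"
      by simp
    note first this
  }
  note both = this
  {
    case 1 then show ?case by (rule both(1))
  next
    case 2 then show ?case by (rule both(2))
  }
qed

text \<open>\<open>decomposed A S C Q T\<close> says that under the law \<open>T\<close> of the nodes \<open>A \<union> S\<close>, the kernel \<open>Q\<close> is the
  conditional law of \<open>X\<^sub>A\<close> given \<open>X\<^sub>S\<close>, and it depends on \<open>X\<^sub>S\<close> through \<open>X\<^sub>C\<close> only.\<close>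

definition decomposed ::
  "'n set \<Rightarrow> 'n set \<Rightarrow> 'n set \<Rightarrow> (('n \<Rightarrow> 'a) \<Rightarrow> ('n \<Rightarrow> 'a) measure) \<Rightarrow> ('n \<Rightarrow> 'a) measure \<Rightarrow> bool" where
  "decomposed A S C Q T \<longleftrightarrow>
     (\<exists>\<sigma>\<in>space (prob_algebra (IS S)).
        T = (\<sigma> \<bind> (\<lambda>s. distr (Q (restrict s C)) (IS (A \<union> S)) (\<lambda>a. merge A S (a, s)))))"

end

section \<open>Adding one node to a decomposed law\<close>

locale decomposition_step = standard_network M for M :: "('n, 'a) bayes_net" +
  fixes A S C :: "'n set" and Q :: "('n \<Rightarrow> 'a) \<Rightarrow> ('n \<Rightarrow> 'a) measure" and v :: 'n
  assumes A: "A \<subseteq> outputs (graph M)" and S: "S \<subseteq> nodes (graph M)" and C: "C \<subseteq> S" and AS: "A \<inter> S = {}"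
    and v: "v \<in> outputs (graph M)" "v \<notin> A" "v \<notin> S"
    and Q: "Q \<in> markov_kernels (X_space M C) (X_space M A)"
begin

lemma sub: "A \<subseteq> \<N>" "C \<subseteq> \<N>" "A \<union> S \<subseteq> \<N>" "A \<union> C \<subseteq> \<N>" "insert v S \<subseteq> \<N>" "insert v (A \<union> S) \<subseteq> \<N>" "v \<in> \<N>"
  "insert v A \<subseteq> \<N>" "insert v A \<subseteq> \<V>" "insert v C \<subseteq> \<N>"
  using A S C V_nodes v by auto

lemma Q_prob: "c \<in> points (XS C) \<Longrightarrow> Q c \<in> space (prob_algebra (IS A))"
  by (rule points_P_space_prob[OF X_quasi_universal[OF sub(1)] markov_kernels_points[OF Q]])

lemma restrict_points: "D \<subseteq> E \<Longrightarrow> s \<in> points (XS E) \<Longrightarrow> restrict s D \<in> points (XS D)"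
  by (auto simp: points_X)

lemma kernel_at_S: "(\<lambda>s. Q (restrict s C)) \<in> markov_kernels (XS S) (XS A)"
  by (rule markov_kernels_compose[OF quasi_measurable_restrict[OF C S] Q])

lemma measurable_kernel_at_S:
  "(\<lambda>s. distr (Q (restrict s C)) (IS (A \<union> S)) (\<lambda>a. merge A S (a, s))) \<in> IS S \<rightarrow>\<^sub>M prob_algebra (IS (A \<union> S))"
  using markov_kernels_push_measurable[OF X_quasi_universal[OF S] X_quasi_universal[OF sub(1)] X_quasi_universal[OF sub(3)]
      kernel_at_S quasi_measurable_merge[OF sub(1) S]] .

lemma merge_at:
  assumes "E \<subseteq> \<N>" "s \<in> points (XS E)"
  shows "(\<lambda>a. merge A E (a, s)) \<in> quasi_measurable (XS A) (XS (A \<union> E))"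
proof -
  have "(\<lambda>a. (a, s)) \<in> quasi_measurable (XS A) (prod_space (XS A) (XS E))"
    by (intro quasi_measurable_Pair quasi_measurable_ident quasi_measurable_const X_quasi_universal assms)
  from quasi_measurable_compose[OF this quasi_measurable_merge[OF sub(1) assms(1)]] show ?thesis .
qed

lemma measurable_merge_at:
  assumes "E \<subseteq> \<N>" "s \<in> points (XS E)"
  shows "(\<lambda>a. merge A E (a, s)) \<in> IS A \<rightarrow>\<^sub>M IS (A \<union> E)"
  using assms sub(1) by (intro measurable_X merge_at) auto

lemma bind_step:
  assumes \<sigma>: "\<sigma> \<in> space (prob_algebra (IS S))" and pa: "pa v \<subseteq> A \<union> S"
  shows "((\<sigma> \<bind> (\<lambda>s. distr (Q (restrict s C)) (IS (A \<union> S)) (\<lambda>a. merge A S (a, s)))) \<bind> step v (A \<union> S)) =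
    (\<sigma> \<bind> (\<lambda>s. Q (restrict s C) \<bind> (\<lambda>a. step v (A \<union> S) (merge A S (a, s)))))"
proof -
  note st = measurable_step[OF v(1) pa sub(3)]
  show ?thesis
    unfolding bind_assoc_prob[OF \<sigma> measurable_kernel_at_S st]
  proof (rule bind_cong_prob[OF \<sigma>])
    fix s assume "s \<in> space (IS S)"
    then have s: "s \<in> points (XS S)" by simp
    show "distr (Q (restrict s C)) (IS (A \<union> S)) (\<lambda>a. merge A S (a, s)) \<bind> step v (A \<union> S) =
      Q (restrict s C) \<bind> (\<lambda>a. step v (A \<union> S) (merge A S (a, s)))"
      by (rule bind_distr_prob[OF Q_prob[OF restrict_points[OF C s]] measurable_merge_at[OF S s] st])
  qed
qed

lemma upd_at:
  assumes "E \<subseteq> \<N>" "s \<in> points (XS E)"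
  shows "(\<lambda>x. s(v := x)) \<in> quasi_measurable (XN v) (XS (insert v E))"
proof -
  have "(\<lambda>x. (x, s)) \<in> quasi_measurable (XN v) (prod_space (XN v) (XS E))"
    by (intro quasi_measurable_Pair quasi_measurable_ident quasi_measurable_const X_quasi_universal assms)
  from quasi_measurable_compose[OF this quasi_measurable_upd[OF assms(1) sub(7)]] show ?thesis by simp
qed

lemma measurable_upd_at:
  assumes "E \<subseteq> \<N>" "s \<in> points (XS E)"
  shows "(\<lambda>x. s(v := x)) \<in> induced (XN v) \<rightarrow>\<^sub>M IS (insert v E)"
  using assms sub(7) by (intro measurable_quasi_measurable upd_at node_quasi_universal X_quasi_universal) auto

lemma mech_prob:
  assumes "pa v \<subseteq> E" "E \<subseteq> \<N>" "w \<in> points (XS E)"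
  shows "mech v (restrict w (pa v)) \<in> points (P_space (XN v))" "mech v (restrict w (pa v)) \<in> space (prob_algebra (induced (XN v)))"
proof -
  show 1: "mech v (restrict w (pa v)) \<in> points (P_space (XN v))"
    using markov_kernels_points[OF mechanism_restrict[OF v(1) assms(1,2)] assms(3)] .
  show "mech v (restrict w (pa v)) \<in> space (prob_algebra (induced (XN v)))"
    by (rule points_P_space_prob[OF node_quasi_universal[OF sub(7)] 1])
qed

text \<open>Given the \<open>S\<close>-part, the mechanism of \<open>v\<close> does not see the
  \<open>A\<close>-part, so the two draws can be exchanged by \<open>markov_commute\<close>. If
  \<open>C'\<close> contains \<open>v\<close>, the kernel ignores that coordinate.\<close>

lemma step_in_rest:
  assumes pa: "pa v \<subseteq> S" and C': "C \<subseteq> C'" "C' \<subseteq> insert v S" and T: "decomposed A S C Q T"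
  shows "decomposed A (insert v S) C' (\<lambda>c. Q (restrict c C)) (T \<bind> step v (A \<union> S))"
proof -
  obtain \<sigma> where \<sigma>: "\<sigma> \<in> space (prob_algebra (IS S))"
    and T: "T = (\<sigma> \<bind> (\<lambda>s. distr (Q (restrict s C)) (IS (A \<union> S)) (\<lambda>a. merge A S (a, s))))"
    using T unfolding decomposed_def by blast
  let ?Q' = "\<lambda>c. Q (restrict c C)"
  let ?k = "\<lambda>s. distr (?Q' (restrict s C')) (IS (A \<union> insert v S)) (\<lambda>a. merge A (insert v S) (a, s))"
  have C'N: "C' \<subseteq> \<N>" using C'(2) sub(5) by blast
  have st: "step v S \<in> IS S \<rightarrow>\<^sub>M prob_algebra (IS (insert v S))"
    by (rule measurable_step[OF v(1) pa S])
  have Q': "?Q' \<in> markov_kernels (XS C') (XS A)"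
    by (rule markov_kernels_compose[OF quasi_measurable_restrict[OF C'(1) C'N] Q])
  have "(\<lambda>s. ?Q' (restrict s C')) \<in> markov_kernels (XS (insert v S)) (XS A)"
    by (rule markov_kernels_compose[OF quasi_measurable_restrict[OF C'(2) sub(5)] Q'])
  from markov_kernels_push_measurable[OF X_quasi_universal[OF sub(5)] X_quasi_universal[OF sub(1)] X_quasi_universal this
      quasi_measurable_merge[OF sub(1,5)]]
  have k: "?k \<in> IS (insert v S) \<rightarrow>\<^sub>M prob_algebra (IS (A \<union> insert v S))"
    using sub(6) by simp
  have "T \<bind> step v (A \<union> S) = (\<sigma> \<bind> (\<lambda>s. Q (restrict s C) \<bind> (\<lambda>a. step v (A \<union> S) (merge A S (a, s)))))"
    unfolding T using pa by (intro bind_step \<sigma>) auto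
  also have "\<dots> = (\<sigma> \<bind> (\<lambda>s. step v S s \<bind> ?k))"
  proof (rule bind_cong_prob[OF \<sigma>])
    fix s assume "s \<in> space (IS S)"
    then have s: "s \<in> points (XS S)" by simp
    let ?f = "\<lambda>p. (merge A S (fst p, s))(v := snd p)"
    let ?N = "mech v (restrict s (pa v))"
    have "restrict (merge A S (a, s)) (pa v) = restrict s (pa v)" for a
      using pa AS by (auto simp: merge_Pair restrict_def fun_eq_iff)
    then have "Q (restrict s C) \<bind> (\<lambda>a. step v (A \<union> S) (merge A S (a, s))) =
        Q (restrict s C) \<bind> (\<lambda>a. distr ?N (IS (insert v (A \<union> S))) (\<lambda>x. ?f (a, x)))"
      by (simp add: step_def)
    also have "\<dots> = (?N \<bind> (\<lambda>x. distr (Q (restrict s C)) (IS (insert v (A \<union> S))) (\<lambda>a. ?f (a, x))))"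
    proof (rule markov_commute)
      show "Q (restrict s C) \<in> points (P_space (XS A))"
        by (rule markov_kernels_points[OF Q restrict_points[OF C s]])
      show "?N \<in> points (P_space (XN v))"
        by (rule mech_prob[OF pa S s])
      have "(\<lambda>p. (snd p, merge A S (fst p, s))) \<in> quasi_measurable (prod_space (XS A) (XN v)) (prod_space (XN v) (XS (A \<union> S)))"
        by (intro quasi_measurable_Pair quasi_measurable_snd quasi_measurable_compose[OF quasi_measurable_fst merge_at[OF S s]])
      from quasi_measurable_compose[OF this quasi_measurable_upd[OF sub(3,7)]]
      show "?f \<in> quasi_measurable (prod_space (XS A) (XN v)) (XS (insert v (A \<union> S)))" by simp
    qed (intro X_quasi_universal node_quasi_universal sub)+
    also have "\<dots> = (?N \<bind> (\<lambda>x. ?k (s(v := x))))"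
    proof -
      have "restrict (restrict (s(v := x)) C') C = restrict s C" for x
        using C C' v by (auto simp: restrict_def fun_eq_iff)
      moreover have "(merge A S (a, s))(v := x) = merge A (insert v S) (a, s(v := x))" for a x
        using v by (auto simp: merge_Pair fun_eq_iff)
      ultimately show ?thesis by simp
    qed
    also have "\<dots> = step v S s \<bind> ?k"
      unfolding step_def by (rule bind_distr_prob[OF mech_prob(2)[OF pa S s] measurable_upd_at[OF S s] k, symmetric])
    finally show "Q (restrict s C) \<bind> (\<lambda>a. step v (A \<union> S) (merge A S (a, s))) = step v S s \<bind> ?k" .
  qed
  also have "\<dots> = (\<sigma> \<bind> step v S) \<bind> ?k"
    by (rule bind_assoc_prob[OF \<sigma> st k, symmetric])
  finally show ?thesis
    unfolding decomposed_def using bind_prob_algebra[OF \<sigma> st] by blast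
qed

text \<open>The value \<open>c\<close> is carried along with the draw from \<open>Q c\<close>
  because the mechanism of \<open>v\<close> may read coordinates of both \<open>A\<close> and
  \<open>C\<close>.\<close>

definition joint_at :: "('n \<Rightarrow> 'a) \<Rightarrow> ('n \<Rightarrow> 'a) measure" where
  "joint_at c = distr (Q c) (IS (A \<union> C)) (\<lambda>a. merge A C (a, c))"

lemma measurable_joint_at: "joint_at \<in> IS C \<rightarrow>\<^sub>M prob_algebra (IS (A \<union> C))"
  unfolding joint_at_def[abs_def]
  using markov_kernels_push_measurable[OF X_quasi_universal[OF sub(2)] X_quasi_universal[OF sub(1)] X_quasi_universal[OF sub(4)]
      Q quasi_measurable_merge[OF sub(1,2)]] .

lemma bind_joint_at:
  assumes "c \<in> points (XS C)" "f \<in> IS (A \<union> C) \<rightarrow>\<^sub>M prob_algebra R"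
  shows "joint_at c \<bind> f = Q c \<bind> (\<lambda>a. f (merge A C (a, c)))"
  unfolding joint_at_def by (rule bind_distr_prob[OF Q_prob[OF assms(1)] measurable_merge_at[OF sub(2) assms(1)] assms(2)])

lemma measurable_mech_push:
  assumes pa: "pa v \<subseteq> A \<union> C" and Y: "quasi_universal_space Y"
    and g: "g \<in> quasi_measurable (prod_space (XN v) (XS (A \<union> C))) Y"
  shows "(\<lambda>w. distr (mech v (restrict w (pa v))) (induced Y) (\<lambda>x. g (x, w))) \<in> IS (A \<union> C) \<rightarrow>\<^sub>M prob_algebra (induced Y)"
  by (rule markov_kernels_push_measurable[OF X_quasi_universal[OF sub(4)] node_quasi_universal[OF sub(7)] Y
        mechanism_restrict[OF v(1) pa sub(4)] g])

lemma restrict_merge_pa: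
  assumes "pa v \<subseteq> A \<union> C"
  shows "restrict (merge A S (a, s)) (pa v) = restrict (merge A C (a, restrict s C)) (pa v)"
  using assms C by (auto simp: merge_Pair restrict_def fun_eq_iff)

lemma quasi_measurable_restrict_A:
  "(\<lambda>p. restrict (snd p) A) \<in> quasi_measurable (prod_space (XN v) (XS (A \<union> C))) (XS A)"
  by (rule quasi_measurable_compose[OF quasi_measurable_snd quasi_measurable_restrict]) (use sub in auto)

lemma merge_points: "a \<in> points (XS A) \<Longrightarrow> s \<in> points (XS E) \<Longrightarrow> merge A E (a, s) \<in> points (XS (A \<union> E))"
  by (auto simp: points_X PiE_def extensional_def merge_Pair)

lemma restrict_merge_A: "a \<in> points (XS A) \<Longrightarrow> restrict (merge A E (a, s)) A = a"
  by (auto simp: merge_Pair restrict_def fun_eq_iff X_extensional)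

text \<open>The law of the \<open>S\<close>-part stays; the new kernel first draws the
  \<open>A\<close>-part from \<open>Q c\<close> and then \<open>v\<close> from its mechanism.
  \<open>Q'\<close> is fixed before \<open>T\<close>, so one kernel serves all input values.\<close>

lemma step_in_A:
  assumes pa: "pa v \<subseteq> A \<union> C"
  obtains Q' where "Q' \<in> markov_kernels (XS C) (XS (insert v A))"
    "\<And>T. decomposed A S C Q T \<Longrightarrow> decomposed (insert v A) S C Q' (T \<bind> step v (A \<union> S))"
proof -
  define h where "h w = distr (mech v (restrict w (pa v))) (IS (insert v A)) (\<lambda>x. (restrict w A)(v := x))" for w
  define Q' where "Q' c = joint_at c \<bind> h" for c
  have "(\<lambda>p. (fst p, restrict (snd p) A)) \<in> quasi_measurable (prod_space (XN v) (XS (A \<union> C))) (prod_space (XN v) (XS A))"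
    by (intro quasi_measurable_Pair quasi_measurable_fst quasi_measurable_restrict_A)
  from measurable_mech_push[OF pa X_quasi_universal[OF sub(8)] quasi_measurable_compose[OF this quasi_measurable_upd[OF sub(1,7)]]]
  have h: "h \<in> IS (A \<union> C) \<rightarrow>\<^sub>M prob_algebra (IS (insert v A))"
    by (simp add: h_def[abs_def])
  have "Q' \<in> IS C \<rightarrow>\<^sub>M prob_algebra (IS (insert v A))"
    unfolding Q'_def by (rule measurable_bind_prob_space[OF measurable_joint_at h])
  \<comment> \<open>The composition is known only to be measurable; standardness of the output
    spaces supplies the noise representation.\<close>
  then have Q': "Q' \<in> markov_kernels (XS C) (XS (insert v A))"
    using sub by (intro standard_markov_kernelsI X_quasi_universal X_standard points_X_nonempty) auto
  have pa': "pa v \<subseteq> A \<union> S" using pa C by blast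
  have "decomposed (insert v A) S C Q' (T \<bind> step v (A \<union> S))" if T: "decomposed A S C Q T" for T
  proof -
    obtain \<sigma> where \<sigma>: "\<sigma> \<in> space (prob_algebra (IS S))"
      and T: "T = (\<sigma> \<bind> (\<lambda>s. distr (Q (restrict s C)) (IS (A \<union> S)) (\<lambda>a. merge A S (a, s))))"
      using T unfolding decomposed_def by blast
    have "T \<bind> step v (A \<union> S) = (\<sigma> \<bind> (\<lambda>s. Q (restrict s C) \<bind> (\<lambda>a. step v (A \<union> S) (merge A S (a, s)))))"
      unfolding T by (rule bind_step[OF \<sigma> pa'])
    also have "\<dots> = (\<sigma> \<bind> (\<lambda>s. distr (Q' (restrict s C)) (IS (insert v A \<union> S)) (\<lambda>a. merge (insert v A) S (a, s))))"
    proof (rule bind_cong_prob[OF \<sigma>])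
      fix s assume "s \<in> space (IS S)"
      then have s: "s \<in> points (XS S)" by simp
      note c = restrict_points[OF C s]
      let ?c = "restrict s C"
      have mm: "(\<lambda>a. merge (insert v A) S (a, s)) \<in> IS (insert v A) \<rightarrow>\<^sub>M IS (insert v A \<union> S)"
      proof (rule measurable_X)
        have "(\<lambda>a. (a, s)) \<in> quasi_measurable (XS (insert v A)) (prod_space (XS (insert v A)) (XS S))"
          by (intro quasi_measurable_Pair quasi_measurable_ident quasi_measurable_const X_quasi_universal S s)
        from quasi_measurable_compose[OF this quasi_measurable_merge[OF sub(8) S]]
        show "(\<lambda>a. merge (insert v A) S (a, s)) \<in> quasi_measurable (XS (insert v A)) (XS (insert v A \<union> S))" .
      qed (use sub in auto)
      have "distr (Q' ?c) (IS (insert v A \<union> S)) (\<lambda>a. merge (insert v A) S (a, s)) =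
          joint_at ?c \<bind> (\<lambda>w. distr (h w) (IS (insert v A \<union> S)) (\<lambda>a. merge (insert v A) S (a, s)))"
        unfolding Q'_def using measurable_space[OF measurable_joint_at] c by (intro distr_bind_prob[OF _ h mm]) simp
      also have "\<dots> = Q ?c \<bind> (\<lambda>a. distr (h (merge A C (a, ?c))) (IS (insert v A \<union> S)) (\<lambda>a. merge (insert v A) S (a, s)))"
        by (rule bind_joint_at[OF c measurable_compose[OF h measurable_distr_prob_space[OF mm]]])
      also have "\<dots> = Q ?c \<bind> (\<lambda>a. step v (A \<union> S) (merge A S (a, s)))"
      proof (rule bind_cong_prob[OF Q_prob[OF c]])
        fix a assume "a \<in> space (IS A)"
        then have a: "a \<in> points (XS A)" by simp
        have "merge (insert v A) S (a(v := x), s) = (merge A S (a, s))(v := x)" for x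
          using v by (auto simp: merge_Pair fun_eq_iff)
        then show "distr (h (merge A C (a, ?c))) (IS (insert v A \<union> S)) (\<lambda>a. merge (insert v A) S (a, s)) = step v (A \<union> S) (merge A S (a, s))"
          unfolding h_def restrict_merge_A[OF a] step_def restrict_merge_pa[OF pa]
          by (subst distr_distr_prob[OF mech_prob(2)[OF pa sub(4) merge_points[OF a c]] measurable_upd_at[OF sub(1) a] mm]) simp
      qed
      finally show "Q ?c \<bind> (\<lambda>a. step v (A \<union> S) (merge A S (a, s))) =
          distr (Q' ?c) (IS (insert v A \<union> S)) (\<lambda>a. merge (insert v A) S (a, s))" by simp
    qed
    finally show ?thesis
      unfolding decomposed_def using \<sigma> by blast
  qed
  with Q' show thesis by (rule that)
qed

text \<open>\<open>G c\<close> is the joint law of the \<open>A\<close>-part and of \<open>v\<close>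
  when the \<open>C\<close>-part is \<open>c\<close>. Splitting it along \<open>v\<close>, with
  \<open>c\<close> as a parameter, moves \<open>v\<close> into the conditioning set. The splitting
  is an identity for every \<open>c\<close> and does not involve \<open>T\<close>, so no null set
  has to be matched with the law of the \<open>S\<close>-part.\<close>

lemma step_in_C:
  assumes pa: "pa v \<subseteq> A \<union> C"
  obtains Q' where "Q' \<in> markov_kernels (XS (insert v C)) (XS A)"
    "\<And>T. decomposed A S C Q T \<Longrightarrow> decomposed A (insert v S) (insert v C) Q' (T \<bind> step v (A \<union> S))"
proof -
  let ?P = "prod_space (XS A) (XN v)"
  have qP: "quasi_universal_space ?P" and qA: "quasi_universal_space (XS A)" and qv: "quasi_universal_space (XN v)"
    by (intro quasi_universal_prod_space X_quasi_universal node_quasi_universal sub)+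
  have msnd: "snd \<in> induced ?P \<rightarrow>\<^sub>M induced (XN v)"
    by (rule measurable_quasi_measurable[OF qP qv quasi_measurable_snd])
  define h where "h w = distr (mech v (restrict w (pa v))) (induced ?P) (\<lambda>x. (restrict w A, x))" for w
  define G where "G c = joint_at c \<bind> h" for c
  have "(\<lambda>p. (restrict (snd p) A, fst p)) \<in> quasi_measurable (prod_space (XN v) (XS (A \<union> C))) ?P"
    by (intro quasi_measurable_Pair quasi_measurable_fst quasi_measurable_restrict_A)
  from measurable_mech_push[OF pa qP this]
  have h: "h \<in> IS (A \<union> C) \<rightarrow>\<^sub>M prob_algebra (induced ?P)"
    by (simp add: h_def[abs_def])
  have G: "G \<in> IS C \<rightarrow>\<^sub>M prob_algebra (induced ?P)"
    unfolding G_def by (rule measurable_bind_prob_space[OF measurable_joint_at h])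
  have Gp: "G c \<in> space (prob_algebra (induced ?P))" if "c \<in> points (XS C)" for c
    using measurable_space[OF G] that by simp
  obtain Q0 where Q0: "Q0 \<in> markov_kernels (prod_space (XN v) (XS C)) (XS A)"
    "\<And>c. c \<in> points (XS C) \<Longrightarrow> G c = distr (G c) (induced (XN v)) snd \<bind> (\<lambda>x. distr (Q0 (x, c)) (induced ?P) (\<lambda>a. (a, x)))"
    using standard_markov_disintegration[OF X_quasi_universal[OF sub(2)] qA X_standard[OF A] points_X_nonempty[OF sub(1)]
        qv standard[OF v(1)] points_node_nonempty[OF sub(7)] G] by blast
  define Q' where "Q' c = Q0 (c v, restrict c C)" for c
  have "(\<lambda>c. (c v, restrict c C)) \<in> quasi_measurable (XS (insert v C)) (prod_space (XN v) (XS C))"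
    using sub by (intro quasi_measurable_Pair quasi_measurable_component_X quasi_measurable_restrict) auto
  from markov_kernels_compose[OF this Q0(1)]
  have Q': "Q' \<in> markov_kernels (XS (insert v C)) (XS A)"
    by (simp add: Q'_def[abs_def])
  have pa': "pa v \<subseteq> A \<union> S" using pa C by blast
  have "decomposed A (insert v S) (insert v C) Q' (T \<bind> step v (A \<union> S))" if T: "decomposed A S C Q T" for T
  proof -
    obtain \<sigma> where \<sigma>: "\<sigma> \<in> space (prob_algebra (IS S))"
      and T: "T = (\<sigma> \<bind> (\<lambda>s. distr (Q (restrict s C)) (IS (A \<union> S)) (\<lambda>a. merge A S (a, s))))"
      using T unfolding decomposed_def by blast
    let ?k = "\<lambda>s. distr (Q' (restrict s (insert v C))) (IS (A \<union> insert v S)) (\<lambda>a. merge A (insert v S) (a, s))"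
    have iC: "insert v C \<subseteq> insert v S" using C by blast
    have "(\<lambda>s. Q' (restrict s (insert v C))) \<in> markov_kernels (XS (insert v S)) (XS A)"
      by (rule markov_kernels_compose[OF quasi_measurable_restrict[OF iC sub(5)] Q'])
    from markov_kernels_push_measurable[OF X_quasi_universal[OF sub(5)] qA X_quasi_universal this quasi_measurable_merge[OF sub(1,5)]]
    have k: "?k \<in> IS (insert v S) \<rightarrow>\<^sub>M prob_algebra (IS (A \<union> insert v S))"
      using sub(6) by simp
    \<comment> \<open>The new law of the \<open>S\<close>-part draws \<open>v\<close> from its
      marginal under \<open>G\<close>, that is, with the \<open>A\<close>-part integrated
      out.\<close>
    define \<tau> where "\<tau> s = distr (distr (G (restrict s C)) (induced (XN v)) snd) (IS (insert v S)) (\<lambda>x. s(v := x))" for s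
    have \<tau>: "\<tau> \<in> IS S \<rightarrow>\<^sub>M prob_algebra (IS (insert v S))"
    proof -
      have "(\<lambda>s. distr (G (restrict s C)) (induced (XN v)) snd) \<in> IS S \<rightarrow>\<^sub>M prob_algebra (induced (XN v))"
        by (rule measurable_compose[OF measurable_compose[OF measurable_X[OF S sub(2) quasi_measurable_restrict[OF C S]] G]
              measurable_distr_prob_space[OF msnd]])
      \<comment> \<open>The push-forward that inserts the draw into \<open>s\<close> is available
        for Markov kernels; standardness of the space of \<open>v\<close> makes this measurable
        family one.\<close>
      then have "(\<lambda>s. distr (G (restrict s C)) (induced (XN v)) snd) \<in> markov_kernels (XS S) (XN v)"
        by (intro standard_markov_kernelsI X_quasi_universal S qv standard v points_node_nonempty sub)
      from markov_kernels_push_measurable[OF X_quasi_universal[OF S] qv X_quasi_universal[OF sub(5)] this quasi_measurable_upd[OF S sub(7)]]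
      show ?thesis by (simp add: \<tau>_def[abs_def])
    qed
    have "T \<bind> step v (A \<union> S) = (\<sigma> \<bind> (\<lambda>s. Q (restrict s C) \<bind> (\<lambda>a. step v (A \<union> S) (merge A S (a, s)))))"
      unfolding T by (rule bind_step[OF \<sigma> pa'])
    also have "\<dots> = (\<sigma> \<bind> (\<lambda>s. \<tau> s \<bind> ?k))"
    proof (rule bind_cong_prob[OF \<sigma>])
      fix s assume "s \<in> space (IS S)"
      then have s: "s \<in> points (XS S)" by simp
      note c = restrict_points[OF C s]
      let ?c = "restrict s C"
      let ?f = "\<lambda>p. (merge A S (fst p, s))(v := snd p)"
      have "(\<lambda>p. (snd p, merge A S (fst p, s))) \<in> quasi_measurable ?P (prod_space (XN v) (XS (A \<union> S)))"
        by (intro quasi_measurable_Pair quasi_measurable_snd quasi_measurable_compose[OF quasi_measurable_fst merge_at[OF S s]])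
      from quasi_measurable_compose[OF this quasi_measurable_upd[OF sub(3,7)]]
      have f: "?f \<in> induced ?P \<rightarrow>\<^sub>M IS (insert v (A \<union> S))"
        by (intro measurable_quasi_measurable qP X_quasi_universal sub) simp
      have jp: "joint_at ?c \<in> space (prob_algebra (IS (A \<union> C)))"
        using measurable_space[OF measurable_joint_at] c by simp
      have GY: "distr (G ?c) (induced (XN v)) snd \<in> space (prob_algebra (induced (XN v)))"
        by (rule distr_in_prob_algebra[OF Gp[OF c] msnd])
      have pairv: "(\<lambda>x. (x, ?c)) \<in> quasi_measurable (XN v) (prod_space (XN v) (XS C))"
        by (intro quasi_measurable_Pair quasi_measurable_ident quasi_measurable_const X_quasi_universal sub c)
      note Q0c = markov_kernels_compose[OF pairv Q0(1)]
      note Q0m = markov_kernels_push_measurable[OF qv qA qP Q0c quasi_measurable_ident]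
      have Q0p: "Q0 (x, ?c) \<in> space (prob_algebra (IS A))" if "x \<in> points (XN v)" for x
        by (rule points_P_space_prob[OF qA markov_kernels_points[OF Q0c that]])
      have prx: "(\<lambda>a. (a, x)) \<in> IS A \<rightarrow>\<^sub>M induced ?P" if "x \<in> points (XN v)" for x
        by (intro measurable_quasi_measurable qA qP quasi_measurable_Pair quasi_measurable_ident quasi_measurable_const qv that)
      have "Q ?c \<bind> (\<lambda>a. step v (A \<union> S) (merge A S (a, s))) = Q ?c \<bind> (\<lambda>a. distr (h (merge A C (a, ?c))) (IS (insert v (A \<union> S))) ?f)"
      proof (rule bind_cong_prob[OF Q_prob[OF c]])
        fix a assume "a \<in> space (IS A)"
        then have a: "a \<in> points (XS A)" by simp
        have pra: "(\<lambda>x. (a, x)) \<in> induced (XN v) \<rightarrow>\<^sub>M induced ?P"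
          by (intro measurable_quasi_measurable qv qP quasi_measurable_Pair quasi_measurable_ident quasi_measurable_const qA a)
        show "step v (A \<union> S) (merge A S (a, s)) = distr (h (merge A C (a, ?c))) (IS (insert v (A \<union> S))) ?f"
          unfolding h_def restrict_merge_A[OF a] step_def restrict_merge_pa[OF pa]
          by (subst distr_distr_prob[OF mech_prob(2)[OF pa sub(4) merge_points[OF a c]] pra f]) simp
      qed
      also have "\<dots> = joint_at ?c \<bind> (\<lambda>w. distr (h w) (IS (insert v (A \<union> S))) ?f)"
        by (rule bind_joint_at[OF c measurable_compose[OF h measurable_distr_prob_space[OF f]], symmetric])
      also have "\<dots> = distr (G ?c) (IS (insert v (A \<union> S))) ?f"
        unfolding G_def by (rule distr_bind_prob[OF jp h f, symmetric])
      also have "\<dots> = distr (distr (G ?c) (induced (XN v)) snd \<bind> (\<lambda>x. distr (Q0 (x, ?c)) (induced ?P) (\<lambda>a. (a, x)))) (IS (insert v (A \<union> S))) ?f"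
        using Q0(2)[OF c] by simp
      also have "\<dots> = distr (G ?c) (induced (XN v)) snd \<bind> (\<lambda>x. distr (distr (Q0 (x, ?c)) (induced ?P) (\<lambda>a. (a, x))) (IS (insert v (A \<union> S))) ?f)"
        by (rule distr_bind_prob[OF GY Q0m f])
      also have "\<dots> = distr (G ?c) (induced (XN v)) snd \<bind> (\<lambda>x. ?k (s(v := x)))"
      proof (rule bind_cong_prob[OF GY])
        fix x assume "x \<in> space (induced (XN v))"
        then have x: "x \<in> points (XN v)" by simp
        have "Q' (restrict (s(v := x)) (insert v C)) = Q0 (x, ?c)"
        proof -
          have "restrict (restrict (s(v := x)) (insert v C)) C = ?c"
            using C v by (auto simp: restrict_def fun_eq_iff)
          then show ?thesis by (simp add: Q'_def)
        qed
        moreover have "(merge A S (a, s))(v := x) = merge A (insert v S) (a, s(v := x))" for a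
          using v by (auto simp: merge_Pair fun_eq_iff)
        ultimately show "distr (distr (Q0 (x, ?c)) (induced ?P) (\<lambda>a. (a, x))) (IS (insert v (A \<union> S))) ?f = ?k (s(v := x))"
          by (simp add: distr_distr_prob[OF Q0p[OF x] prx[OF x] f])
      qed
      also have "\<dots> = \<tau> s \<bind> ?k"
        unfolding \<tau>_def by (rule bind_distr_prob[OF GY measurable_upd_at[OF S s] k, symmetric])
      finally show "Q ?c \<bind> (\<lambda>a. step v (A \<union> S) (merge A S (a, s))) = \<tau> s \<bind> ?k" .
    qed
    also have "\<dots> = (\<sigma> \<bind> \<tau>) \<bind> ?k"
      by (rule bind_assoc_prob[OF \<sigma> \<tau> k, symmetric])
    finally show ?thesis
      unfolding decomposed_def using bind_prob_algebra[OF \<sigma> \<tau>] by blast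
  qed
  with Q' show thesis by (rule that)
qed

end

section \<open>Separation by walks\<close>

text \<open>The negation of \<open>blocked\<close>, apart from the condition at the last node. With
  a free end, walks can grow node by node and pass through colliders in \<open>C\<close>.\<close>

definition active_walk :: "'n cdgraph \<Rightarrow> 'n set \<Rightarrow> 'n set \<Rightarrow> 'n list \<Rightarrow> bool" where
  "active_walk G A C \<pi> \<longleftrightarrow> walk G \<pi> \<and> hd \<pi> \<in> A \<and> hd \<pi> \<notin> C \<and>
     (\<forall>k. Suc (Suc k) < length \<pi> \<longrightarrow>
        \<not> (non_collider G (\<pi> ! k) (\<pi> ! Suc k) (\<pi> ! Suc (Suc k)) \<and> \<pi> ! Suc k \<in> C) \<and>
        \<not> (collider G (\<pi> ! k) (\<pi> ! Suc k) (\<pi> ! Suc (Suc k)) \<and> \<pi> ! Suc k \<notin> Anc G C))"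

lemma CDAG_edge_asym:
  assumes "CDAG G" "(u, w) \<in> edges G"
  shows "(w, u) \<notin> edges G"
proof
  assume "(w, u) \<in> edges G"
  then have "(u, u) \<in> (edges G)\<^sup>+" using assms(2) by (rule trancl_into_trancl[OF r_into_trancl, rotated])
  then show False using assms(1) by (simp add: CDAG_def acyclic_def)
qed

text \<open>Only the triple centred at the old end is new. A one-node walk has no such triple, which
  is why \<open>triple\<close> speaks about decompositions of the list.\<close>

lemma active_walk_append:
  assumes \<pi>: "active_walk G A C \<pi>" and w: "w \<in> nodes G" "(last \<pi>, w) \<in> edges G \<or> (w, last \<pi>) \<in> edges G"
    and triple: "\<And>p \<rho>. \<pi> = \<rho> @ [p, last \<pi>] \<Longrightarrow>
      \<not> (non_collider G p (last \<pi>) w \<and> last \<pi> \<in> C) \<and> \<not> (collider G p (last \<pi>) w \<and> last \<pi> \<notin> Anc G C)"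
  shows "active_walk G A C (\<pi> @ [w])"
proof -
  have ne: "\<pi> \<noteq> []" and wk: "walk G \<pi>" using \<pi> by (auto simp: active_walk_def walk_def)
  have "walk G (\<pi> @ [w])"
    unfolding walk_def
  proof (intro conjI allI impI)
    show "set (\<pi> @ [w]) \<subseteq> nodes G" using wk w by (auto simp: walk_def)
    fix k assume k: "Suc k < length (\<pi> @ [w])"
    show "((\<pi> @ [w]) ! k, (\<pi> @ [w]) ! Suc k) \<in> edges G \<or> ((\<pi> @ [w]) ! Suc k, (\<pi> @ [w]) ! k) \<in> edges G"
    proof (cases "Suc k < length \<pi>")
      case True
      then show ?thesis using wk by (simp add: walk_def nth_append)
    next
      case False
      with k have len: "length \<pi> = Suc k" by simp
      then have "\<pi> ! k = last \<pi>" using ne by (simp add: last_conv_nth)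
      then show ?thesis using w(2) len by (simp add: nth_append)
    qed
  qed simp
  moreover have "\<not> (non_collider G ((\<pi> @ [w]) ! k) ((\<pi> @ [w]) ! Suc k) ((\<pi> @ [w]) ! Suc (Suc k)) \<and> (\<pi> @ [w]) ! Suc k \<in> C) \<and>
      \<not> (collider G ((\<pi> @ [w]) ! k) ((\<pi> @ [w]) ! Suc k) ((\<pi> @ [w]) ! Suc (Suc k)) \<and> (\<pi> @ [w]) ! Suc k \<notin> Anc G C)"
    if k: "Suc (Suc k) < length (\<pi> @ [w])" for k
  proof (cases "Suc (Suc k) < length \<pi>")
    case True
    then show ?thesis using \<pi> by (simp add: active_walk_def nth_append)
  next
    case False
    with k have len: "length \<pi> = Suc (Suc k)" by simp
    have "\<pi> = take k \<pi> @ [\<pi> ! k, \<pi> ! Suc k]"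
      using len by (intro nth_equalityI) (auto simp: nth_append less_Suc_eq)
    moreover have "\<pi> ! Suc k = last \<pi>" using len ne by (simp add: last_conv_nth)
    ultimately have "\<pi> = take k \<pi> @ [\<pi> ! k, last \<pi>]" by simp
    from triple[OF this] show ?thesis
      using len \<open>\<pi> ! Suc k = last \<pi>\<close> by (simp add: nth_append)
  qed
  ultimately show ?thesis
    using \<pi> ne by (simp add: active_walk_def)
qed

definition reachable :: "'n cdgraph \<Rightarrow> 'n set \<Rightarrow> 'n set \<Rightarrow> 'n \<Rightarrow> bool" where
  "reachable G A C u \<longleftrightarrow> (\<exists>\<pi>. active_walk G A C \<pi> \<and> last \<pi> = u)"

text \<open>The last edge of the walk points away from its end, so that the walk can be continued to a
  parent without creating a collider.\<close>

definition reachable_out :: "'n cdgraph \<Rightarrow> 'n set \<Rightarrow> 'n set \<Rightarrow> 'n \<Rightarrow> bool" where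
  "reachable_out G A C u \<longleftrightarrow>
     (\<exists>\<pi>. active_walk G A C \<pi> \<and> last \<pi> = u \<and> (\<forall>\<rho> p. \<pi> = \<rho> @ [p, u] \<longrightarrow> (u, p) \<in> edges G))"

locale separation =
  fixes G :: "'n cdgraph" and A B C :: "'n set"
  assumes dag: "CDAG G" and A: "A \<subseteq> nodes G" and B: "B \<subseteq> nodes G" and C: "C \<subseteq> nodes G"
    and separated: "separated G A B C"
begin

lemma edge_nodes: "(u, w) \<in> edges G \<Longrightarrow> u \<in> nodes G \<and> w \<in> nodes G"
  using dag by (auto simp: CDAG_def nodes_def)

lemma asym: "(u, w) \<in> edges G \<Longrightarrow> (w, u) \<notin> edges G"
  by (rule CDAG_edge_asym[OF dag])

lemma Anc_self: "D \<subseteq> nodes G \<Longrightarrow> D \<subseteq> Anc G D"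
  by (auto simp: Anc_def)

lemma Anc_parent: "u \<in> Anc G D \<Longrightarrow> (w, u) \<in> edges G \<Longrightarrow> w \<in> Anc G D"
  using edge_nodes by (auto simp: Anc_def intro: converse_rtrancl_into_rtrancl)

lemma not_Anc_not_in: "u \<in> nodes G \<Longrightarrow> u \<notin> Anc G C \<Longrightarrow> u \<notin> C"
  using Anc_self[OF C] by auto

lemma reachable_out_reachable: "reachable_out G A C u \<Longrightarrow> reachable G A C u"
  by (auto simp: reachable_out_def reachable_def)

lemma reachable_out_start: "a \<in> A \<Longrightarrow> a \<notin> C \<Longrightarrow> reachable_out G A C a"
  unfolding reachable_out_def using A
  by (intro exI[of _ "[a]"]) (auto simp: active_walk_def walk_def)

text \<open>Since the last edge leaves \<open>u\<close>, or there is none, \<open>u\<close> is not a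
  collider on the longer walk, and \<open>u \<notin> C\<close> keeps it open. The added edge again
  leaves the new end.\<close>

lemma reachable_out_parent:
  assumes "reachable_out G A C u" "u \<notin> C" "(w, u) \<in> edges G"
  shows "reachable_out G A C w"
proof -
  obtain \<pi> where \<pi>: "active_walk G A C \<pi>" "last \<pi> = u" "\<And>\<rho> p. \<pi> = \<rho> @ [p, u] \<Longrightarrow> (u, p) \<in> edges G"
    using assms(1) by (auto simp: reachable_out_def)
  have "active_walk G A C (\<pi> @ [w])"
    using \<pi> assms(2,3) edge_nodes asym
    by (intro active_walk_append[OF \<pi>(1)]) (auto simp: collider_def)
  moreover have "(w, p) \<in> edges G" if "\<pi> @ [w] = \<rho> @ [p, w]" for \<rho> p
  proof -
    have "\<pi> = \<rho> @ [p]" using that by simp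
    then show ?thesis using \<pi>(2) assms(3) by simp
  qed
  ultimately show ?thesis unfolding reachable_out_def by (intro exI[of _ "\<pi> @ [w]"]) auto
qed

lemma reachable_child_append:
  assumes "active_walk G A C \<pi>" "last \<pi> \<notin> C" "(last \<pi>, w) \<in> edges G"
  shows "active_walk G A C (\<pi> @ [w])"
  using assms edge_nodes asym by (intro active_walk_append) (auto simp: collider_def)

lemma reachable_child: "reachable G A C u \<Longrightarrow> u \<notin> C \<Longrightarrow> (u, w) \<in> edges G \<Longrightarrow> reachable G A C w"
  unfolding reachable_def using reachable_child_append by fastforce

text \<open>\<open>u \<notin> C\<close> opens \<open>u\<close> as a non-collider and
  \<open>u \<in> Anc G C\<close> opens it as a collider, so the direction of the preceding edge does
  not matter.\<close>

lemma reachable_parent_Anc: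
  assumes "reachable G A C u" "u \<notin> C" "u \<in> Anc G C" "(w, u) \<in> edges G"
  shows "reachable G A C w"
proof -
  obtain \<pi> where \<pi>: "active_walk G A C \<pi>" "last \<pi> = u" using assms(1) by (auto simp: reachable_def)
  have "active_walk G A C (\<pi> @ [w])"
    using \<pi> assms edge_nodes by (intro active_walk_append) auto
  then show ?thesis unfolding reachable_def by (intro exI[of _ "\<pi> @ [w]"]) simp
qed

text \<open>Both edges enter \<open>v\<close>, and a collider in \<open>C\<close> is open. This is
  how two parents of a conditioned node become linked.\<close>

lemma reachable_through_collider:
  assumes "reachable G A C u" "u \<notin> C" "(u, v) \<in> edges G" "(w, v) \<in> edges G" "v \<in> C"
  shows "reachable G A C w"
proof -
  obtain \<pi> where \<pi>: "active_walk G A C \<pi>" "last \<pi> = u" using assms(1) by (auto simp: reachable_def)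
  have 1: "active_walk G A C (\<pi> @ [v])"
    using reachable_child_append[OF \<pi>(1)] \<pi>(2) assms by simp
  have "active_walk G A C ((\<pi> @ [v]) @ [w])"
  proof (rule active_walk_append[OF 1])
    fix p \<rho> assume "\<pi> @ [v] = \<rho> @ [p, last (\<pi> @ [v])]"
    then have "\<pi> = \<rho> @ [p]" by simp
    then have "p = u" using \<pi>(2) by simp
    moreover have "v \<in> Anc G C" using Anc_self[OF C] assms(5) by auto
    ultimately show "\<not> (non_collider G p (last (\<pi> @ [v])) w \<and> last (\<pi> @ [v]) \<in> C) \<and>
        \<not> (collider G p (last (\<pi> @ [v])) w \<and> last (\<pi> @ [v]) \<notin> Anc G C)"
      using asym[OF assms(3)] asym[OF assms(4)] by (auto simp: non_collider_def)
  qed (use assms(4) edge_nodes in auto)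
  then show ?thesis unfolding reachable_def by (intro exI[of _ "(\<pi> @ [v]) @ [w]"]) simp
qed

text \<open>An active walk to a target could be blocked only at its end, and the end lies outside
  \<open>C\<close>.\<close>

lemma not_reachable_target:
  assumes "reachable G A C u" "u \<notin> C"
  shows "u \<notin> inputs G \<union> B"
proof
  assume u: "u \<in> inputs G \<union> B"
  obtain \<pi> where \<pi>: "active_walk G A C \<pi>" "last \<pi> = u" using assms(1) by (auto simp: reachable_def)
  then have "blocked G C \<pi>"
    using separated u by (auto simp: separated_def active_walk_def)
  then show False
    using \<pi> assms(2) by (auto simp: blocked_def active_walk_def)
qed

text \<open>The directed walk from \<open>u\<close> to \<open>A\<close> is traversed backwards. As
  descendants of \<open>u\<close>, its nodes avoid \<open>Anc G C\<close> and hence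
  \<open>C\<close>, so each passage to a parent is open.\<close>

lemma reachable_out_Anc:
  assumes "u \<in> Anc G A" "u \<notin> Anc G C"
  shows "reachable_out G A C u"
proof -
  obtain a where a: "a \<in> A" "(u, a) \<in> (edges G)\<^sup>*" using assms(1) by (auto simp: Anc_def)
  from a(2) have "u \<notin> Anc G C \<longrightarrow> reachable_out G A C u"
  proof (induction rule: converse_rtrancl_induct)
    case base
    show ?case using reachable_out_start[OF a(1)] not_Anc_not_in[of a] A a(1) by blast
  next
    case (step y z)
    show ?case
      using step reachable_out_parent[OF _ _ step(1)] Anc_parent[OF _ step(1)] not_Anc_not_in[of z] edge_nodes[OF step(1)]
      by blast
  qed
  then show ?thesis using assms(2) by blast
qed

text \<open>Otherwise the active walk could follow a directed walk from \<open>u\<close> to a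
  target. All nodes on it are descendants of \<open>u\<close>, hence outside \<open>Anc G C\<close>,
  so every passage is open, contrary to separation.\<close>

lemma reachable_not_Anc_target:
  assumes "reachable G A C u" "u \<notin> Anc G C"
  shows "u \<notin> Anc G (inputs G \<union> B)"
proof
  assume "u \<in> Anc G (inputs G \<union> B)"
  then obtain t where t: "t \<in> inputs G \<union> B" "(u, t) \<in> (edges G)\<^sup>*" and u: "u \<in> nodes G" by (auto simp: Anc_def)
  show False
  proof (cases "t \<in> Anc G C")
    case True
    then have "u \<in> Anc G C" using t(2) u by (auto simp: Anc_def intro: rtrancl_trans)
    then show False using assms(2) by simp
  next
    case False
    from t(2) have "t \<notin> Anc G C \<longrightarrow> reachable G A C t"
    proof (induction rule: rtrancl_induct)
      case base
      show ?case using assms(1) by simp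
    next
      case (step y z)
      show ?case
        using step reachable_child[OF _ _ step(2)] edge_nodes[OF step(2)]
      proof (intro impI)
        assume z: "z \<notin> Anc G C"
        show "reachable G A C z"
        proof (cases "y \<in> Anc G C")
          case True
          have "u \<in> Anc G C"
            using True step(1) u by (auto simp: Anc_def intro: rtrancl_trans)
          then show ?thesis using assms(2) by simp
        next
          case False
          then show ?thesis
            using step reachable_child[OF _ _ step(2)] edge_nodes[OF step(2)] not_Anc_not_in by blast
        qed
      qed
    qed
    then have "reachable G A C t" using False by simp
    moreover have "t \<notin> C" using False not_Anc_not_in[of t] t(1) B by (auto simp: nodes_def)
    ultimately show False using not_reachable_target t(1) by blast
  qed
qed

text \<open>\<open>A0\<close> collects the nodes of the ancestral closure outside \<open>C\<close>
  that an active walk from \<open>A\<close> reaches. The restriction to the closure makes this set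
  pass to parents outside \<open>C\<close>: elsewhere a reached node could be a closed
  collider.\<close>

lemma separation_partition:
  obtains A0 S0 where "A0 \<subseteq> outputs G" "S0 \<subseteq> nodes G" "A0 \<inter> S0 = {}" "A \<subseteq> A0 \<union> C" "B \<subseteq> S0" "C \<subseteq> S0" "inputs G \<subseteq> S0"
    "\<And>v. v \<in> A0 \<union> S0 \<Longrightarrow> (v \<in> S0 \<and> Pa G v \<subseteq> S0) \<or> insert v (Pa G v) \<subseteq> A0 \<union> C"
proof -
  let ?T = "A \<union> (inputs G \<union> B) \<union> C"
  define D where "D = Anc G ?T"
  define A0 where "A0 = {u \<in> D - C. reachable G A C u}"
  define S0 where "S0 = D - A0"
  have T: "?T \<subseteq> D"
    unfolding D_def using A B C by (intro Anc_self) (auto simp: nodes_def)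
  have DN: "D \<subseteq> nodes G" by (auto simp: D_def Anc_def)
  have D_parent: "w \<in> D" if "u \<in> D" "(w, u) \<in> edges G" for u w
    using that unfolding D_def by (rule Anc_parent)
  have D_cases: "u \<in> Anc G A \<or> u \<in> Anc G (inputs G \<union> B) \<or> u \<in> Anc G C" if "u \<in> D" for u
    using that by (auto simp: D_def Anc_def)
  have target: "u \<notin> inputs G \<union> B" if "u \<in> A0" for u
    using that not_reachable_target unfolding A0_def by blast
  have child: "w \<in> A0" if "u \<in> A0" "(u, w) \<in> edges G" "w \<in> D" "w \<notin> C" for u w
    using that reachable_child unfolding A0_def by blast
  have parent: "w \<in> A0" if u: "u \<in> A0" and wu: "(w, u) \<in> edges G" and wC: "w \<notin> C" for u w
  proof -
    have uD: "u \<in> D" "u \<notin> C" "reachable G A C u" using u by (auto simp: A0_def)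
    have "reachable G A C w"
    proof (cases "u \<in> Anc G C")
      case True
      then show ?thesis using reachable_parent_Anc[OF uD(3,2) _ wu] by simp
    next
      \<comment> \<open>Here \<open>u\<close> could be a closed collider on the given walk. But it
        must be an ancestor of \<open>A\<close>, and the reversed directed walk from
        \<open>A\<close> arrives with an edge that leaves \<open>u\<close>.\<close>
      case False
      then have "u \<in> Anc G A" using D_cases[OF uD(1)] reachable_not_Anc_target[OF uD(3)] by blast
      then have "reachable_out G A C u" using False by (rule reachable_out_Anc)
      then show ?thesis using reachable_out_parent[OF _ uD(2) wu] reachable_out_reachable by blast
    qed
    then show ?thesis using D_parent[OF uD(1) wu] wC by (simp add: A0_def)
  qed
  \<comment> \<open>Membership spreads within a family by way of \<open>v\<close>: from
    \<open>v\<close> to its parents, from a parent to \<open>v\<close> if \<open>v\<close> is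
    outside \<open>C\<close>, and between parents through the open collider if \<open>v\<close> is
    in \<open>C\<close>.\<close>
  have fam: "w \<in> A0 \<union> C" if v: "v \<in> D" and u: "u \<in> insert v (Pa G v)" "u \<in> A0" and w: "w \<in> insert v (Pa G v)" for u v w
  proof (cases "u = v")
    case True
    then show ?thesis using u(2) w parent[of v w] by (auto simp: Pa_def)
  next
    case False
    then have uv: "(u, v) \<in> edges G" using u(1) by (simp add: Pa_def)
    show ?thesis
    proof (cases "v \<in> C")
      case True
      show ?thesis
      proof (cases "w = v")
        case False
        then have wv: "(w, v) \<in> edges G" using w by (simp add: Pa_def)
        then have "reachable G A C w"
          using reachable_through_collider[OF _ _ uv wv True] u(2) by (simp add: A0_def)
        then show ?thesis using D_parent[OF v wv] by (auto simp: A0_def)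
      qed (use True in simp)
    next
      case False
      then have "v \<in> A0" using child[OF u(2) uv v] by simp
      then show ?thesis using w parent[of v w] by (auto simp: Pa_def)
    qed
  qed
  show thesis
  proof
    show "A0 \<subseteq> outputs G"
      using target DN by (auto simp: A0_def nodes_def)
    show "S0 \<subseteq> nodes G" "A0 \<inter> S0 = {}" using DN by (auto simp: S0_def)
    show "A \<subseteq> A0 \<union> C"
      using T reachable_out_reachable[OF reachable_out_start] by (auto simp: A0_def)
    show "B \<subseteq> S0" "inputs G \<subseteq> S0" using T target by (auto simp: S0_def)
    show "C \<subseteq> S0" using T by (auto simp: S0_def A0_def)
    fix v assume "v \<in> A0 \<union> S0"
    then have v: "v \<in> D" by (auto simp: A0_def S0_def)
    have pD: "Pa G v \<subseteq> D" using D_parent[OF v] by (auto simp: Pa_def)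
    show "(v \<in> S0 \<and> Pa G v \<subseteq> S0) \<or> insert v (Pa G v) \<subseteq> A0 \<union> C"
    proof (cases "insert v (Pa G v) \<inter> A0 = {}")
      case True
      then show ?thesis using v pD by (auto simp: S0_def)
    next
      case False
      then obtain u where "u \<in> insert v (Pa G v)" "u \<in> A0" by blast
      then show ?thesis using fam[OF v] by blast
    qed
  qed
qed

end

section \<open>The global Markov property\<close>

context standard_network
begin

text \<open>Only at a node of \<open>C\<close> with a parent in \<open>A0\<close> does the conditional law of the \<open>A0\<close>-part change
  non-causally: there it is updated by disintegration. Doing this node by node along the topological
  order, rather than once for the whole \<open>A0\<close>-part, keeps the null sets under control when the
  mechanisms of the two parts feed into each other.\<close>

lemma decomposition:
  assumes "parents_first us" and A0: "A0 \<subseteq> \<V>" and S0: "S0 \<subseteq> \<N>" and disj: "A0 \<inter> S0 = {}"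
    and CS: "C \<subseteq> S0" and J: "\<J> \<subseteq> S0"
    and family: "\<And>v. v \<in> A0 \<union> S0 \<Longrightarrow> (v \<in> S0 \<and> pa v \<subseteq> S0) \<or> insert v (pa v) \<subseteq> A0 \<union> C"
  defines "W \<equiv> \<lambda>us. set us \<union> \<J>"
  shows "\<exists>Q\<in>markov_kernels (XS (C \<inter> W us)) (XS (A0 \<inter> W us)). \<forall>xJ\<in>points (XS \<J>).
    decomposed (A0 \<inter> W us) (S0 \<inter> W us) (C \<inter> W us) Q
      (distr (law us xJ) (IS ((A0 \<union> S0) \<inter> W us)) (\<lambda>w. restrict w ((A0 \<union> S0) \<inter> W us)))"
  using assms(1)
proof (induction us)
  case Nil
  have "\<V> \<inter> \<J> = {}" using dag by (auto simp: CDAG_def)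
  then have sets: "A0 \<inter> W [] = {}" "S0 \<inter> W [] = \<J>" "(A0 \<union> S0) \<inter> W [] = \<J>" "C \<inter> W [] = C \<inter> \<J>"
    using A0 J by (auto simp: W_def)
  \<comment> \<open>No input lies in \<open>A0\<close>, so the kernel starts as the point mass on
    the one-point space and the \<open>S0\<close>-part as the point mass at
    \<open>xJ\<close>.\<close>
  define Q where "Q c = return (IS {}) (\<lambda>_. undefined)" for c :: "'n \<Rightarrow> 'a"
  have u: "(\<lambda>_. undefined) \<in> points (XS {})" by (simp add: points_X)
  have CJ: "C \<inter> \<J> \<subseteq> \<N>" using J_nodes by auto
  have Q: "Q \<in> markov_kernels (XS (C \<inter> \<J>)) (XS {})"
    unfolding Q_def[abs_def] by (intro markov_kernels_return X_quasi_universal CJ quasi_measurable_const u) auto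
  have "decomposed {} \<J> (C \<inter> \<J>) Q (distr (law [] xJ) (IS \<J>) (\<lambda>w. restrict w \<J>))" if xJ: "xJ \<in> points (XS \<J>)" for xJ
  proof -
    let ?k = "\<lambda>s. distr (Q (restrict s (C \<inter> \<J>))) (IS \<J>) (\<lambda>a. merge {} \<J> (a, s))"
    have rx: "restrict xJ \<J> = xJ" "merge {} \<J> ((\<lambda>_. undefined), xJ) = xJ"
      using X_extensional[OF xJ] by (auto simp: merge_Pair restrict_def)
    have "(\<lambda>s. Q (restrict s (C \<inter> \<J>))) \<in> markov_kernels (XS \<J>) (XS {})"
      using markov_kernels_compose[OF quasi_measurable_restrict Q] J_nodes by auto
    from markov_kernels_push_measurable[OF X_quasi_universal[OF J_nodes] X_quasi_universal X_quasi_universal this quasi_measurable_merge[OF _ J_nodes]]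
    have k: "?k \<in> IS \<J> \<rightarrow>\<^sub>M prob_algebra (IS \<J>)" using J_nodes by simp
    have mg: "(\<lambda>a. merge {} \<J> (a, xJ)) \<in> IS {} \<rightarrow>\<^sub>M IS \<J>"
    proof (rule measurable_X)
      have "(\<lambda>a. (a, xJ)) \<in> quasi_measurable (XS {}) (prod_space (XS {}) (XS \<J>))"
        by (intro quasi_measurable_Pair quasi_measurable_ident quasi_measurable_const X_quasi_universal J_nodes xJ)
      from quasi_measurable_compose[OF this quasi_measurable_merge] J_nodes
      show "(\<lambda>a. merge {} \<J> (a, xJ)) \<in> quasi_measurable (XS {}) (XS \<J>)" by simp
    qed (use J_nodes in auto)
    have "distr (law [] xJ) (IS \<J>) (\<lambda>w. restrict w \<J>) = return (IS \<J>) xJ"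
      using measurable_X[OF J_nodes J_nodes quasi_measurable_restrict[OF order.refl J_nodes]] xJ
      by (simp add: distr_return rx)
    also have "\<dots> = ?k xJ"
      using mg u by (simp add: Q_def distr_return rx)
    also have "\<dots> = return (IS \<J>) xJ \<bind> ?k"
      by (rule bind_return[OF measurable_prob_algebraD[OF k], symmetric]) (simp add: xJ)
    finally have "distr (law [] xJ) (IS \<J>) (\<lambda>w. restrict w \<J>) = return (IS \<J>) xJ \<bind> ?k" .
    moreover have "return (IS \<J>) xJ \<in> space (prob_algebra (IS \<J>))"
      using xJ by (simp add: space_prob_algebra prob_space_return)
    ultimately show ?thesis
      unfolding decomposed_def by (auto intro!: bexI[of _ "return (IS \<J>) xJ"])
  qed
  with Q show ?case unfolding sets by blast
next
  case (Cons v us)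
  then have us: "parents_first us" and vf: "v \<in> \<V>" "v \<notin> set us" "pa v \<subseteq> W us" by (auto simp: W_def)
  have "v \<notin> \<J>" using vf(1) dag by (auto simp: CDAG_def)
  then have vW: "v \<notin> W us" using vf by (simp add: W_def)
  have Wv: "W (v # us) = insert v (W us)" by (simp add: W_def)
  have WN: "W us \<subseteq> \<N>" "insert v (W us) \<subseteq> \<N>" using parents_first_nodes[OF us] vf V_nodes by (auto simp: W_def)
  let ?A = "A0 \<inter> W us" and ?S = "S0 \<inter> W us" and ?C = "C \<inter> W us" and ?D = "(A0 \<union> S0) \<inter> W us"
  have D: "?D \<subseteq> \<N>" "insert v ?D \<subseteq> \<N>" "?A \<union> ?S = ?D" using WN by auto
  let ?T = "\<lambda>xJ. distr (law us xJ) (IS ?D) (\<lambda>w. restrict w ?D)"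
  obtain Q where Qf: "Q \<in> markov_kernels (XS ?C) (XS ?A)" "\<And>xJ. xJ \<in> points (XS \<J>) \<Longrightarrow> decomposed ?A ?S ?C Q (?T xJ)"
    using Cons.IH[OF us] by blast
  have L: "law us xJ \<in> space (prob_algebra (IS (W us)))" if "xJ \<in> points (XS \<J>)" for xJ
    unfolding W_def by (rule law_prob[OF us that])
  have st: "step v (W us) \<in> IS (W us) \<rightarrow>\<^sub>M prob_algebra (IS (insert v (W us)))"
    by (rule measurable_step[OF vf(1,3) WN(1)])
  have law_Cons: "law (v # us) xJ = law us xJ \<bind> step v (W us)" for xJ by (simp add: W_def)
  have mres: "(\<lambda>w. restrict w ?D) \<in> IS (W us) \<rightarrow>\<^sub>M IS ?D"
    by (intro measurable_X quasi_measurable_restrict WN D) auto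
  have mp: "mech v (restrict w (pa v)) \<in> space (prob_algebra (induced (XN v)))" if "w \<in> points (XS (W us))" for w
    using points_P_space_prob[OF node_quasi_universal markov_kernels_points[OF mechanism_restrict[OF vf(1,3) WN(1)] that]] vf V_nodes by auto
  have mu: "(\<lambda>x. w(v := x)) \<in> induced (XN v) \<rightarrow>\<^sub>M IS (insert v (W us))" if w: "w \<in> points (XS (W us))" for w
  proof -
    have "(\<lambda>x. (x, w)) \<in> quasi_measurable (XN v) (prod_space (XN v) (XS (W us)))"
      by (intro quasi_measurable_Pair quasi_measurable_ident quasi_measurable_const X_quasi_universal WN w)
    from quasi_measurable_compose[OF this quasi_measurable_upd[OF WN(1)]] vf V_nodes
    show ?thesis
      by (intro measurable_quasi_measurable node_quasi_universal X_quasi_universal WN) auto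
  qed
  show ?case
  proof (cases "v \<in> A0 \<union> S0")
    \<comment> \<open>A node outside \<open>A0 \<union> S0\<close> integrates out because its
      mechanism has total mass 1; the law of the retained nodes does not change.\<close>
    case False
    then have sets: "A0 \<inter> W (v # us) = ?A" "S0 \<inter> W (v # us) = ?S" "C \<inter> W (v # us) = ?C" "(A0 \<union> S0) \<inter> W (v # us) = ?D"
      using CS by (auto simp: Wv)
    have T: "distr (law (v # us) xJ) (IS ?D) (\<lambda>w. restrict w ?D) = ?T xJ" if xJ: "xJ \<in> points (XS \<J>)" for xJ
    proof -
      have m: "(\<lambda>w. restrict w ?D) \<in> IS (insert v (W us)) \<rightarrow>\<^sub>M IS ?D"
        by (intro measurable_X quasi_measurable_restrict WN D) auto
      have "distr (law (v # us) xJ) (IS ?D) (\<lambda>w. restrict w ?D) = law us xJ \<bind> (\<lambda>w. distr (step v (W us) w) (IS ?D) (\<lambda>w. restrict w ?D))"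
        unfolding law_Cons by (rule distr_bind_prob[OF L[OF xJ] st m])
      also have "\<dots> = law us xJ \<bind> (\<lambda>w. return (IS ?D) (restrict w ?D))"
      proof (rule bind_cong_prob[OF L[OF xJ]])
        fix w assume "w \<in> space (IS (W us))"
        then have w: "w \<in> points (XS (W us))" by simp
        have "restrict (w(v := x)) ?D = restrict w ?D" for x
          using vW by (auto simp: restrict_def fun_eq_iff)
        then have "distr (step v (W us) w) (IS ?D) (\<lambda>w. restrict w ?D) = distr (mech v (restrict w (pa v))) (IS ?D) (\<lambda>_. restrict w ?D)"
          unfolding step_def by (subst distr_distr_prob[OF mp[OF w] mu[OF w] m]) simp
        also have "\<dots> = return (IS ?D) (restrict w ?D)"
          using space_prob_algebraD(1)[OF mp[OF w]] measurable_space[OF mres] w by (intro prob_space.distr_const) auto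
        finally show "distr (step v (W us) w) (IS ?D) (\<lambda>w. restrict w ?D) = return (IS ?D) (restrict w ?D)" .
      qed
      also have "\<dots> = ?T xJ"
        using mres space_prob_algebraD[OF L[OF xJ]] prob_space.not_empty[of "law us xJ"]
        by (intro bind_return_distr') (auto cong: measurable_cong_sets)
      finally show ?thesis .
    qed
    show ?thesis
      unfolding sets by (intro bexI[OF _ Qf(1)] ballI) (simp only: T Qf(2))
  next
    case True
    have pD: "pa v \<subseteq> ?D" using family[OF True] vf(3) CS by blast
    have T: "distr (law (v # us) xJ) (IS (insert v ?D)) (\<lambda>w. restrict w (insert v ?D)) = ?T xJ \<bind> step v (?A \<union> ?S)"
      if xJ: "xJ \<in> points (XS \<J>)" for xJ
    proof -
      have m: "(\<lambda>w. restrict w (insert v ?D)) \<in> IS (insert v (W us)) \<rightarrow>\<^sub>M IS (insert v ?D)"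
        by (intro measurable_X quasi_measurable_restrict WN D) auto
      have "distr (law (v # us) xJ) (IS (insert v ?D)) (\<lambda>w. restrict w (insert v ?D)) =
          law us xJ \<bind> (\<lambda>w. distr (step v (W us) w) (IS (insert v ?D)) (\<lambda>w. restrict w (insert v ?D)))"
        unfolding law_Cons by (rule distr_bind_prob[OF L[OF xJ] st m])
      also have "\<dots> = law us xJ \<bind> (\<lambda>w. step v ?D (restrict w ?D))"
      proof (rule bind_cong_prob[OF L[OF xJ]])
        fix w assume "w \<in> space (IS (W us))"
        then have w: "w \<in> points (XS (W us))" by simp
        have "restrict (w(v := x)) (insert v ?D) = (restrict w ?D)(v := x)" for x
          using vW by (auto simp: restrict_def fun_eq_iff)
        moreover have "restrict (restrict w ?D) (pa v) = restrict w (pa v)"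
          using pD by (auto simp: restrict_def fun_eq_iff)
        ultimately show "distr (step v (W us) w) (IS (insert v ?D)) (\<lambda>w. restrict w (insert v ?D)) = step v ?D (restrict w ?D)"
          unfolding step_def by (subst distr_distr_prob[OF mp[OF w] mu[OF w] m]) simp
      qed
      also have "\<dots> = ?T xJ \<bind> step v ?D"
        by (rule bind_distr_prob[OF L[OF xJ] mres measurable_step[OF vf(1) pD D(1)], symmetric])
      finally show ?thesis by (simp only: D(3))
    qed
    interpret decomposition_step M ?A ?S ?C Q v
      by unfold_locales (use A0 S0 CS disj vf vW WN Qf in auto)
    have sD: "(A0 \<union> S0) \<inter> W (v # us) = insert v ?D" using True by (auto simp: Wv)
    \<comment> \<open>A node of \<open>C\<close> whose parents all lie in \<open>S0\<close> is
      handled by the first case, without disintegration.\<close>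
    consider "v \<in> S0" "pa v \<subseteq> S0" | "v \<in> A0" "pa v \<subseteq> A0 \<union> C" | "v \<notin> A0" "v \<in> C" "pa v \<subseteq> A0 \<union> C"
      using family[OF True] by blast
    then show ?thesis
    proof cases
      case 1
      let ?C' = "C \<inter> W (v # us)"
      have sets: "A0 \<inter> W (v # us) = ?A" "S0 \<inter> W (v # us) = insert v ?S"
        using 1 disj by (auto simp: Wv)
      have C': "?C \<subseteq> ?C'" "?C' \<subseteq> insert v ?S" "?C' \<subseteq> \<N>" using CS WN by (auto simp: Wv)
      have "pa v \<subseteq> ?S" using 1 vf(3) by blast
      note d = step_in_rest[OF this C'(1,2)]
      have Q': "(\<lambda>c. Q (restrict c ?C)) \<in> markov_kernels (XS ?C') (XS ?A)"
        by (rule markov_kernels_compose[OF quasi_measurable_restrict[OF C'(1,3)] Qf(1)])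
      show ?thesis
        unfolding sD sets by (intro bexI[OF _ Q'] ballI) (simp only: T d[OF Qf(2)])
    next
      case 2
      then have "v \<notin> S0" "v \<notin> C" using disj CS by auto
      then have sets: "A0 \<inter> W (v # us) = insert v ?A" "S0 \<inter> W (v # us) = ?S" "C \<inter> W (v # us) = ?C"
        using 2 by (auto simp: Wv)
      have pv: "pa v \<subseteq> ?A \<union> ?C" using 2 vf(3) by blast
      obtain Q' where Q': "Q' \<in> markov_kernels (XS ?C) (XS (insert v ?A))"
        "\<And>T. decomposed ?A ?S ?C Q T \<Longrightarrow> decomposed (insert v ?A) ?S ?C Q' (T \<bind> step v (?A \<union> ?S))"
        by (rule step_in_A[OF pv], rule that)
      show ?thesis
        unfolding sD sets by (intro bexI[OF _ Q'(1)] ballI) (simp only: T Q'(2)[OF Qf(2)])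
    next
      case 3
      then have sets: "A0 \<inter> W (v # us) = ?A" "S0 \<inter> W (v # us) = insert v ?S" "C \<inter> W (v # us) = insert v ?C"
        using CS by (auto simp: Wv)
      have pv: "pa v \<subseteq> ?A \<union> ?C" using 3 vf(3) by blast
      obtain Q' where Q': "Q' \<in> markov_kernels (XS (insert v ?C)) (XS ?A)"
        "\<And>T. decomposed ?A ?S ?C Q T \<Longrightarrow> decomposed ?A (insert v ?S) (insert v ?C) Q' (T \<bind> step v (?A \<union> ?S))"
        by (rule step_in_C[OF pv], rule that)
      show ?thesis
        unfolding sD sets by (intro bexI[OF _ Q'(1)] ballI) (simp only: T Q'(2)[OF Qf(2)])
    qed
  qed
qed

text \<open>Integrating against the point mass merely inserts \<open>xJ\<close> next to the output
  configuration, after which \<open>kernel_along_law\<close> applies.\<close>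

lemma extended_kernel_law:
  assumes vs: "topological_order (graph M) vs" and xJ: "xJ \<in> points (XS \<J>)"
    and g: "g \<in> IS \<N> \<rightarrow>\<^sub>M R"
  shows "distr (extended_kernel M (joint_kernel M vs) xJ) R (\<lambda>x. g (merge \<V> \<J> x)) = distr (law (rev vs) xJ) R g"
proof -
  let ?P = "joint_kernel M vs xJ"
  let ?VJ = "prod_space (XS \<V>) (XS \<J>)"
  have V: "set (rev vs) = \<V>" using vs by (simp add: topological_order_def)
  have N: "\<V> \<union> \<J> = \<N>" by (auto simp: nodes_def)
  note kl = kernel_along_law[OF parents_first_rev[OF vs] xJ, folded joint_kernel_def, unfolded V N]
  have qV: "quasi_universal_space (XS \<V>)" and qJ: "quasi_universal_space (XS \<J>)"
    by (intro X_quasi_universal V_nodes J_nodes)+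
  have qVJ: "quasi_universal_space ?VJ" by (rule quasi_universal_prod_space[OF qV qJ])
  have pr: "(\<lambda>x. (x, y)) \<in> IS \<V> \<rightarrow>\<^sub>M induced ?VJ" if "y \<in> points (XS \<J>)" for y
    by (intro measurable_quasi_measurable qV qVJ quasi_measurable_Pair quasi_measurable_ident quasi_measurable_const qJ that)
  have mg: "merge \<V> \<J> \<in> induced ?VJ \<rightarrow>\<^sub>M IS \<N>"
    using measurable_quasi_measurable[OF qVJ X_quasi_universal quasi_measurable_merge[OF V_nodes J_nodes]] by (simp add: N)
  have sec: "{x. (x, y) \<in> E} = (\<lambda>x. (x, y)) -` E \<inter> space (IS \<V>)" if "E \<in> sets (induced ?VJ)" for E y
    using sets.sets_into_space[OF that] by auto
  have "extended_kernel M (joint_kernel M vs) xJ = distr ?P (induced ?VJ) (\<lambda>x. (x, xJ))"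
  proof -
    let ?B = "distr ?P (induced ?VJ) (\<lambda>x. (x, xJ))"
    have pm: "(\<lambda>x. (x, xJ)) \<in> ?P \<rightarrow>\<^sub>M induced ?VJ"
      using pr[OF xJ] space_prob_algebraD(2)[OF kl(1)] by (simp cong: measurable_cong_sets)
    have "?B = measure_of (space ?B) (sets ?B) (emeasure ?B)"
      by (rule measure_of_of_measure[symmetric])
    also have "\<dots> = measure_of (points ?VJ) (induced_sets ?VJ) (\<lambda>E. \<integral>\<^sup>+ y. emeasure ?P {x. (x, y) \<in> E} \<partial>return (IS \<J>) xJ)"
      unfolding space_distr sets_distr space_induced sets_induced[OF qVJ]
    proof (rule measure_of_eq)
      show "induced_sets ?VJ \<subseteq> Pow (points ?VJ)" by (auto simp: induced_sets_def)
      fix E assume "E \<in> sigma_sets (points ?VJ) (induced_sets ?VJ)"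
      then have E: "E \<in> sets (induced ?VJ)"
        using sets.sigma_sets_eq[of "induced ?VJ"] sets_induced[OF qVJ] by simp
      have "(\<lambda>y. emeasure ?P {x. (x, y) \<in> E}) \<in> borel_measurable (IS \<J>)"
      proof -
        \<comment> \<open>On a nonempty standard space every probability measure is a push-forward
          from the sample space: this is \<open>standard_markov_kernelsI\<close> for a constant
          family. It makes the section function of \<open>E\<close> measurable.\<close>
        have "?P \<in> points (P_space (XS \<V>))"
          using markov_kernels_points[OF standard_markov_kernelsI[OF qV qV X_standard points_X_nonempty[OF V_nodes]
                measurable_const[OF kl(1)]], of _] points_X_nonempty[OF V_nodes] by blast
        from markov_kernels_push_measurable[OF qJ qV qVJ markov_kernels_constant[OF qV this] quasi_measurable_ident]
        have "(\<lambda>y. distr ?P (induced ?VJ) (\<lambda>x. (x, y))) \<in> IS \<J> \<rightarrow>\<^sub>M prob_algebra (induced ?VJ)" .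
        from measurable_compose[OF measurable_prob_algebraD[OF this] measurable_emeasure_subprob_algebra[OF E]]
        show ?thesis
        proof (rule measurable_cong[THEN iffD1, rotated])
          fix y assume "y \<in> space (IS \<J>)"
          then have "(\<lambda>x. (x, y)) \<in> ?P \<rightarrow>\<^sub>M induced ?VJ"
            using pr[of y] space_prob_algebraD(2)[OF kl(1)] by (simp cong: measurable_cong_sets)
          from emeasure_distr[OF this E] show "emeasure (distr ?P (induced ?VJ) (\<lambda>x. (x, y))) E = emeasure ?P {x. (x, y) \<in> E}"
            using space_prob_algebraD(3)[OF kl(1)] sec[OF E] by simp
        qed
      qed
      then show "emeasure ?B E = (\<integral>\<^sup>+ y. emeasure ?P {x. (x, y) \<in> E} \<partial>return (IS \<J>) xJ)"
        using xJ emeasure_distr[OF pm E] sec[OF E] space_prob_algebraD(3)[OF kl(1)]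
        by (subst nn_integral_return) simp_all
    qed
    finally show ?thesis
      by (simp add: extended_kernel_def kernel_prod_def)
  qed
  then have "distr (extended_kernel M (joint_kernel M vs) xJ) R (\<lambda>x. g (merge \<V> \<J> x)) = distr ?P R (\<lambda>x. g (merge \<V> \<J> (x, xJ)))"
    using distr_distr_prob[OF kl(1) pr[OF xJ] measurable_compose[OF mg g]] by simp
  also have "\<dots> = distr (distr ?P (IS \<N>) (\<lambda>x. merge \<V> \<J> (x, xJ))) R g"
    by (rule distr_distr_prob[OF kl(1) measurable_compose[OF pr[OF xJ] mg] g, symmetric])
  finally show ?thesis
    by (simp add: kl(2))
qed

theorem global_markov:
  assumes vs: "topological_order (graph M) vs" and "A \<subseteq> \<N>" "B \<subseteq> \<N>" "C \<subseteq> \<N>" and "separated (graph M) A B C"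
  shows "cond_independent M (joint_kernel M vs) A B C"
proof -
  interpret separation "graph M" A B C
    using assms dag by unfold_locales auto
  obtain A0 S0 where p: "A0 \<subseteq> \<V>" "S0 \<subseteq> \<N>" "A0 \<inter> S0 = {}" "A \<subseteq> A0 \<union> C" "B \<subseteq> S0" "C \<subseteq> S0" "\<J> \<subseteq> S0"
    and family: "\<And>v. v \<in> A0 \<union> S0 \<Longrightarrow> (v \<in> S0 \<and> pa v \<subseteq> S0) \<or> insert v (pa v) \<subseteq> A0 \<union> C"
    by (rule separation_partition, rule that)
  have W: "set (rev vs) \<union> \<J> = \<N>" using vs by (auto simp: topological_order_def nodes_def)
  let ?D = "A0 \<union> S0"
  have A0: "A0 \<subseteq> \<N>" and D: "?D \<subseteq> \<N>" using p V_nodes by auto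
  have sets: "A0 \<inter> \<N> = A0" "S0 \<inter> \<N> = S0" "C \<inter> \<N> = C" "?D \<inter> \<N> = ?D" using p A0 D by auto
  obtain Q where Q: "Q \<in> markov_kernels (XS C) (XS A0)"
    and dec: "\<And>xJ. xJ \<in> points (XS \<J>) \<Longrightarrow> decomposed A0 S0 C Q (distr (law (rev vs) xJ) (IS ?D) (\<lambda>w. restrict w ?D))"
    using decomposition[OF parents_first_rev[OF vs] p(1,2,3,6,7) family] unfolding W sets by blast
  have qA: "quasi_universal_space (XS A)" and qC: "quasi_universal_space (XS C)" and qA0: "quasi_universal_space (XS A0)"
    and qS: "quasi_universal_space (XS S0)" and qD: "quasi_universal_space (XS ?D)" and qN: "quasi_universal_space (XS \<N>)"
    and qBC: "quasi_universal_space (prod_space (XS B) (XS C))"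
    and qABC: "quasi_universal_space (prod_space (XS A) (prod_space (XS B) (XS C)))"
    by (intro quasi_universal_prod_space X_quasi_universal A0 D p order.refl A B C)+
  let ?ABC = "prod_space (XS A) (prod_space (XS B) (XS C))" and ?BC = "prod_space (XS B) (XS C)"
  \<comment> \<open>As \<open>A \<subseteq> A0 \<union> C\<close>, the value on \<open>A\<close> is
    read off from a draw on \<open>A0\<close> together with the conditioning value; coordinates in
    \<open>C\<close> are copied from \<open>c\<close>.\<close>
  define Q' where "Q' c = distr (Q c) (IS A) (\<lambda>a. restrict (merge A0 C (a, c)) A)" for c
  have AC: "A0 \<union> C \<subseteq> \<N>" using A0 C by blast
  have Q': "Q' \<in> markov_kernels (XS C) (XS A)"
    unfolding Q'_def[abs_def]
    using markov_kernels_push[OF qC qA0 qA Q quasi_measurable_compose[OF quasi_measurable_merge[OF A0 C] quasi_measurable_restrict[OF p(4) AC]]] .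
  define t where "t w = (restrict w B, restrict w C)" for w :: "'n \<Rightarrow> 'a"
  define f where "f w = (restrict w A, restrict w B, restrict w C)" for w :: "'n \<Rightarrow> 'a"
  have t: "t \<in> quasi_measurable (XS E) ?BC" if "B \<subseteq> E" "C \<subseteq> E" "E \<subseteq> \<N>" for E
    unfolding t_def[abs_def] using that by (intro quasi_measurable_Pair quasi_measurable_restrict)
  have f: "f \<in> quasi_measurable (XS E) ?ABC" if "A \<subseteq> E" "B \<subseteq> E" "C \<subseteq> E" "E \<subseteq> \<N>" for E
    unfolding f_def[abs_def] using that by (intro quasi_measurable_Pair quasi_measurable_restrict)
  have tm: "t \<in> IS E \<rightarrow>\<^sub>M induced ?BC" if "B \<subseteq> E" "C \<subseteq> E" "E \<subseteq> \<N>" for E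
    by (rule measurable_quasi_measurable[OF X_quasi_universal[OF that(3)] qBC t[OF that]])
  have fm: "f \<in> IS E \<rightarrow>\<^sub>M induced ?ABC" if "A \<subseteq> E" "B \<subseteq> E" "C \<subseteq> E" "E \<subseteq> \<N>" for E
    by (rule measurable_quasi_measurable[OF X_quasi_universal[OF that(4)] qABC f[OF that]])
  have sub: "A \<subseteq> ?D" "B \<subseteq> ?D" "C \<subseteq> ?D" using p by auto
  show ?thesis
    unfolding cond_independent_def
  proof (intro bexI[OF _ Q'] ballI)
    fix xJ assume xJ: "xJ \<in> points (XS \<J>)"
    let ?P = "joint_kernel M vs"
    let ?L = "law (rev vs) xJ"
    let ?T = "distr ?L (IS ?D) (\<lambda>w. restrict w ?D)"
    obtain \<sigma> where \<sigma>: "\<sigma> \<in> space (prob_algebra (IS S0))"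
      and T: "?T = (\<sigma> \<bind> (\<lambda>s. distr (Q (restrict s C)) (IS ?D) (\<lambda>a. merge A0 S0 (a, s))))"
      using dec[OF xJ] unfolding decomposed_def by blast
    have L: "?L \<in> space (prob_algebra (IS \<N>))"
      using law_prob[OF parents_first_rev[OF vs] xJ] by (simp only: W)
    have res: "(\<lambda>w. restrict w ?D) \<in> IS \<N> \<rightarrow>\<^sub>M IS ?D"
      by (intro measurable_X quasi_measurable_restrict D order.refl)
    have k: "(\<lambda>s. distr (Q (restrict s C)) (IS ?D) (\<lambda>a. merge A0 S0 (a, s))) \<in> IS S0 \<rightarrow>\<^sub>M prob_algebra (IS ?D)"
      using markov_kernels_push_measurable[OF qS qA0 qD markov_kernels_compose[OF quasi_measurable_restrict[OF p(6,2)] Q]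
          quasi_measurable_merge[OF A0 p(2)]] .
    have c: "restrict s C \<in> points (XS C)" if "s \<in> points (XS S0)" for s
      using that p(6) by (auto simp: points_X)
    have Qp: "Q c \<in> space (prob_algebra (IS A0))" if "c \<in> points (XS C)" for c
      by (rule points_P_space_prob[OF qA0 markov_kernels_points[OF Q that]])
    have mg: "(\<lambda>a. merge A0 E (a, s)) \<in> IS A0 \<rightarrow>\<^sub>M IS (A0 \<union> E)" if "E \<subseteq> \<N>" "s \<in> points (XS E)" for E s
    proof (rule measurable_X)
      have "(\<lambda>a. (a, s)) \<in> quasi_measurable (XS A0) (prod_space (XS A0) (XS E))"
        by (intro quasi_measurable_Pair quasi_measurable_ident quasi_measurable_const X_quasi_universal that)
      from quasi_measurable_compose[OF this quasi_measurable_merge[OF A0 that(1)]]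
      show "(\<lambda>a. merge A0 E (a, s)) \<in> quasi_measurable (XS A0) (XS (A0 \<union> E))" .
    qed (use A0 that in auto)
    \<comment> \<open>Both marginals are images of the law under maps that read only the retained
      nodes, so one formula serves both.\<close>
    have push: "distr ?L R g = \<sigma> \<bind> (\<lambda>s. distr (Q (restrict s C)) R (\<lambda>a. g (merge A0 S0 (a, s))))"
      if g: "g \<in> IS ?D \<rightarrow>\<^sub>M R" and gr: "\<And>w. g (restrict w ?D) = g w" for g and R :: "'c measure"
    proof -
      have "distr ?L R g = distr ?T R g"
        by (subst distr_distr_prob[OF L res g]) (simp add: gr)
      also have "\<dots> = \<sigma> \<bind> (\<lambda>s. distr (distr (Q (restrict s C)) (IS ?D) (\<lambda>a. merge A0 S0 (a, s))) R g)"
        unfolding T by (rule distr_bind_prob[OF \<sigma> k g])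
      also have "\<dots> = \<sigma> \<bind> (\<lambda>s. distr (Q (restrict s C)) R (\<lambda>a. g (merge A0 S0 (a, s))))"
        by (rule bind_cong_prob[OF \<sigma>]) (simp add: distr_distr_prob[OF Qp[OF c] mg[OF p(2)] g])
      finally show ?thesis .
    qed
    have "marginal3 M ?P A B C xJ = distr ?L (induced ?ABC) f"
      unfolding marginal3_def X_proj_def
      using extended_kernel_law[OF vs xJ fm[OF A B C order.refl]] by (simp add: f_def)
    also have "\<dots> = \<sigma> \<bind> (\<lambda>s. distr (Q (restrict s C)) (induced ?ABC) (\<lambda>a. f (merge A0 S0 (a, s))))"
      by (rule push[OF fm[OF sub D]]) (simp add: f_def Int_absorb1 sub)
    finally have m3: "marginal3 M ?P A B C xJ =
        \<sigma> \<bind> (\<lambda>s. distr (Q (restrict s C)) (induced ?ABC) (\<lambda>a. f (merge A0 S0 (a, s))))" .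
    have mS: "restrict (merge A0 S0 (a, s)) E = restrict s E" if "E \<subseteq> S0" for a s :: "'n \<Rightarrow> 'a" and E
      using that p(3) by (auto simp: merge_Pair restrict_def fun_eq_iff)
    have "marginal2 M ?P B C xJ = distr ?L (induced ?BC) t"
      unfolding marginal2_def X_proj_def
      using extended_kernel_law[OF vs xJ tm[OF B C order.refl]] by (simp add: t_def)
    also have "\<dots> = \<sigma> \<bind> (\<lambda>s. distr (Q (restrict s C)) (induced ?BC) (\<lambda>a. t (merge A0 S0 (a, s))))"
      by (rule push[OF tm[OF sub(2,3) D]]) (simp add: t_def Int_absorb1 sub)
    also have "\<dots> = \<sigma> \<bind> (\<lambda>s. return (induced ?BC) (t s))"
    proof (rule bind_cong_prob[OF \<sigma>])
      fix s assume s: "s \<in> space (IS S0)"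
      \<comment> \<open>\<open>t\<close> reads coordinates in \<open>S0\<close> only, so the draw
        from \<open>Q\<close> integrates out and leaves a point mass.\<close>
      have "t (merge A0 S0 (a, s)) = t s" for a
        by (simp add: t_def mS p)
      then show "distr (Q (restrict s C)) (induced ?BC) (\<lambda>a. t (merge A0 S0 (a, s))) = return (induced ?BC) (t s)"
        using space_prob_algebraD(1)[OF Qp[OF c]] measurable_space[OF tm[OF p(5,6,2)] s] s
        by (auto intro!: prob_space.distr_const)
    qed
    also have "\<dots> = distr \<sigma> (induced ?BC) t"
      using tm[OF p(5,6,2)] space_prob_algebraD[OF \<sigma>] prob_space.not_empty[of \<sigma>]
      by (intro bind_return_distr') (auto cong: measurable_cong_sets)
    finally have m2: "marginal2 M ?P B C xJ = distr \<sigma> (induced ?BC) t" .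
    have K: "(\<lambda>y. (\<lambda>((xB, xC), xJ). Q' xC) (y, xJ)) \<in> markov_kernels ?BC (XS A)"
      using markov_kernels_compose[OF quasi_measurable_snd Q'] by (simp add: split_beta')
    have m2p: "marginal2 M ?P B C xJ \<in> space (prob_algebra (induced ?BC))"
      unfolding m2 by (rule distr_in_prob_algebra[OF \<sigma> tm[OF p(5,6,2)]])
    have k': "(\<lambda>y. distr (Q' (snd y)) (induced ?ABC) (\<lambda>x. (x, y))) \<in> induced ?BC \<rightarrow>\<^sub>M prob_algebra (induced ?ABC)"
      using markov_kernels_push_measurable[OF qBC qA qABC markov_kernels_compose[OF quasi_measurable_snd Q'] quasi_measurable_ident] .
    have "kernel_prod (XS A) ?BC (\<lambda>((xB, xC), xJ). Q' xC) (marginal2 M ?P B C) xJ =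
        marginal2 M ?P B C xJ \<bind> (\<lambda>y. distr (Q' (snd y)) (induced ?ABC) (\<lambda>x. (x, y)))"
      using kernel_prod_eq_bind[OF qA qBC, where K="\<lambda>((xB, xC), xJ). Q' xC" and Q="marginal2 M ?P B C" and z=xJ, OF K m2p]
      by (simp add: split_beta')
    also have "\<dots> = \<sigma> \<bind> (\<lambda>s. distr (Q' (snd (t s))) (induced ?ABC) (\<lambda>x. (x, t s)))"
      unfolding m2 by (rule bind_distr_prob[OF \<sigma> tm[OF p(5,6,2)] k'])
    also have "\<dots> = \<sigma> \<bind> (\<lambda>s. distr (Q (restrict s C)) (induced ?ABC) (\<lambda>a. f (merge A0 S0 (a, s))))"
    proof (rule bind_cong_prob[OF \<sigma>])
      fix s assume "s \<in> space (IS S0)"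
      then have s: "s \<in> points (XS S0)" by simp
      let ?c = "restrict s C"
      have ts: "t s \<in> points ?BC" using quasi_measurable_points[OF t[OF p(5,6,2)] s] .
      have pr: "(\<lambda>x. (x, t s)) \<in> IS A \<rightarrow>\<^sub>M induced ?ABC"
        by (intro measurable_quasi_measurable qA qABC quasi_measurable_Pair quasi_measurable_ident quasi_measurable_const qBC ts)
      have mA: "(\<lambda>a. restrict (merge A0 C (a, ?c)) A) \<in> IS A0 \<rightarrow>\<^sub>M IS A"
        by (rule measurable_compose[OF mg[OF C c[OF s]] measurable_X[OF AC A quasi_measurable_restrict[OF p(4) AC]]])
      have eq: "(restrict (merge A0 C (a, ?c)) A, t s) = f (merge A0 S0 (a, s))" for a
      proof -
        have "restrict (merge A0 C (a, ?c)) A = restrict (merge A0 S0 (a, s)) A"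
          using p(4,6) by (auto simp: merge_Pair restrict_def fun_eq_iff)
        then show ?thesis by (simp add: f_def t_def mS p)
      qed
      have "distr (Q' ?c) (induced ?ABC) (\<lambda>x. (x, t s)) = distr (Q ?c) (induced ?ABC) (\<lambda>a. (restrict (merge A0 C (a, ?c)) A, t s))"
        unfolding Q'_def by (rule distr_distr_prob[OF Qp[OF c[OF s]] mA pr])
      moreover have "snd (t s) = ?c" by (simp add: t_def)
      ultimately show "distr (Q' (snd (t s))) (induced ?ABC) (\<lambda>x. (x, t s)) =
          distr (Q ?c) (induced ?ABC) (\<lambda>a. f (merge A0 S0 (a, s)))"
        by (simp only: eq)
    qed
    finally show "marginal3 M ?P A B C xJ = kernel_prod (XS A) ?BC (\<lambda>((xB, xC), xJ). Q' xC) (marginal2 M ?P B C) xJ"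
      using m3 by simp
  qed
qed

end

text \<open>Without input values the claim degenerates to the existence of a kernel, which can only fail
  if \<open>X\<^sub>A\<close> is empty and \<open>X\<^sub>C\<close> is not. Emptiness propagates from a node to one of its parents, so
  an empty node of \<open>A\<close> is joined to an input node by a directed walk of empty nodes, and \<open>C\<close> has to
  block it.\<close>

lemma separated_kernel_exists:
  assumes M: "causal_bayesian_network M" and "A \<subseteq> nodes (graph M)" "B \<subseteq> nodes (graph M)" "C \<subseteq> nodes (graph M)"
    and "separated (graph M) A B C"
  shows "markov_kernels (X_space M C) (X_space M A) \<noteq> {}"
proof -
  let ?G = "graph M"
  have dagM: "CDAG ?G" using M by (simp add: causal_bayesian_network_def)
  interpret separation ?G A B C
    using assms dagM by unfold_locales auto
  have qn: "quasi_universal_space (node_space M v)" if "v \<in> nodes ?G" for v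
    using M that by (simp add: causal_bayesian_network_def)
  have qX: "quasi_universal_space (X_space M D)" if "D \<subseteq> nodes ?G" for D
    unfolding X_space_def using that by (intro quasi_universal_Pi_space qn) auto
  have pX: "points (X_space M D) = (\<Pi>\<^sub>E v\<in>D. points (node_space M v))" for D
    by (simp add: X_space_def points_Pi_space)
  have "edges ?G \<subseteq> nodes ?G \<times> outputs ?G" "finite (outputs ?G)" "finite (nodes ?G)"
    using dagM unfolding CDAG_def nodes_def by blast+
  then have "finite (edges ?G)"
    using finite_subset[OF _ finite_cartesian_product] by blast
  then have wf: "wf (edges ?G)"
    using dagM by (simp add: CDAG_def finite_acyclic_wf)
  show ?thesis
  proof (cases "points (X_space M A) = {}")
    case False
    then obtain x where "x \<in> points (X_space M A)" by blast
    then have "(\<lambda>_. x) \<in> quasi_measurable (X_space M C) (X_space M A)"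
      by (intro quasi_measurable_const qX A)
    from markov_kernels_return[OF qX[OF C] qX[OF A] this] show ?thesis by blast
  next
    case True
    have "points (X_space M C) = {}"
    proof (rule ccontr)
      assume "points (X_space M C) \<noteq> {}"
      then have Cne: "points (node_space M c) \<noteq> {}" if "c \<in> C" for c
        using that by (auto simp: pX PiE_eq_empty_iff)
      have False if "reachable_out ?G A C u" "u \<in> nodes ?G" "points (node_space M u) = {}" for u
        using wf that
      proof (induction u rule: wf_induct_rule)
        case (less u)
        have uC: "u \<notin> C" using Cne less.prems(3) by blast
        have "u \<notin> inputs ?G"
          using not_reachable_target[OF reachable_out_reachable[OF less.prems(1)] uC] by blast
        then have u: "u \<in> outputs ?G" using less.prems(2) by (simp add: nodes_def)
        have K: "mechanism M u \<in> markov_kernels (X_space M (Pa ?G u)) (node_space M u)"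
          using M u by (simp add: causal_bayesian_network_def)
        have "points (X_space M (Pa ?G u)) = {}"
        proof (rule ccontr)
          assume "points (X_space M (Pa ?G u)) \<noteq> {}"
          then obtain x where "x \<in> points (X_space M (Pa ?G u))" by blast
          from markov_kernels_points[OF K this]
          obtain \<xi> where "\<xi> \<in> rvars (node_space M u)" by (rule points_P_spaceE)
          from rvars_points[OF qn[OF less.prems(2)] this] show False using less.prems(3) by blast
        qed
        then obtain w where w: "(w, u) \<in> edges ?G" "points (node_space M w) = {}"
          by (auto simp: pX PiE_eq_empty_iff Pa_def)
        show False
          using less.IH[OF w(1) reachable_out_parent[OF less.prems(1) uC w(1)] _ w(2)] edge_nodes[OF w(1)] by blast
      qed
      moreover obtain a where "a \<in> A" "points (node_space M a) = {}"
        using True by (auto simp: pX PiE_eq_empty_iff)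
      moreover from this have "a \<notin> C" using Cne by blast
      ultimately show False
        using reachable_out_start A by blast
    qed
    \<comment> \<open>A space without points has no admissible random variables, so any map out of
      it is vacuously a Markov kernel.\<close>
    then have "(\<lambda>_. undefined) \<in> markov_kernels (X_space M C) (X_space M A)"
      using rvars_points[OF qX[OF C]] by (intro markov_kernelsI qX C) blast
    then show ?thesis by blast
  qed
qed

theorem theorem8p19:
  fixes M :: "('n, 'a) bayes_net" and vs :: "'n list" and A B C :: "'n set"
  assumes "causal_bayesian_network M"
    and "topological_order (graph M) vs"
    and "\<forall>v\<in>outputs (graph M). standard_space (node_space M v)"
    and "A \<subseteq> nodes (graph M)" and "B \<subseteq> nodes (graph M)" and "C \<subseteq> nodes (graph M)"
    and "separated (graph M) A B C"
  shows "cond_independent M (joint_kernel M vs) A B C"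
proof (cases "points (X_space M (inputs (graph M))) = {}")
  case True
  then show ?thesis
    using separated_kernel_exists[OF assms(1,4-7)] unfolding cond_independent_def by auto
next
  case False
  then interpret standard_network M
    using assms(1,3) by unfold_locales auto
  show ?thesis
    using assms by (intro global_markov)
qed

end
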